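(* Suppose that $\Lambda$ is a row-finite $k$-graph without sources, and that $\Lambda$ is both aperiodic and cofinal. Suppose that $\eta:\Lambda\to G$ is a functor into a group $G$, that $\sigma\in Z^2(G,\mathbb{T})$, and that $B$ is the Fell bundle over $G$ with fibres $B_g=\overline{\operatorname{span}}\{s_\lambda s_\mu^*:\eta(\lambda)\eta(\mu)^{-1}=g\}\subset C^*(\Lambda)$. Then $C^*(B(\sigma))$ is simple.
   Context: All groups are discrete. A $k$-graph is a countable small category $\Lambda$ with a functor $d:\Lambda\to\mathbb{N}^k$ satisfying the factorisation property: if $d(\lambda)=m+n$, there are unique $\mu,\nu$ with $\lambda=\mu\nu$, $d(\mu)=m$, $d(\nu)=n$. Range and source (codomain and domain) are written $r,s$, so $\lambda\mu$ is defined exactly when $s(\lambda)=r(\mu)$. $\Lambda^n:=d^{-1}(n)$, $\Lambda^0$ is identified with the set of objects, $v\Lambda:=\{\lambda:r(\lambda)=v\}$, $v\Lambda^n:=v\Lambda\cap\Lambda^n$, $v\Lambda w:=\{\lambda\in v\Lambda:s(\lambda)=w\}$. For $0\le m\le n\le d(\lambda)$, $\lambda(m,n)$ is the unique path of degree $n-m$ with $\lambda=\lambda'\lambda(m,n)\lambda''$, $d(\lambda')=m$, $d(\lambda'')=d(\lambda)-n$. Row-finite without sources means every $v\Lambda^n$ is finite and nonempty. $\Lambda$ is aperiodic if for every $v\in\Lambda^0$ and every $m,n\in\mathbb{N}^k$ with $m\ne n$ there exists $\lambda\in v\Lambda$ such that $d(\lambda)\ge m\vee n$ and $\lambda(m,m+d(\lambda)-(m\vee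 n))\ne\lambda(n,n+d(\lambda)-(m\vee n))$. $\Lambda$ is cofinal if for every pair $v,w\in\Lambda^0$ there exists $n\in\mathbb{N}^k$ such that $v\Lambda s(\lambda)\ne\emptyset$ for every $\lambda\in w\Lambda^n$. $C^*(\Lambda)$ is the universal $C^*$-algebra generated by a Cuntz--Krieger family $\{s_\lambda\}$: the $p_v:=s_v$ ($v\in\Lambda^0$) are mutually orthogonal projections; $s_\lambda s_\mu=s_{\lambda\mu}$ if $s(\lambda)=r(\mu)$; $s_\lambda^*s_\lambda=p_{s(\lambda)}$; $p_v=\sum_{\lambda\in v\Lambda^n}s_\lambda s_\lambda^*$. A functor $\eta:\Lambda\to G$ is a map with $\eta(\lambda\mu)=\eta(\lambda)\eta(\mu)$ for composable $\lambda,\mu$ and $\eta(v)=e$ for $v\in\Lambda^0$. A Fell bundle over $G$ is a set $B$ with a map $p:B\to G$ whose fibres $B_g=p^{-1}(g)$ are complex Banach spaces, with an associative multiplication and an involution such that: $p(bc)=p(b)p(c)$; multiplication is bilinear $B_g\times B_h\to B_{gh}$ with $\|bc\|\le\|b\|\,\|c\|$; $b\mapsto b^*$ is conjugate linear $B_g\to B_{g^{-1}}$ with $(bc)^*=c^*b^*$, $\|b^*b\|=\|b\|^2$ (so $B_e$ is a $C^*$-algebra); and $b^*b\ge0$ in $B_e$. The subspaces $B_g\subset C^*(\Lambda)$ of the claim form such a bundle with the operations and norm of $C^*(\Lambda)$. $Z^2(G,\mathbb{T})$ is the set of $\sigma:G\times G\to\mathbb{T}$ with $\sigma(e,g)=\sigma(g,e)=1$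 and $\sigma(g,h)\sigma(gh,k)=\sigma(g,hk)\sigma(h,k)$. The deformed bundle $B(\sigma)$ is the Fell bundle with the same set, projection and Banach space fibres as $B$, and operations $b\cdot_\sigma c=\sigma(g,h)bc$, $b^{*_\sigma}=\overline{\sigma(g,g^{-1})}b^*$ for $b\in B_g$, $c\in B_h$. A representation of a Fell bundle $B$ in a $C^*$-algebra $C$ consists of linear maps $\pi_g:B_g\to C$ with $\pi_{gh}(bc)=\pi_g(b)\pi_h(c)$, $\pi_g(b)^*=\pi_{g^{-1}}(b^* )$ and $\pi_e$ nondegenerate. $C^*(B)$ is the $C^*$-algebra generated by a universal such representation. A $C^*$-algebra is simple if its only closed two-sided ideals are $\{0\}$ and itself. *)

theory Defs
  imports
    "HOL-Analysis.Abstract_Metric_Spaces"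
    "HOL-Algebra.Module"
    "HOL-Library.Countable_Set"
    "HOL-Library.Function_Algebras"
begin

section \<open>Complex Banach spaces and C*-algebras\<close>

definition complex_ring :: "complex ring" where
  "complex_ring = \<lparr>carrier = UNIV, mult = (*), one = 1, zero = 0, add = (+)\<rparr>"

text \<open>
  Normed spaces and C*-algebras are carrier-based and extend the HOL-Algebra record of modules.
  The field \<open>one\<close> is never used (C*-algebras need not be unital), and for a mere normed
  space \<open>mult\<close> and \<open>star\<close> are not used either.
\<close>

record 'a cnormed = "(complex, 'a) module" +
  nrm :: "'a \<Rightarrow> real"

record 'a cstar = "'a cnormed" +
  star :: "'a \<Rightarrow> 'a"

text \<open>The value off the carrier is immaterial; \<open>Metric_space\<close> requires a distance that is
  symmetric and nonnegative everywhere.\<close>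

definition norm_dist :: "('a, 'm) cnormed_scheme \<Rightarrow> 'a \<Rightarrow> 'a \<Rightarrow> real" where
  "norm_dist V x y = (if x \<in> carrier V \<and> y \<in> carrier V then nrm V (x \<ominus>\<^bsub>V\<^esub> y) else 0)"

abbreviation norm_topology :: "('a, 'm) cnormed_scheme \<Rightarrow> 'a topology" where
  "norm_topology V \<equiv> Metric_space.mtopology (carrier V) (norm_dist V)"

locale complex_normed_space = Module.module complex_ring V for V (structure) +
  assumes norm_nonneg: "x \<in> carrier V \<Longrightarrow> 0 \<le> nrm V x"
    and norm_eq_zero: "x \<in> carrier V \<Longrightarrow> nrm V x = 0 \<longleftrightarrow> x = \<zero>\<^bsub>V\<^esub>"
    and norm_smult: "x \<in> carrier V \<Longrightarrow> nrm V (z \<odot>\<^bsub>V\<^esub> x) = cmod z * nrm V x"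
    and norm_triangle: "x \<in> carrier V \<Longrightarrow> y \<in> carrier V
          \<Longrightarrow> nrm V (x \<oplus>\<^bsub>V\<^esub> y) \<le> nrm V x + nrm V y"

lemma (in complex_normed_space) norm_neg:
  assumes "x \<in> carrier V" shows "nrm V (\<ominus>\<^bsub>V\<^esub> x) = nrm V x"
proof -
  have "\<ominus>\<^bsub>complex_ring\<^esub> \<one>\<^bsub>complex_ring\<^esub> \<odot>\<^bsub>V\<^esub> x = \<ominus>\<^bsub>V\<^esub> x"
    using assms smult_l_minus[of "\<one>\<^bsub>complex_ring\<^esub>" x] by simp
  moreover have "\<ominus>\<^bsub>complex_ring\<^esub> \<one>\<^bsub>complex_ring\<^esub> = (-1 :: complex)"
    using R.l_neg[of "\<one>\<^bsub>complex_ring\<^esub>"] by (simp add: complex_ring_def eq_neg_iff_add_eq_0)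
  ultimately show ?thesis using norm_smult[OF assms, of "-1"] by simp
qed

sublocale complex_normed_space \<subseteq> Metric_space "carrier V" "norm_dist V"
proof
  fix x y
  show "0 \<le> norm_dist V x y"
    by (simp add: norm_dist_def norm_nonneg)
  show "norm_dist V x y = norm_dist V y x"
    using norm_neg[of "x \<ominus>\<^bsub>V\<^esub> y"]
    by (auto simp: norm_dist_def a_minus_def M.minus_add M.a_comm)
next
  fix x y assume "x \<in> carrier V" "y \<in> carrier V"
  then show "norm_dist V x y = 0 \<longleftrightarrow> x = y"
    unfolding norm_dist_def a_minus_def
    by (simp add: norm_eq_zero) (metis M.a_inv_closed M.add.right_cancel M.r_neg)
next
  fix x y z assume xyz: "x \<in> carrier V" "y \<in> carrier V" "z \<in> carrier V"
  have "x \<ominus>\<^bsub>V\<^esub> z = (x \<ominus>\<^bsub>V\<^esub> y) \<oplus>\<^bsub>V\<^esub> (y \<ominus>\<^bsub>V\<^esub> z)"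
    using xyz by (simp add: a_minus_def M.a_assoc M.r_neg1)
  then show "norm_dist V x z \<le> norm_dist V x y + norm_dist V y z"
    using xyz norm_triangle[of "x \<ominus>\<^bsub>V\<^esub> y" "y \<ominus>\<^bsub>V\<^esub> z"] by (simp add: norm_dist_def)
qed

locale complex_banach_space = complex_normed_space +
  assumes complete: "mcomplete"

locale cstar_algebra = complex_banach_space A for A :: "'a cstar" (structure) +
  assumes mult_closed: "x \<in> carrier A \<Longrightarrow> y \<in> carrier A \<Longrightarrow> x \<otimes>\<^bsub>A\<^esub> y \<in> carrier A"
    and mult_assoc: "x \<in> carrier A \<Longrightarrow> y \<in> carrier A \<Longrightarrow> z \<in> carrier A
          \<Longrightarrow> (x \<otimes>\<^bsub>A\<^esub> y) \<otimes>\<^bsub>A\<^esub> z = x \<otimes>\<^bsub>A\<^esub> (y \<otimes>\<^bsub>A\<^esub> z)"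
    and mult_distrib_right: "x \<in> carrier A \<Longrightarrow> y \<in> carrier A \<Longrightarrow> z \<in> carrier A
          \<Longrightarrow> (x \<oplus>\<^bsub>A\<^esub> y) \<otimes>\<^bsub>A\<^esub> z = x \<otimes>\<^bsub>A\<^esub> z \<oplus>\<^bsub>A\<^esub> y \<otimes>\<^bsub>A\<^esub> z"
    and mult_distrib_left: "x \<in> carrier A \<Longrightarrow> y \<in> carrier A \<Longrightarrow> z \<in> carrier A
          \<Longrightarrow> z \<otimes>\<^bsub>A\<^esub> (x \<oplus>\<^bsub>A\<^esub> y) = z \<otimes>\<^bsub>A\<^esub> x \<oplus>\<^bsub>A\<^esub> z \<otimes>\<^bsub>A\<^esub> y"
    and mult_smult_left: "x \<in> carrier A \<Longrightarrow> y \<in> carrier A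
          \<Longrightarrow> (c \<odot>\<^bsub>A\<^esub> x) \<otimes>\<^bsub>A\<^esub> y = c \<odot>\<^bsub>A\<^esub> (x \<otimes>\<^bsub>A\<^esub> y)"
    and mult_smult_right: "x \<in> carrier A \<Longrightarrow> y \<in> carrier A
          \<Longrightarrow> x \<otimes>\<^bsub>A\<^esub> (c \<odot>\<^bsub>A\<^esub> y) = c \<odot>\<^bsub>A\<^esub> (x \<otimes>\<^bsub>A\<^esub> y)"
    and norm_mult: "x \<in> carrier A \<Longrightarrow> y \<in> carrier A
          \<Longrightarrow> nrm A (x \<otimes>\<^bsub>A\<^esub> y) \<le> nrm A x * nrm A y"
    and star_closed: "x \<in> carrier A \<Longrightarrow> star A x \<in> carrier A"
    and star_star: "x \<in> carrier A \<Longrightarrow> star A (star A x) = x"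
    and star_add: "x \<in> carrier A \<Longrightarrow> y \<in> carrier A
          \<Longrightarrow> star A (x \<oplus>\<^bsub>A\<^esub> y) = star A x \<oplus>\<^bsub>A\<^esub> star A y"
    and star_smult: "x \<in> carrier A \<Longrightarrow> star A (c \<odot>\<^bsub>A\<^esub> x) = cnj c \<odot>\<^bsub>A\<^esub> star A x"
    and star_mult: "x \<in> carrier A \<Longrightarrow> y \<in> carrier A
          \<Longrightarrow> star A (x \<otimes>\<^bsub>A\<^esub> y) = star A y \<otimes>\<^bsub>A\<^esub> star A x"
    and cstar_identity: "x \<in> carrier A \<Longrightarrow> nrm A (star A x \<otimes>\<^bsub>A\<^esub> x) = (nrm A x)\<^sup>2"

definition closed_span :: "('a, 'm) cnormed_scheme \<Rightarrow> 'a set \<Rightarrow> 'a set" where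
  "closed_span V S = norm_topology V closure_of ((\<lambda>W. submodule W complex_ring V) hull S)"

definition positive :: "'a cstar \<Rightarrow> 'a \<Rightarrow> bool" where
  "positive A a \<longleftrightarrow> (\<exists>c\<in>carrier A. a = star A c \<otimes>\<^bsub>A\<^esub> c)"

definition cstar_subalgebra :: "'a cstar \<Rightarrow> 'a set \<Rightarrow> bool" where
  "cstar_subalgebra A D \<longleftrightarrow> submodule D complex_ring A \<and> closedin (norm_topology A) D \<and>
     (\<forall>x\<in>D. \<forall>y\<in>D. x \<otimes>\<^bsub>A\<^esub> y \<in> D) \<and> (\<forall>x\<in>D. star A x \<in> D)"

definition cstar_generates :: "'a cstar \<Rightarrow> 'a set \<Rightarrow> bool" where
  "cstar_generates A S \<longleftrightarrow> S \<subseteq> carrier A \<and>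
     (\<forall>D. cstar_subalgebra A D \<and> S \<subseteq> D \<longrightarrow> D = carrier A)"

definition cstar_hom :: "'a cstar \<Rightarrow> 'b cstar \<Rightarrow> ('a \<Rightarrow> 'b) set" where
  "cstar_hom A D = {\<phi> \<in> carrier A \<rightarrow> carrier D.
     (\<forall>x\<in>carrier A. \<forall>y\<in>carrier A. \<phi> (x \<oplus>\<^bsub>A\<^esub> y) = \<phi> x \<oplus>\<^bsub>D\<^esub> \<phi> y \<and>
        \<phi> (x \<otimes>\<^bsub>A\<^esub> y) = \<phi> x \<otimes>\<^bsub>D\<^esub> \<phi> y) \<and>
     (\<forall>x\<in>carrier A. \<forall>c. \<phi> (c \<odot>\<^bsub>A\<^esub> x) = c \<odot>\<^bsub>D\<^esub> \<phi> x) \<and>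
     (\<forall>x\<in>carrier A. \<phi> (star A x) = star D (\<phi> x))}"

definition closed_ideal :: "'a cstar \<Rightarrow> 'a set \<Rightarrow> bool" where
  "closed_ideal A I \<longleftrightarrow> submodule I complex_ring A \<and> closedin (norm_topology A) I \<and>
     (\<forall>a\<in>I. \<forall>x\<in>carrier A. x \<otimes>\<^bsub>A\<^esub> a \<in> I \<and> a \<otimes>\<^bsub>A\<^esub> x \<in> I)"

definition simple_cstar_algebra :: "'a cstar \<Rightarrow> bool" where
  "simple_cstar_algebra A \<longleftrightarrow> cstar_algebra A \<and>
     (\<forall>I. closed_ideal A I \<longrightarrow> I = {\<zero>\<^bsub>A\<^esub>} \<or> I = carrier A)"


section \<open>Higher-rank graphs\<close>

definition Nk :: "nat \<Rightarrow> (nat \<Rightarrow> nat) set" where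
  "Nk k = {n. \<forall>i\<ge>k. n i = 0}"

text \<open>Arrows-only presentation of a small category: an object is identified with its identity
  morphism, so \<open>rng\<close> and \<open>src\<close> take values in the morphisms; \<open>pcomp \<Lambda> \<kappa> \<mu>\<close> is
  meaningful when \<open>src \<Lambda> \<kappa> = rng \<Lambda> \<mu>\<close>. Order, supremum and
  arithmetic on degrees are pointwise.\<close>

record 'l kgraph =
  paths :: "'l set"
  rng :: "'l \<Rightarrow> 'l"
  src :: "'l \<Rightarrow> 'l"
  pcomp :: "'l \<Rightarrow> 'l \<Rightarrow> 'l"
  deg :: "'l \<Rightarrow> nat \<Rightarrow> nat"

locale k_graph =
  fixes k :: nat and \<Lambda> :: "'l kgraph"
  assumes countable_paths: "countable (paths \<Lambda>)"
    and rng_closed: "\<kappa> \<in> paths \<Lambda> \<Longrightarrow> rng \<Lambda> \<kappa> \<in> paths \<Lambda>"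
    and src_closed: "\<kappa> \<in> paths \<Lambda> \<Longrightarrow> src \<Lambda> \<kappa> \<in> paths \<Lambda>"
    and rng_rng: "\<kappa> \<in> paths \<Lambda> \<Longrightarrow> rng \<Lambda> (rng \<Lambda> \<kappa>) = rng \<Lambda> \<kappa>"
    and src_rng: "\<kappa> \<in> paths \<Lambda> \<Longrightarrow> src \<Lambda> (rng \<Lambda> \<kappa>) = rng \<Lambda> \<kappa>"
    and rng_src: "\<kappa> \<in> paths \<Lambda> \<Longrightarrow> rng \<Lambda> (src \<Lambda> \<kappa>) = src \<Lambda> \<kappa>"
    and src_src: "\<kappa> \<in> paths \<Lambda> \<Longrightarrow> src \<Lambda> (src \<Lambda> \<kappa>) = src \<Lambda> \<kappa>"
    and pcomp_closed: "\<kappa> \<in> paths \<Lambda> \<Longrightarrow> \<mu> \<in> paths \<Lambda> \<Longrightarrow> src \<Lambda> \<kappa> = rng \<Lambda> \<mu>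
          \<Longrightarrow> pcomp \<Lambda> \<kappa> \<mu> \<in> paths \<Lambda>"
    and rng_pcomp: "\<kappa> \<in> paths \<Lambda> \<Longrightarrow> \<mu> \<in> paths \<Lambda> \<Longrightarrow> src \<Lambda> \<kappa> = rng \<Lambda> \<mu>
          \<Longrightarrow> rng \<Lambda> (pcomp \<Lambda> \<kappa> \<mu>) = rng \<Lambda> \<kappa>"
    and src_pcomp: "\<kappa> \<in> paths \<Lambda> \<Longrightarrow> \<mu> \<in> paths \<Lambda> \<Longrightarrow> src \<Lambda> \<kappa> = rng \<Lambda> \<mu>
          \<Longrightarrow> src \<Lambda> (pcomp \<Lambda> \<kappa> \<mu>) = src \<Lambda> \<mu>"
    and pcomp_assoc: "\<kappa> \<in> paths \<Lambda> \<Longrightarrow> \<mu> \<in> paths \<Lambda> \<Longrightarrow> \<nu> \<in> paths \<Lambda>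
          \<Longrightarrow> src \<Lambda> \<kappa> = rng \<Lambda> \<mu> \<Longrightarrow> src \<Lambda> \<mu> = rng \<Lambda> \<nu>
          \<Longrightarrow> pcomp \<Lambda> (pcomp \<Lambda> \<kappa> \<mu>) \<nu> = pcomp \<Lambda> \<kappa> (pcomp \<Lambda> \<mu> \<nu>)"
    and pcomp_rng: "\<kappa> \<in> paths \<Lambda> \<Longrightarrow> pcomp \<Lambda> (rng \<Lambda> \<kappa>) \<kappa> = \<kappa>"
    and pcomp_src: "\<kappa> \<in> paths \<Lambda> \<Longrightarrow> pcomp \<Lambda> \<kappa> (src \<Lambda> \<kappa>) = \<kappa>"
    and deg_closed: "\<kappa> \<in> paths \<Lambda> \<Longrightarrow> deg \<Lambda> \<kappa> \<in> Nk k"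
    and deg_identity: "\<kappa> \<in> paths \<Lambda> \<Longrightarrow> deg \<Lambda> (rng \<Lambda> \<kappa>) = 0"
    and deg_pcomp: "\<kappa> \<in> paths \<Lambda> \<Longrightarrow> \<mu> \<in> paths \<Lambda> \<Longrightarrow> src \<Lambda> \<kappa> = rng \<Lambda> \<mu>
          \<Longrightarrow> deg \<Lambda> (pcomp \<Lambda> \<kappa> \<mu>) = deg \<Lambda> \<kappa> + deg \<Lambda> \<mu>"
    and factorisation: "\<kappa> \<in> paths \<Lambda> \<Longrightarrow> m \<in> Nk k \<Longrightarrow> n \<in> Nk k \<Longrightarrow> deg \<Lambda> \<kappa> = m + n
          \<Longrightarrow> \<exists>!(\<mu>, \<nu>). \<mu> \<in> paths \<Lambda> \<and> \<nu> \<in> paths \<Lambda> \<and> src \<Lambda> \<mu> = rng \<Lambda> \<nu> \<and>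
                pcomp \<Lambda> \<mu> \<nu> = \<kappa> \<and> deg \<Lambda> \<mu> = m \<and> deg \<Lambda> \<nu> = n"

definition vertices :: "'l kgraph \<Rightarrow> 'l set" where
  "vertices \<Lambda> = {v \<in> paths \<Lambda>. deg \<Lambda> v = 0}"

definition paths_at :: "'l kgraph \<Rightarrow> 'l \<Rightarrow> 'l set" where
  "paths_at \<Lambda> v = {\<kappa> \<in> paths \<Lambda>. rng \<Lambda> \<kappa> = v}"

definition paths_at_deg :: "'l kgraph \<Rightarrow> 'l \<Rightarrow> (nat \<Rightarrow> nat) \<Rightarrow> 'l set" where
  "paths_at_deg \<Lambda> v n = {\<kappa> \<in> paths_at \<Lambda> v. deg \<Lambda> \<kappa> = n}"

definition row_finite_no_sources :: "nat \<Rightarrow> 'l kgraph \<Rightarrow> bool" where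
  "row_finite_no_sources k \<Lambda> \<longleftrightarrow> (\<forall>v\<in>vertices \<Lambda>. \<forall>n\<in>Nk k.
     finite (paths_at_deg \<Lambda> v n) \<and> paths_at_deg \<Lambda> v n \<noteq> {})"

text \<open>The path \<open>\<kappa>(m,n)\<close>, for \<open>m \<le> n \<le> deg \<Lambda> \<kappa>\<close>.\<close>

definition segment :: "'l kgraph \<Rightarrow> 'l \<Rightarrow> (nat \<Rightarrow> nat) \<Rightarrow> (nat \<Rightarrow> nat) \<Rightarrow> 'l" where
  "segment \<Lambda> \<kappa> m n = (THE \<nu>. \<nu> \<in> paths \<Lambda> \<and> deg \<Lambda> \<nu> = n - m \<and>
     (\<exists>\<kappa>'\<in>paths \<Lambda>. \<exists>\<kappa>''\<in>paths \<Lambda>. src \<Lambda> \<kappa>' = rng \<Lambda> \<nu> \<and> src \<Lambda> \<nu> = rng \<Lambda> \<kappa>'' \<and>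
        deg \<Lambda> \<kappa>' = m \<and> deg \<Lambda> \<kappa>'' = deg \<Lambda> \<kappa> - n \<and>
        \<kappa> = pcomp \<Lambda> (pcomp \<Lambda> \<kappa>' \<nu>) \<kappa>''))"

definition kgraph_aperiodic :: "nat \<Rightarrow> 'l kgraph \<Rightarrow> bool" where
  "kgraph_aperiodic k \<Lambda> \<longleftrightarrow> (\<forall>v\<in>vertices \<Lambda>. \<forall>m\<in>Nk k. \<forall>n\<in>Nk k. m \<noteq> n \<longrightarrow>
     (\<exists>\<kappa>\<in>paths_at \<Lambda> v. sup m n \<le> deg \<Lambda> \<kappa> \<and>
        segment \<Lambda> \<kappa> m (m + deg \<Lambda> \<kappa> - sup m n) \<noteq> segment \<Lambda> \<kappa> n (n + deg \<Lambda> \<kappa> - sup m n)))"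

definition kgraph_cofinal :: "nat \<Rightarrow> 'l kgraph \<Rightarrow> bool" where
  "kgraph_cofinal k \<Lambda> \<longleftrightarrow> (\<forall>v\<in>vertices \<Lambda>. \<forall>w\<in>vertices \<Lambda>. \<exists>n\<in>Nk k.
     \<forall>\<kappa>\<in>paths_at_deg \<Lambda> w n. {\<mu> \<in> paths_at \<Lambda> v. src \<Lambda> \<mu> = src \<Lambda> \<kappa>} \<noteq> {})"

definition kgraph_functor :: "'l kgraph \<Rightarrow> ('g, 'm) monoid_scheme \<Rightarrow> ('l \<Rightarrow> 'g) \<Rightarrow> bool" where
  "kgraph_functor \<Lambda> G \<eta> \<longleftrightarrow> \<eta> \<in> paths \<Lambda> \<rightarrow> carrier G \<and>
     (\<forall>\<kappa>\<in>paths \<Lambda>. \<forall>\<mu>\<in>paths \<Lambda>. src \<Lambda> \<kappa> = rng \<Lambda> \<mu> \<longrightarrow>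
        \<eta> (pcomp \<Lambda> \<kappa> \<mu>) = \<eta> \<kappa> \<otimes>\<^bsub>G\<^esub> \<eta> \<mu>) \<and>
     (\<forall>v\<in>vertices \<Lambda>. \<eta> v = \<one>\<^bsub>G\<^esub>)"


section \<open>The C*-algebra of a higher-rank graph\<close>

definition cuntz_krieger_family :: "nat \<Rightarrow> 'l kgraph \<Rightarrow> 'a cstar \<Rightarrow> ('l \<Rightarrow> 'a) \<Rightarrow> bool" where
  "cuntz_krieger_family k \<Lambda> A s \<longleftrightarrow> s \<in> paths \<Lambda> \<rightarrow> carrier A \<and>
     (\<forall>v\<in>vertices \<Lambda>. s v \<otimes>\<^bsub>A\<^esub> s v = s v \<and> star A (s v) = s v) \<and>
     (\<forall>v\<in>vertices \<Lambda>. \<forall>w\<in>vertices \<Lambda>. v \<noteq> w \<longrightarrow> s v \<otimes>\<^bsub>A\<^esub> s w = \<zero>\<^bsub>A\<^esub>) \<and>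
     (\<forall>\<kappa>\<in>paths \<Lambda>. \<forall>\<mu>\<in>paths \<Lambda>. src \<Lambda> \<kappa> = rng \<Lambda> \<mu> \<longrightarrow>
        s \<kappa> \<otimes>\<^bsub>A\<^esub> s \<mu> = s (pcomp \<Lambda> \<kappa> \<mu>)) \<and>
     (\<forall>\<kappa>\<in>paths \<Lambda>. star A (s \<kappa>) \<otimes>\<^bsub>A\<^esub> s \<kappa> = s (src \<Lambda> \<kappa>)) \<and>
     (\<forall>v\<in>vertices \<Lambda>. \<forall>n\<in>Nk k.
        s v = finsum A (\<lambda>\<kappa>. s \<kappa> \<otimes>\<^bsub>A\<^esub> star A (s \<kappa>)) (paths_at_deg \<Lambda> v n))"

text \<open>\<open>is_graph_cstar k \<Lambda> A s\<close>: \<open>A\<close>, generated by \<open>s\<close>, is a copy of $C^*(\Lambda)$.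

  In HOL the universal property can only be tested against C*-algebras \<open>D\<close> whose carrier lies in
  one type; here it is the type \<open>'a\<close> of \<open>A\<close>. Nothing is lost. On the one hand, an algebra that is
  universal for all C*-algebras is in particular universal for these. On the other hand, as
  \<open>\<Lambda>\<close> is countable, every C*-algebra generated by a Cuntz--Krieger family is separable, hence of
  cardinality at most that of the continuum, whereas every nonzero C*-algebra has at least that
  cardinality. So either all the C*-algebras generated by Cuntz--Krieger families (including
  $C^*(\Lambda)$ itself) have copies carried by subsets of \<open>'a\<close>, or \<open>A\<close> is zero. The same applies to
  \<open>is_bundle_cstar\<close> below when only countably many fibres are nonzero and these are separable, as
  for the bundles \<open>graph_bundle\<close> and their deformations.\<close>

definition is_graph_cstar :: "nat \<Rightarrow> 'l kgraph \<Rightarrow> 'a cstar \<Rightarrow> ('l \<Rightarrow> 'a) \<Rightarrow> bool" where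
  "is_graph_cstar k \<Lambda> A s \<longleftrightarrow> cstar_algebra A \<and> cuntz_krieger_family k \<Lambda> A s \<and>
     cstar_generates A (s ` paths \<Lambda>) \<and>
     (\<forall>(D :: 'a cstar) t. cstar_algebra D \<and> cuntz_krieger_family k \<Lambda> D t \<longrightarrow>
        (\<exists>\<phi>\<in>cstar_hom A D. \<forall>\<kappa>\<in>paths \<Lambda>. \<phi> (s \<kappa>) = t \<kappa>))"


section \<open>Fell bundles\<close>

text \<open>The carrier is the total space. Addition and scalar multiplication are only meaningful
  within a fibre, and \<open>fzero B g\<close> is the zero of the fibre over \<open>g\<close>.\<close>

record ('g, 'b) fell = "'b partial_object" +
  proj :: "'b \<Rightarrow> 'g"
  fzero :: "'g \<Rightarrow> 'b"
  fadd :: "'b \<Rightarrow> 'b \<Rightarrow> 'b"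
  fsmult :: "complex \<Rightarrow> 'b \<Rightarrow> 'b"
  fnorm :: "'b \<Rightarrow> real"
  fmult :: "'b \<Rightarrow> 'b \<Rightarrow> 'b"
  fstar :: "'b \<Rightarrow> 'b"

text \<open>Over the identity this is the C*-algebra $B_e$; over the other group elements only the
  Banach space structure of the fibre is meaningful.\<close>

definition fibre :: "('g, 'b) fell \<Rightarrow> 'g \<Rightarrow> 'b cstar" where
  "fibre B g = \<lparr>carrier = {b \<in> carrier B. proj B b = g}, mult = fmult B, one = undefined,
     zero = fzero B g, add = fadd B, smult = fsmult B, nrm = fnorm B, star = fstar B\<rparr>"

locale fell_bundle = group G for G (structure) and B :: "('g, 'b) fell" +
  assumes proj_closed: "b \<in> carrier B \<Longrightarrow> proj B b \<in> carrier G"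
    and fibre_banach: "g \<in> carrier G \<Longrightarrow> complex_banach_space (fibre B g)"
    and fmult_closed: "b \<in> carrier B \<Longrightarrow> c \<in> carrier B \<Longrightarrow> fmult B b c \<in> carrier B"
    and proj_fmult: "b \<in> carrier B \<Longrightarrow> c \<in> carrier B
          \<Longrightarrow> proj B (fmult B b c) = proj B b \<otimes>\<^bsub>G\<^esub> proj B c"
    and fmult_assoc: "b \<in> carrier B \<Longrightarrow> c \<in> carrier B \<Longrightarrow> d \<in> carrier B
          \<Longrightarrow> fmult B (fmult B b c) d = fmult B b (fmult B c d)"
    and fmult_add_left: "b \<in> carrier B \<Longrightarrow> b' \<in> carrier B \<Longrightarrow> c \<in> carrier B \<Longrightarrow> proj B b = proj B b'
          \<Longrightarrow> fmult B (fadd B b b') c = fadd B (fmult B b c) (fmult B b' c)"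
    and fmult_add_right: "b \<in> carrier B \<Longrightarrow> c \<in> carrier B \<Longrightarrow> c' \<in> carrier B \<Longrightarrow> proj B c = proj B c'
          \<Longrightarrow> fmult B b (fadd B c c') = fadd B (fmult B b c) (fmult B b c')"
    and fmult_smult_left: "b \<in> carrier B \<Longrightarrow> c \<in> carrier B
          \<Longrightarrow> fmult B (fsmult B z b) c = fsmult B z (fmult B b c)"
    and fmult_smult_right: "b \<in> carrier B \<Longrightarrow> c \<in> carrier B
          \<Longrightarrow> fmult B b (fsmult B z c) = fsmult B z (fmult B b c)"
    and fnorm_fmult: "b \<in> carrier B \<Longrightarrow> c \<in> carrier B
          \<Longrightarrow> fnorm B (fmult B b c) \<le> fnorm B b * fnorm B c"
    and fstar_closed: "b \<in> carrier B \<Longrightarrow> fstar B b \<in> carrier B"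
    and proj_fstar: "b \<in> carrier B \<Longrightarrow> proj B (fstar B b) = inv\<^bsub>G\<^esub> (proj B b)"
    and fstar_fstar: "b \<in> carrier B \<Longrightarrow> fstar B (fstar B b) = b"
    and fstar_add: "b \<in> carrier B \<Longrightarrow> b' \<in> carrier B \<Longrightarrow> proj B b = proj B b'
          \<Longrightarrow> fstar B (fadd B b b') = fadd B (fstar B b) (fstar B b')"
    and fstar_smult: "b \<in> carrier B \<Longrightarrow> fstar B (fsmult B z b) = fsmult B (cnj z) (fstar B b)"
    and fstar_fmult: "b \<in> carrier B \<Longrightarrow> c \<in> carrier B
          \<Longrightarrow> fstar B (fmult B b c) = fmult B (fstar B c) (fstar B b)"
    and fell_cstar_identity: "b \<in> carrier B \<Longrightarrow> fnorm B (fmult B (fstar B b) b) = (fnorm B b)\<^sup>2"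
    and fell_positive: "b \<in> carrier B \<Longrightarrow> positive (fibre B \<one>\<^bsub>G\<^esub>) (fmult B (fstar B b) b)"

definition fell_representation ::
    "('g, 'm) monoid_scheme \<Rightarrow> ('g, 'b) fell \<Rightarrow> 'c cstar \<Rightarrow> ('b \<Rightarrow> 'c) \<Rightarrow> bool" where
  "fell_representation G B C \<pi> \<longleftrightarrow> \<pi> \<in> carrier B \<rightarrow> carrier C \<and>
     (\<forall>b\<in>carrier B. \<forall>b'\<in>carrier B. proj B b = proj B b' \<longrightarrow>
        \<pi> (fadd B b b') = \<pi> b \<oplus>\<^bsub>C\<^esub> \<pi> b') \<and>
     (\<forall>b\<in>carrier B. \<forall>z. \<pi> (fsmult B z b) = z \<odot>\<^bsub>C\<^esub> \<pi> b) \<and>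
     (\<forall>b\<in>carrier B. \<forall>c\<in>carrier B. \<pi> (fmult B b c) = \<pi> b \<otimes>\<^bsub>C\<^esub> \<pi> c) \<and>
     (\<forall>b\<in>carrier B. \<pi> (fstar B b) = star C (\<pi> b)) \<and>
     closed_span C {\<pi> b \<otimes>\<^bsub>C\<^esub> c |b c. b \<in> carrier (fibre B \<one>\<^bsub>G\<^esub>) \<and> c \<in> carrier C} = carrier C"

text \<open>\<open>is_bundle_cstar G B C \<pi>\<close>: \<open>C\<close>, with the representation \<open>\<pi>\<close>, is a copy of $C^*(B)$.\<close>

definition is_bundle_cstar ::
    "('g, 'm) monoid_scheme \<Rightarrow> ('g, 'b) fell \<Rightarrow> 'c cstar \<Rightarrow> ('b \<Rightarrow> 'c) \<Rightarrow> bool" where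
  "is_bundle_cstar G B C \<pi> \<longleftrightarrow> cstar_algebra C \<and> fell_representation G B C \<pi> \<and>
     cstar_generates C (\<pi> ` carrier B) \<and>
     (\<forall>(D :: 'c cstar) \<rho>. cstar_algebra D \<and> fell_representation G B D \<rho> \<longrightarrow>
        (\<exists>\<phi>\<in>cstar_hom C D. \<forall>b\<in>carrier B. \<phi> (\<pi> b) = \<rho> b))"

definition cocycles :: "('g, 'm) monoid_scheme \<Rightarrow> ('g \<Rightarrow> 'g \<Rightarrow> complex) set" where
  "cocycles G = {\<sigma>.
     (\<forall>g\<in>carrier G. \<forall>h\<in>carrier G. cmod (\<sigma> g h) = 1) \<and>
     (\<forall>g\<in>carrier G. \<sigma> \<one>\<^bsub>G\<^esub> g = 1 \<and> \<sigma> g \<one>\<^bsub>G\<^esub> = 1) \<and>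
     (\<forall>g\<in>carrier G. \<forall>h\<in>carrier G. \<forall>l\<in>carrier G.
        \<sigma> g h * \<sigma> (g \<otimes>\<^bsub>G\<^esub> h) l = \<sigma> g (h \<otimes>\<^bsub>G\<^esub> l) * \<sigma> h l)}"

definition deformed_bundle ::
    "('g, 'm) monoid_scheme \<Rightarrow> ('g \<Rightarrow> 'g \<Rightarrow> complex) \<Rightarrow> ('g, 'b) fell \<Rightarrow> ('g, 'b) fell" where
  "deformed_bundle G \<sigma> B = B\<lparr>
     fmult := (\<lambda>b c. fsmult B (\<sigma> (proj B b) (proj B c)) (fmult B b c)),
     fstar := (\<lambda>b. fsmult B (cnj (\<sigma> (proj B b) (inv\<^bsub>G\<^esub> (proj B b)))) (fstar B b))\<rparr>"

definition graph_fibre :: "'l kgraph \<Rightarrow> ('g, 'm) monoid_scheme \<Rightarrow> ('l \<Rightarrow> 'g) \<Rightarrow>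
    'a cstar \<Rightarrow> ('l \<Rightarrow> 'a) \<Rightarrow> 'g \<Rightarrow> 'a set" where
  "graph_fibre \<Lambda> G \<eta> A s g = closed_span A {s \<kappa> \<otimes>\<^bsub>A\<^esub> star A (s \<mu>) |\<kappa> \<mu>.
     \<kappa> \<in> paths \<Lambda> \<and> \<mu> \<in> paths \<Lambda> \<and> \<eta> \<kappa> \<otimes>\<^bsub>G\<^esub> inv\<^bsub>G\<^esub> (\<eta> \<mu>) = g}"

text \<open>The total space is the disjoint union of the subspaces $B_g$ of \<open>A\<close>, i.e. the element \<open>a\<close>
  of $B_g$ is represented by the pair \<open>(a, g)\<close>.\<close>

definition graph_bundle :: "'l kgraph \<Rightarrow> ('g, 'm) monoid_scheme \<Rightarrow> ('l \<Rightarrow> 'g) \<Rightarrow>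
    'a cstar \<Rightarrow> ('l \<Rightarrow> 'a) \<Rightarrow> ('g, 'a \<times> 'g) fell" where
  "graph_bundle \<Lambda> G \<eta> A s = \<lparr>
     carrier = {(a, g). g \<in> carrier G \<and> a \<in> graph_fibre \<Lambda> G \<eta> A s g},
     proj = snd,
     fzero = (\<lambda>g. (\<zero>\<^bsub>A\<^esub>, g)),
     fadd = (\<lambda>(a, g) (b, h). (a \<oplus>\<^bsub>A\<^esub> b, g)),
     fsmult = (\<lambda>z (a, g). (z \<odot>\<^bsub>A\<^esub> a, g)),
     fnorm = (\<lambda>(a, g). nrm A a),
     fmult = (\<lambda>(a, g) (b, h). (a \<otimes>\<^bsub>A\<^esub> b, g \<otimes>\<^bsub>G\<^esub> h)),
     fstar = (\<lambda>(a, g). (star A a, inv\<^bsub>G\<^esub> g))\<rparr>"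

end

theory Submission
  imports Defs "HOL-Computational_Algebra.Polynomial"
begin

text \<open>
  The elements \<open>t \<kappa> = \<pi> (s \<kappa>, \<eta> \<kappa>)\<close> satisfy the Cuntz--Krieger relations up to unimodular
  factors, and the products \<open>t \<kappa> (t \<mu>)\<^sup>*\<close> span a dense subalgebra. It suffices that a closed
  ideal \<open>I\<close> containing no vertex projection is zero: if \<open>I\<close> contains one, cofinality gives all
  the others.

  Let \<open>c\<close> be a finite linear combination of the \<open>t \<kappa> (t \<mu>)\<^sup>*\<close>. Aperiodicity yields a path \<open>\<xi>\<close>
  such that compression by \<open>t \<xi>\<close> kills all but one of the homogeneous components of \<open>c\<close> (for
  the grading by \<open>deg \<kappa> - deg \<mu>\<close>), so each of them has norm at most the norm of any \<open>z\<close>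
  with \<open>z - c \<in> I\<close>. The number of components of \<open>(c\<^sup>* c)\<^sup>n\<close> is polynomial in \<open>n\<close>. By
  the C*-identity, taking \<open>n\<close>-th roots gives that \<open>c\<close> itself has norm at most that of \<open>z\<close>,
  and \<open>I = 0\<close> follows by density.
\<close>

section \<open>Normed spaces and C*-algebras\<close>

text \<open>The infimum of the norms of the \<open>z\<close> with \<open>z - c\<close> in
  \<open>I\<close> is the norm of \<open>c\<close> in the quotient by \<open>I\<close>, so the
  estimate says that the quotient map is isometric on a dense subalgebra; the quotient itself is
  never formed. Powers help because the degrees that occur in the \<open>n\<close>-th power of
  \<open>star A c \<otimes> c\<close> spread only linearly in \<open>n\<close>. Exponents are powers
  of two because these are what repeated use of the C*-identity reaches.

  Two obstacles shape the rest. The Cuntz-Krieger relations say that the range projections of one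
  degree sum to a vertex projection, not that they are mutually orthogonal. The textbook deduction
  uses the order on self-adjoint elements; here it is replaced by an estimate around an extreme
  point of a unit ball. Moreover a representation of a Fell bundle is purely algebraic, whereas the
  products of generators span the fibres only densely. Its continuity is obtained from an algebraic
  relation between an element and a square root, which every *-homomorphism preserves.\<close>

lemma le_of_power_two_powers:
  fixes a b K :: real
  assumes "0 \<le> a" "0 \<le> b" and le: "\<And>j. a ^ (2 ^ j) \<le> K ^ Suc j * b ^ (2 ^ j)"
  shows "a \<le> b"
proof (rule ccontr)
  assume "\<not> a \<le> b"
  then have ab: "b < a" "0 < a" using \<open>0 \<le> b\<close> by auto
  \<comment> \<open>If \<open>b < a\<close>, then \<open>r ^ 2 ^ j\<close> decays doubly
    exponentially in \<open>j\<close> and defeats the growth of \<open>K ^ Suc j\<close>, against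
    \<open>one_le\<close>.\<close>
  define r where "r = b / a"
  have r: "0 \<le> r" "r < 1" using ab \<open>0 \<le> b\<close> by (auto simp: r_def)
  have one_le: "1 \<le> K ^ Suc j * r ^ (2 ^ j)" for j
  proof -
    have "a ^ (2 ^ j) / a ^ (2 ^ j) \<le> (K ^ Suc j * b ^ (2 ^ j)) / a ^ (2 ^ j)"
      using le[of j] ab by (intro divide_right_mono) auto
    then show ?thesis using ab by (simp add: r_def power_divide)
  qed
  have K: "0 < K" "r \<noteq> 0" using one_le[of 0] r
    by (auto simp: not_less[symmetric] intro: ccontr mult_nonpos_nonneg) (smt (verit) mult_nonpos_nonneg)
  obtain N where N: "K * r ^ N < 1 / 2"
  proof -
    have "(\<lambda>j. K * r ^ j) \<longlonglongrightarrow> K * 0" using r by (intro tendsto_mult_left LIMSEQ_realpow_zero) auto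
    then have "eventually (\<lambda>j. K * r ^ j < 1 / 2) sequentially"
      by (rule order_tendstoD) auto
    then show thesis using that by (auto simp: eventually_sequentially)
  qed
  \<comment> \<open>The maximum with 1 permits division by \<open>M\<close> below.\<close>
  define M where "M = max N 1"
  have M: "K * r ^ M < 1 / 2" "1 \<le> M"
  proof -
    have "r ^ M \<le> r ^ N" using r by (intro power_decreasing) (auto simp: M_def)
    then show "K * r ^ M < 1 / 2" using N K by (smt (verit) mult_left_mono)
  qed (simp add: M_def)
  \<comment> \<open>The exponent \<open>2 ^ j\<close> then has room to pair each of the
    \<open>Suc j\<close> factors \<open>K\<close> with its own \<open>r ^ M\<close>; every such pair
    is below 1/2.\<close>
  have "\<exists>j. M * Suc j \<le> 2 ^ j"
  proof -
    have "(\<lambda>j. real (Suc j) * (1/2) ^ j) \<longlonglongrightarrow> 0"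
    proof -
      have "(\<lambda>j. real j * (1/2::real) ^ j) \<longlonglongrightarrow> 0" by (intro powser_times_n_limit_0) auto
      moreover have "(\<lambda>j. (1/2::real) ^ j) \<longlonglongrightarrow> 0" by (intro LIMSEQ_realpow_zero) auto
      ultimately have "(\<lambda>j. real j * (1/2::real) ^ j + (1/2) ^ j) \<longlonglongrightarrow> 0 + 0" by (rule tendsto_add)
      then show ?thesis by (simp add: algebra_simps)
    qed
    then have "eventually (\<lambda>j. real (Suc j) * (1/2) ^ j < 1 / real M) sequentially"
      using M by (intro order_tendstoD) auto
    then obtain j where "real (Suc j) * (1/2) ^ j < 1 / real M" by (auto simp: eventually_sequentially)
    then have "real (M * Suc j) < real (2 ^ j)" using M by (simp add: field_simps)
    then show ?thesis using of_nat_less_iff less_imp_le by blast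
  qed
  then obtain j where j: "M * Suc j \<le> 2 ^ j" by blast
  have "K ^ Suc j * r ^ (2 ^ j) \<le> K ^ Suc j * r ^ (M * Suc j)"
    using r K j by (intro mult_left_mono power_decreasing) auto
  also have "\<dots> = (K * r ^ M) ^ Suc j" by (simp only: power_mult power_mult_distrib)
  also have "\<dots> < 1" using M K r by (intro power_less_one_iff[THEN iffD2]) auto
  finally show False using one_le[of j] by simp
qed

section \<open>Carrier-based normed spaces\<close>

context complex_normed_space
begin

lemma complex_ring_simps [simp]:
  "carrier complex_ring = UNIV" "x \<oplus>\<^bsub>complex_ring\<^esub> y = x + y" "x \<otimes>\<^bsub>complex_ring\<^esub> y = x * y"
  "\<zero>\<^bsub>complex_ring\<^esub> = 0" "\<one>\<^bsub>complex_ring\<^esub> = 1"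
  by (simp_all add: complex_ring_def)

lemma scale_closed [simp]: "x \<in> carrier V \<Longrightarrow> z \<odot> x \<in> carrier V"
  using smult_closed by simp

lemma scale_add_left: "x \<in> carrier V \<Longrightarrow> (y + z) \<odot> x = y \<odot> x \<oplus> z \<odot> x"
  using smult_l_distr[of y z x] by simp

lemma scale_add_right: "x \<in> carrier V \<Longrightarrow> y \<in> carrier V \<Longrightarrow> z \<odot> (x \<oplus> y) = z \<odot> x \<oplus> z \<odot> y"
  using smult_r_distr[of z x y] by simp

lemma scale_scale [simp]: "x \<in> carrier V \<Longrightarrow> y \<odot> (z \<odot> x) = (y * z) \<odot> x"
  using smult_assoc1[of y z x] by simp

lemma scale_one [simp]: "x \<in> carrier V \<Longrightarrow> 1 \<odot> x = x"
  using smult_one by simp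

lemma scale_zero_left [simp]: "x \<in> carrier V \<Longrightarrow> 0 \<odot> x = \<zero>"
  using smult_l_null[of x] by simp

lemma scale_zero_right [simp]: "z \<odot> \<zero> = \<zero>"
  using smult_r_null[of z] by simp

lemma neg_eq_scale: "x \<in> carrier V \<Longrightarrow> \<ominus> x = (-1) \<odot> x"
  by (metis M.minus_equality M.r_neg M.a_inv_closed scale_add_left scale_closed scale_one
      scale_zero_left add.left_inverse)

text \<open>Multiplication and star are linear for sums and scalar multiples; in this form
  differences inherit that linearity.\<close>

lemma diff_eq_scale: "x \<in> carrier V \<Longrightarrow> y \<in> carrier V \<Longrightarrow> x \<ominus> y = x \<oplus> (-1) \<odot> y"
  by (simp add: a_minus_def neg_eq_scale)

lemma norm_zero [simp]: "nrm V \<zero> = 0"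
  by (simp add: norm_eq_zero)

lemma norm_diff_commute: "x \<in> carrier V \<Longrightarrow> y \<in> carrier V \<Longrightarrow> nrm V (x \<ominus> y) = nrm V (y \<ominus> x)"
  using commute[of x y] by (simp add: norm_dist_def)

lemma norm_diff_triangle:
  "x \<in> carrier V \<Longrightarrow> y \<in> carrier V \<Longrightarrow> nrm V (x \<ominus> y) \<le> nrm V x + nrm V y"
  using norm_triangle[of x "\<ominus> y"] by (simp add: a_minus_def norm_neg)

lemma norm_le_add_diff:
  assumes "x \<in> carrier V" "y \<in> carrier V" shows "nrm V x \<le> nrm V y + nrm V (x \<ominus> y)"
proof -
  have "x = y \<oplus> (x \<ominus> y)"
    using assms by (metis M.a_comm M.minus_closed a_minus_def M.a_assoc M.l_neg M.r_zero M.a_inv_closed)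
  then show ?thesis using norm_triangle[of y "x \<ominus> y"] assms by auto
qed

lemma finsum_closed' [simp]: "f \<in> S \<rightarrow> carrier V \<Longrightarrow> finsum V f S \<in> carrier V"
  by (rule M.finsum_closed)

lemma norm_finsum:
  fixes K :: real
  assumes "finite S" "\<And>i. i \<in> S \<Longrightarrow> f i \<in> carrier V" "\<And>i. i \<in> S \<Longrightarrow> nrm V (f i) \<le> K"
  shows "nrm V (finsum V f S) \<le> card S * K"
  using assms
proof (induction S)
  case (insert i S)
  then have "nrm V (finsum V f (insert i S)) = nrm V (f i \<oplus> finsum V f S)"
    by (subst M.finsum_insert) auto
  also have "\<dots> \<le> nrm V (f i) + nrm V (finsum V f S)"
    using insert by (intro norm_triangle) auto
  also have "\<dots> \<le> K + card S * K" using insert by (intro add_mono insert.IH) auto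
  finally show ?case using insert by (simp add: algebra_simps)
qed simp

lemma closure_of_iff:
  assumes "S \<subseteq> carrier V"
  shows "x \<in> norm_topology V closure_of S \<longleftrightarrow>
    x \<in> carrier V \<and> (\<forall>\<epsilon>>0. \<exists>y\<in>S. nrm V (x \<ominus> y) < \<epsilon>)"
  unfolding metric_closure_of using assms
  by (auto simp: in_mball norm_dist_def) (metis subsetD)+

lemma closedin_approx:
  assumes "closedin (norm_topology V) S" "x \<in> carrier V" "\<And>\<epsilon>. \<epsilon> > 0 \<Longrightarrow> \<exists>y\<in>S. nrm V (x \<ominus> y) < \<epsilon>"
  shows "x \<in> S"
proof -
  have "S \<subseteq> carrier V" using closedin_subset[OF assms(1)] by simp
  then show ?thesis using closure_of_iff assms closure_of_closedin[OF assms(1)] by metis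
qed

end

section \<open>Linear spans and closed linear spans\<close>

inductive_set linear_span :: "('a, 'm) cnormed_scheme \<Rightarrow> 'a set \<Rightarrow> 'a set"
  for V :: "('a, 'm) cnormed_scheme" and S :: "'a set" where
  base: "x \<in> S \<Longrightarrow> x \<in> linear_span V S"
| zero: "\<zero>\<^bsub>V\<^esub> \<in> linear_span V S"
| add: "x \<in> linear_span V S \<Longrightarrow> y \<in> linear_span V S \<Longrightarrow> x \<oplus>\<^bsub>V\<^esub> y \<in> linear_span V S"
| scale: "x \<in> linear_span V S \<Longrightarrow> z \<odot>\<^bsub>V\<^esub> x \<in> linear_span V S"

context complex_normed_space
begin

lemma linear_span_closed: "x \<in> linear_span V S \<Longrightarrow> S \<subseteq> carrier V \<Longrightarrow> x \<in> carrier V"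
  by (induction rule: linear_span.induct) auto

lemma linear_span_subset: "S \<subseteq> linear_span V T \<Longrightarrow> linear_span V S \<subseteq> linear_span V T"
proof
  fix x assume "S \<subseteq> linear_span V T" "x \<in> linear_span V S"
  from this(2,1) show "x \<in> linear_span V T"
    by (induction rule: linear_span.induct) (auto intro: linear_span.intros)
qed

lemma linear_span_mono: "S \<subseteq> T \<Longrightarrow> linear_span V S \<subseteq> linear_span V T"
  by (intro linear_span_subset) (auto intro: linear_span.base)

lemma submodule_scale: "submodule W complex_ring V \<Longrightarrow> x \<in> W \<Longrightarrow> z \<odot> x \<in> W"
  using submoduleE(4)[of W z x] by simp

lemma submodule_zero: "submodule W complex_ring V \<Longrightarrow> \<zero> \<in> W"
  by (metis submoduleE(1,2) submodule_scale scale_zero_left subset_iff ex_in_conv)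

lemma submodule_diff: "submodule W complex_ring V \<Longrightarrow> x \<in> W \<Longrightarrow> y \<in> W \<Longrightarrow> x \<ominus> y \<in> W"
  unfolding a_minus_def by (intro submoduleE(5)) (auto intro: submoduleE(3))

lemma submodule_finsum:
  assumes "submodule W complex_ring V" "\<And>i. i \<in> S \<Longrightarrow> f i \<in> W"
  shows "finsum V f S \<in> W"
proof (cases "finite S")
  case True
  then show ?thesis using assms(2)
  proof (induction S)
    case empty
    then show ?case using submodule_zero[OF assms(1)] by simp
  next
    case (insert i S)
    then have "f ` insert i S \<subseteq> W" by blast
    moreover have "W \<subseteq> carrier V" using submoduleE(1)[OF assms(1)] .
    ultimately show ?case using insert
      by (subst M.finsum_insert) (auto intro!: submoduleE(5)[OF assms(1)])
  qed
qed (simp add: M.finsum_infinite submodule_zero[OF assms(1)])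

lemma submodule_linear_span:
  assumes "S \<subseteq> carrier V" shows "submodule (linear_span V S) complex_ring V"
  using linear_span_closed[OF _ assms]
  by (intro submoduleI) (auto intro: linear_span.intros simp: neg_eq_scale)

lemma linear_span_le_submodule:
  assumes "submodule W complex_ring V" "S \<subseteq> W" shows "linear_span V S \<subseteq> W"
proof
  fix x assume "x \<in> linear_span V S"
  then show "x \<in> W"
    by (induction rule: linear_span.induct)
      (use assms in \<open>auto intro: submodule_scale submodule_zero submoduleE(5)\<close>)
qed

text \<open>Lets facts about \<open>closed_span\<close> be proved by rule induction on
  \<open>linear_span\<close>, generator by generator.\<close>

lemma hull_eq_linear_span:
  assumes "S \<subseteq> carrier V" shows "(\<lambda>W. submodule W complex_ring V) hull S = linear_span V S"
  using assms by (intro hull_unique submodule_linear_span linear_span_le_submodule)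
    (auto intro: linear_span.base)

lemma closed_span_iff:
  assumes "S \<subseteq> carrier V"
  shows "x \<in> closed_span V S \<longleftrightarrow>
    x \<in> carrier V \<and> (\<forall>\<epsilon>>0. \<exists>y\<in>linear_span V S. nrm V (x \<ominus> y) < \<epsilon>)"
  unfolding closed_span_def hull_eq_linear_span[OF assms]
  using assms by (intro closure_of_iff) (auto intro: linear_span_closed)

lemma closedin_closed_span: "closedin (norm_topology V) (closed_span V S)"
  by (simp add: closed_span_def)

lemma linear_span_subset_closed_span:
  assumes "S \<subseteq> carrier V" shows "linear_span V S \<subseteq> closed_span V S"
proof
  fix x assume x: "x \<in> linear_span V S"
  then have "x \<in> carrier V" using linear_span_closed[OF _ assms] by blast
  then show "x \<in> closed_span V S"
    using x by (auto simp: closed_span_iff[OF assms] intro!: bexI[of _ x]) (simp add: a_minus_def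
        M.r_neg)
qed

lemma submodule_closed_span:
  assumes S: "S \<subseteq> carrier V" shows "submodule (closed_span V S) complex_ring V"
proof -
  note [simp] = closed_span_iff[OF S]
  note lc = linear_span_closed[OF _ S]
  have add: "x \<oplus> y \<in> closed_span V S" if x: "x \<in> closed_span V S" and y: "y \<in> closed_span V S" for x y
    unfolding closed_span_iff[OF S]
  proof (intro conjI allI impI)
    show "x \<oplus> y \<in> carrier V" using x y by simp
    fix \<epsilon> :: real assume "\<epsilon> > 0"
    then obtain x' y' where x': "x' \<in> linear_span V S" "nrm V (x \<ominus> x') < \<epsilon> / 2"
      and y': "y' \<in> linear_span V S" "nrm V (y \<ominus> y') < \<epsilon> / 2"
      using x y unfolding closed_span_iff[OF S] by (meson half_gt_zero)
    have c: "x \<in> carrier V" "y \<in> carrier V" "x' \<in> carrier V" "y' \<in> carrier V"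
      using x y lc x' y' by auto
    have "(x \<oplus> y) \<ominus> (x' \<oplus> y') = (x \<ominus> x') \<oplus> (y \<ominus> y')"
      using c by (simp add: a_minus_def M.minus_add M.a_ac)
    then have "nrm V ((x \<oplus> y) \<ominus> (x' \<oplus> y')) < \<epsilon>"
      using norm_triangle[of "x \<ominus> x'" "y \<ominus> y'"] c x' y' by simp
    then show "\<exists>z\<in>linear_span V S. nrm V ((x \<oplus> y) \<ominus> z) < \<epsilon>"
      using x' y' by (blast intro: linear_span.add)
  qed
  have scale: "z \<odot> x \<in> closed_span V S" if x: "x \<in> closed_span V S" for z x
    unfolding closed_span_iff[OF S]
  proof (intro conjI allI impI)
    show "z \<odot> x \<in> carrier V" using x by simp
    fix \<epsilon> :: real assume "\<epsilon> > 0"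
    \<comment> \<open>The added 1 keeps the divisor positive when \<open>z\<close> is zero.\<close>
    then have "\<epsilon> / (cmod z + 1) > 0" by (intro divide_pos_pos) (auto intro: add_nonneg_pos)
    then obtain x' where x': "x' \<in> linear_span V S" "nrm V (x \<ominus> x') < \<epsilon> / (cmod z + 1)"
      using x by auto
    have c: "x \<in> carrier V" "x' \<in> carrier V" using x lc x' by auto
    have "z \<odot> x \<ominus> z \<odot> x' = z \<odot> (x \<ominus> x')"
      using c by (simp add: diff_eq_scale scale_add_right mult.commute)
    then have "nrm V (z \<odot> x \<ominus> z \<odot> x') = cmod z * nrm V (x \<ominus> x')"
      using c by (simp add: norm_smult)
    also have "\<dots> \<le> (cmod z + 1) * nrm V (x \<ominus> x')"
      using c by (intro mult_right_mono norm_nonneg) auto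
    also have "\<dots> < \<epsilon>" using x'(2) \<open>\<epsilon> / (cmod z + 1) > 0\<close>
      by (subst (asm) pos_less_divide_eq) (auto simp: mult.commute add_nonneg_pos)
    finally show "\<exists>y\<in>linear_span V S. nrm V (z \<odot> x \<ominus> y) < \<epsilon>"
      using x' by (blast intro: linear_span.scale)
  qed
  have "\<zero> \<in> closed_span V S"
    using linear_span_subset_closed_span[OF S] by (auto intro: linear_span.zero)
  then show ?thesis
    using add scale scale[of _ "-1"] by (intro submoduleI) (auto simp: neg_eq_scale)
qed

end

section \<open>C*-algebras, projections and iterated squares\<close>

context cstar_algebra
begin

declare mult_closed [simp] star_closed [simp] star_star [simp]

lemma mult_zero_left [simp]: "x \<in> carrier A \<Longrightarrow> \<zero> \<otimes> x = \<zero>"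
  using mult_smult_left[of \<zero> x 0] by simp

lemma mult_zero_right [simp]: "x \<in> carrier A \<Longrightarrow> x \<otimes> \<zero> = \<zero>"
  using mult_smult_right[of x \<zero> 0] by simp

lemma star_zero [simp]: "star A \<zero> = \<zero>"
  using star_smult[of \<zero> 0] by simp

lemma mult_finsum_left:
  "\<lbrakk>x \<in> carrier A; f \<in> S \<rightarrow> carrier A\<rbrakk> \<Longrightarrow> x \<otimes> finsum A f S = finsum A (\<lambda>i. x \<otimes> f i) S"
proof (induction S rule: infinite_finite_induct)
  case (insert i S)
  then show ?case by (simp add: Pi_iff mult_distrib_left)
qed (auto simp: M.finsum_infinite)

lemma mult_finsum_right:
  "\<lbrakk>x \<in> carrier A; f \<in> S \<rightarrow> carrier A\<rbrakk> \<Longrightarrow> finsum A f S \<otimes> x = finsum A (\<lambda>i. f i \<otimes> x) S"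
proof (induction S rule: infinite_finite_induct)
  case (insert i S)
  then show ?case by (simp add: Pi_iff mult_distrib_right)
qed (auto simp: M.finsum_infinite)

lemma norm_star [simp]:
  assumes "x \<in> carrier A" shows "nrm A (star A x) = nrm A x"
proof -
  have le: "nrm A y \<le> nrm A (star A y)" if y: "y \<in> carrier A" for y
  proof (cases "nrm A y = 0")
    case False
    have "nrm A y * nrm A y \<le> nrm A (star A y) * nrm A y"
      using y cstar_identity[OF y] norm_mult[of "star A y" y] by (simp add: power2_eq_square)
    then show ?thesis using False norm_nonneg[OF y] by (simp add: mult_le_cancel_right)
  qed (use y in \<open>simp add: norm_nonneg\<close>)
  show ?thesis using le[of x] le[of "star A x"] assms by simp
qed

definition projection :: "'a \<Rightarrow> bool" where
  "projection p \<longleftrightarrow> p \<in> carrier A \<and> p \<otimes> p = p \<and> star A p = p"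

lemma projectionD [simp]:
  assumes "projection p" shows "p \<in> carrier A" "p \<otimes> p = p" "star A p = p"
  using assms by (auto simp: projection_def)

lemma norm_projection:
  assumes "projection p" "p \<noteq> \<zero>" shows "nrm A p = 1"
proof -
  have "nrm A p * nrm A p = nrm A p"
    using cstar_identity[of p] assms by (simp add: power2_eq_square)
  then show ?thesis using assms norm_eq_zero[of p] by simp
qed

lemma norm_projection_le: "projection p \<Longrightarrow> nrm A p \<le> 1"
  using norm_projection[of p] by (cases "p = \<zero>") auto

text \<open>\<open>(sq ^^ j) x\<close> is the power of \<open>x\<close> with exponent
  \<open>2 ^ j\<close>. For self-adjoint \<open>x\<close> each squaring is one application of the
  C*-identity, and no unit is involved.\<close>

definition sq :: "'a \<Rightarrow> 'a" where "sq x = x \<otimes> x"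

lemma sq_pow_Suc: "(sq ^^ Suc j) x = (sq ^^ j) x \<otimes> (sq ^^ j) x"
  by (simp add: sq_def)

lemma sq_pow_closed [simp]: "x \<in> carrier A \<Longrightarrow> (sq ^^ j) x \<in> carrier A"
  by (induction j) (auto simp: sq_def)

lemma norm_sq_pow:
  assumes "x \<in> carrier A" "star A x = x" shows "nrm A ((sq ^^ j) x) = nrm A x ^ 2 ^ j"
proof -
  have "star A ((sq ^^ j) x) = (sq ^^ j) x" for j
    using assms by (induction j) (auto simp: sq_def star_mult)
  then have "nrm A ((sq ^^ Suc j) x) = nrm A ((sq ^^ j) x) ^ 2" for j
    using cstar_identity[of "(sq ^^ j) x"] assms by (simp add: sq_def)
  then show ?thesis by (induction j) (simp_all add: power_mult[symmetric] mult.commute)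
qed

lemma norm_sq_pow_le:
  assumes "x \<in> carrier A" shows "nrm A ((sq ^^ j) x) \<le> nrm A x ^ 2 ^ j"
proof (induction j)
  case (Suc j)
  have "nrm A ((sq ^^ Suc j) x) \<le> nrm A ((sq ^^ j) x) * nrm A ((sq ^^ j) x)"
    using assms norm_mult by (simp add: sq_def)
  also have "\<dots> \<le> nrm A x ^ 2 ^ j * nrm A x ^ 2 ^ j"
    using Suc assms by (intro mult_mono) (auto simp: norm_nonneg)
  finally show ?case by (simp add: power_add[symmetric] mult_2)
qed simp

end

section \<open>Projections summing to a projection\<close>

text \<open>Multiplication by the primitive root \<open>\<omega>\<close> permutes the roots and
  multiplies the sum by \<open>\<omega> ^ n\<close>, which is not 1.\<close>

lemma sum_powers_roots_unity:
  assumes "0 < N" "\<not> N dvd n"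
  shows "(\<Sum>z | z ^ N = 1. z ^ n) = (0 :: complex)"
proof -
  define \<omega> where "\<omega> = cis (2 * pi / real N)"
  have \<omega>: "\<omega> ^ N = 1" using assms by (simp add: \<omega>_def DeMoivre)
  have "\<omega> ^ n \<noteq> 1"
  proof
    assume "\<omega> ^ n = 1"
    then obtain j :: int where "real n * (2 * pi / real N) = 2 * pi * of_int j"
      by (auto simp: \<omega>_def DeMoivre complex_eq_iff cos_one_2pi_int)
    then have "real n = real N * of_int j" using assms by (simp add: field_simps)
    then have "(of_int (int n) :: real) = of_int (int N * j)" by simp
    then have "int n = int N * j" by (simp only: of_int_eq_iff)
    then show False using assms by (metis dvd_triv_left int_dvd_int_iff)
  qed
  moreover have "bij_betw ((*) \<omega>) {z. z ^ N = 1} {z. z ^ N = 1}"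
  proof (rule bij_betw_byWitness[where f' = "\<lambda>z. z / \<omega>"])
    have "\<omega> \<noteq> 0" by (simp add: \<omega>_def)
    then show "\<forall>z\<in>{z. z ^ N = 1}. \<omega> * z / \<omega> = z" "\<forall>z\<in>{z. z ^ N = 1}. \<omega> * (z / \<omega>) = z" by auto
  qed (auto simp: power_mult_distrib power_divide \<omega>)
  then have "(\<Sum>z | z ^ N = 1. (\<omega> * z) ^ n) = (\<Sum>z | z ^ N = 1. z ^ n)"
    by (rule sum.reindex_bij_betw)
  then have "\<omega> ^ n * (\<Sum>z | z ^ N = 1. z ^ n) = (\<Sum>z | z ^ N = 1. z ^ n)"
    by (simp add: power_mult_distrib sum_distrib_left)
  ultimately show ?thesis by (metis mult_cancel_right1)
qed

text \<open>The weight \<open>z ^ M\<close> turns the coefficient of degree \<open>i\<close> into a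
  multiple of the sum of all \<open>z ^ (M + i)\<close>. For \<open>i \<le> M\<close> this vanishes
  unless \<open>i = 1\<close>: since \<open>0 < M\<close>, the only multiple of \<open>Suc M\<close>
  between \<open>M\<close> and \<open>2 * M\<close> is \<open>Suc M\<close> itself. Beyond degree
  \<open>M\<close> there are no coefficients.\<close>

lemma linear_coeff_extraction:
  fixes t :: complex
  assumes "0 < M"
  shows "(\<Sum>z | z ^ Suc M = 1. smult (z ^ M) ([:1, t * z:] ^ M)) = [:0, of_nat (Suc M * M) * t:]"
proof (rule poly_eqI)
  fix i
  have "coeff (\<Sum>z | z ^ Suc M = 1. smult (z ^ M) ([:1, t * z:] ^ M)) i =
      (\<Sum>z | z ^ Suc M = 1. of_nat (M choose i) * t ^ i * z ^ (M + i))"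
  proof (unfold coeff_sum, rule sum.cong[OF refl])
    fix z :: complex
    show "coeff (smult (z ^ M) ([:1, t * z:] ^ M)) i = of_nat (M choose i) * t ^ i * z ^ (M + i)"
    proof (cases "i \<le> M")
      case False
      have "degree ([:1, t * z:] ^ M) \<le> degree [:1, t * z:] * M" by (rule degree_power_le)
      also have "\<dots> \<le> 1 * M" by (intro mult_right_mono) auto
      finally show ?thesis using False by (simp add: coeff_eq_0)
    qed (simp add: coeff_linear_poly_power power_add power_mult_distrib)
  qed
  also have "\<dots> = of_nat (M choose i) * t ^ i * (\<Sum>z | z ^ Suc M = 1. z ^ (M + i))"
    by (simp add: sum_distrib_left)
  also have "\<dots> = coeff [:0, of_nat (Suc M * M) * t:] i"
  proof -
    consider "i = 1" | "i > M" | "i \<le> M" "i \<noteq> 1" by linarith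
    then show ?thesis
    proof cases
      case 1
      have "(\<Sum>z::complex | z ^ Suc M = 1. z ^ Suc M) = (\<Sum>z::complex | z ^ Suc M = 1. 1)"
        by (intro sum.cong) auto
      also have "\<dots> = of_nat (Suc M)" by (simp add: card_roots_unity_eq del: power_Suc)
      finally show ?thesis using 1 by (simp add: algebra_simps)
    next
      case 2
      then show ?thesis using assms by (auto simp: coeff_pCons split: nat.splits)
    next
      case 3
      have "\<not> Suc M dvd M + i"
      proof
        assume "Suc M dvd M + i"
        then obtain c where c: "M + i = Suc M * c" by (auto elim: dvdE)
        have "c \<noteq> 0" using c assms by (intro notI) simp
        moreover have "c \<noteq> 1" using c 3 by auto
        ultimately have "2 \<le> c" by simp
        then have "Suc M * 2 \<le> M + i" unfolding c by (rule mult_le_mono2)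
        then show False using 3 by simp
      qed
      then show ?thesis using 3 sum_powers_roots_unity[of "Suc M" "M + i"]
        by (auto simp: coeff_pCons split: nat.splits simp del: power_Suc)
    qed
  qed
  finally show "coeff (\<Sum>z | z ^ Suc M = 1. smult (z ^ M) ([:1, t * z:] ^ M)) i =
    coeff [:0, of_nat (Suc M * M) * t:] i" .
qed

section \<open>Polynomials in a corner and perturbations of its unit\<close>

context cstar_algebra
begin

text \<open>Horner's scheme in the corner: constants are multiples of \<open>e\<close>, which takes
  the place of the unit.\<close>

definition poly_eval :: "'a \<Rightarrow> 'a \<Rightarrow> complex poly \<Rightarrow> 'a" where
  "poly_eval e x p = fold_coeffs (\<lambda>a y. a \<odot> e \<oplus> x \<otimes> y) p \<zero>"

context
  fixes e x
  assumes ex: "e \<in> carrier A" "x \<in> carrier A" "e \<otimes> e = e" "e \<otimes> x = x" "x \<otimes> e = x"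
begin

lemma poly_eval_0 [simp]: "poly_eval e x 0 = \<zero>"
  by (simp add: poly_eval_def)

lemma poly_eval_pCons: "poly_eval e x (pCons a p) = a \<odot> e \<oplus> x \<otimes> poly_eval e x p"
  using ex by (cases "a = 0 \<and> p = 0") (auto simp: poly_eval_def)

lemma poly_eval_closed [simp]: "poly_eval e x p \<in> carrier A"
  using ex by (induction p) (auto simp: poly_eval_pCons)

lemma poly_eval_unit: "e \<otimes> poly_eval e x p = poly_eval e x p"
  using ex by (cases p) (auto simp: poly_eval_pCons mult_distrib_left mult_smult_right
      mult_assoc[symmetric])

lemma poly_eval_add: "poly_eval e x (p + q) = poly_eval e x p \<oplus> poly_eval e x q"
proof (induction p q rule: poly_induct2)
  case (pCons a p b q)
  then show ?case using ex
    by (simp add: poly_eval_pCons scale_add_left mult_distrib_left M.a_ac)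
qed simp

lemma poly_eval_smult: "poly_eval e x (smult c p) = c \<odot> poly_eval e x p"
  using ex by (induction p) (auto simp: poly_eval_pCons scale_add_right mult_smult_right)

text \<open>The value is the \<open>n\<close>-th power of \<open>e \<oplus> c \<odot> x\<close>,
  with \<open>e\<close> as its zeroth power, so submultiplicativity suffices.\<close>

lemma poly_eval_linear_power_le:
  assumes "nrm A e \<le> 1" "nrm A (e \<oplus> c \<odot> x) \<le> 1"
  shows "nrm A (poly_eval e x ([:1, c:] ^ n)) \<le> 1"
proof (induction n)
  case (Suc n)
  let ?p = "[:1, c:] ^ n"
  have "[:1, c:] ^ Suc n = ?p + pCons 0 (smult c ?p)" by simp
  then have "poly_eval e x ([:1, c:] ^ Suc n) = poly_eval e x (?p + pCons 0 (smult c ?p))"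
    by (rule arg_cong)
  also have "\<dots> = (e \<oplus> c \<odot> x) \<otimes> poly_eval e x ?p"
    using ex by (simp add: poly_eval_add poly_eval_pCons poly_eval_smult mult_distrib_right
        mult_smult_left mult_smult_right poly_eval_unit)
  finally have "nrm A (poly_eval e x ([:1, c:] ^ Suc n)) \<le>
      nrm A (e \<oplus> c \<odot> x) * nrm A (poly_eval e x ?p)"
    using ex norm_mult by simp
  also have "\<dots> \<le> 1 * 1" using Suc assms ex by (intro mult_mono) (auto simp: norm_nonneg)
  finally show ?case by simp
qed (use assms ex in \<open>simp add: one_pCons poly_eval_pCons\<close>)

lemma norm_poly_eval_sum:
  fixes K :: real
  assumes "finite S" "\<And>i. i \<in> S \<Longrightarrow> nrm A (poly_eval e x (f i)) \<le> K"
  shows "nrm A (poly_eval e x (\<Sum>i\<in>S. f i)) \<le> card S * K"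
  using assms
proof (induction S)
  case (insert i S)
  have "nrm A (poly_eval e x (\<Sum>i\<in>insert i S. f i)) \<le>
      nrm A (poly_eval e x (f i)) + nrm A (poly_eval e x (\<Sum>i\<in>S. f i))"
    using insert by (simp add: poly_eval_add norm_triangle)
  also have "\<dots> \<le> K + card S * K" using insert by (intro add_mono insert.IH) auto
  finally show ?case using insert by (simp add: algebra_simps)
qed simp

text \<open>The unit of a complex Banach algebra is an extreme point of the unit ball: averaging
  \<open>(e + t \<zeta> x) ^ M\<close> over the roots of unity \<open>\<zeta>\<close> of order \<open>M + 1\<close> leaves \<open>M t x\<close>.\<close>

lemma zero_if_perturbation_le_one:
  assumes "nrm A e \<le> 1" "0 < \<delta>"
    and le: "\<And>t. cmod t \<le> \<delta> \<Longrightarrow> nrm A (e \<oplus> t \<odot> x) \<le> 1"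
  shows "x = \<zero>"
proof -
  \<comment> \<open>Each of the \<open>Suc M\<close> summands of the average has norm at most 1,
    while their sum is \<open>Suc M * M * \<delta>\<close> times \<open>x\<close>; the common factor
    \<open>Suc M\<close> cancels.\<close>
  have bound: "real M * \<delta> * nrm A x \<le> 1" if "0 < M" for M
  proof -
    let ?R = "{z :: complex. z ^ Suc M = 1}"
    have "finite ?R" by (rule finite_roots_unity) auto
    have card: "card ?R = Suc M" by (rule card_roots_unity_eq) auto
    have "nrm A (poly_eval e x (\<Sum>z\<in>?R. smult (z ^ M) ([:1, \<delta> * z:] ^ M))) \<le> real (card ?R) * 1"
    proof (rule norm_poly_eval_sum[OF \<open>finite ?R\<close>])
      fix z :: complex assume "z \<in> ?R"
      then have "cmod z ^ Suc M = 1 ^ Suc M"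
        by (simp only: mem_Collect_eq norm_power[symmetric]) simp
      then have z: "cmod z = 1" by (rule power_eq_imp_eq_base) auto
      then have "nrm A (poly_eval e x ([:1, \<delta> * z:] ^ M)) \<le> 1"
        using assms by (intro poly_eval_linear_power_le le) (auto simp: Real_Vector_Spaces.norm_mult)
      then show "nrm A (poly_eval e x (smult (z ^ M) ([:1, \<delta> * z:] ^ M))) \<le> 1"
        using z by (simp add: poly_eval_smult norm_smult norm_power)
    qed
    also have "poly_eval e x (\<Sum>z\<in>?R. smult (z ^ M) ([:1, \<delta> * z:] ^ M)) =
        (of_nat (Suc M * M) * complex_of_real \<delta>) \<odot> x"
      unfolding linear_coeff_extraction[OF that] using ex
      by (simp add: poly_eval_pCons mult_smult_right)
    also have "nrm A \<dots> = real (Suc M) * (real M * \<delta> * nrm A x)"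
      unfolding norm_smult[OF ex(2)] using \<open>0 < \<delta>\<close> by (simp only: Real_Vector_Spaces.norm_mult
          norm_of_nat norm_of_real) (simp add: algebra_simps)
    finally have "real (Suc M) * (real M * \<delta> * nrm A x) \<le> real (Suc M) * 1" unfolding card .
    then show ?thesis by (subst (asm) mult_le_cancel_left_pos) auto
  qed
  have "nrm A x = 0"
  proof (rule ccontr)
    assume "nrm A x \<noteq> 0"
    then have "\<delta> * nrm A x > 0" using ex norm_nonneg[of x] \<open>0 < \<delta>\<close> by simp
    then obtain M where "1 < real M * (\<delta> * nrm A x)" using ex_less_of_nat_mult by blast
    moreover from this have "0 < M" by (intro gr0I) simp
    ultimately show False using bound[of M] by (simp add: mult.assoc)
  qed
  then show ?thesis using ex norm_eq_zero by simp
qed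

end

section \<open>Orthogonality from contractions in a corner\<close>

lemma norm_convex:
  assumes "x \<in> carrier A" "y \<in> carrier A" "nrm A x \<le> K" "nrm A y \<le> K" "0 \<le> a" "0 \<le> b" "a + b = 1"
  shows "nrm A (complex_of_real a \<odot> x \<oplus> complex_of_real b \<odot> y) \<le> K"
proof -
  have "nrm A (complex_of_real a \<odot> x \<oplus> complex_of_real b \<odot> y) \<le> a * nrm A x + b * nrm A y"
    using assms norm_triangle[of "complex_of_real a \<odot> x" "complex_of_real b \<odot> y"]
    by (simp add: norm_smult)
  also have "\<dots> \<le> a * K + b * K" using assms by (intro add_mono mult_left_mono) auto
  also have "\<dots> = K" using assms by (simp add: distrib_right[symmetric])
  finally show ?thesis .
qed

text \<open>The algebra need not be unital, hence the corner \<open>e A e\<close> with unit \<open>e\<close>.\<close>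

lemma norm_corner_square:
  assumes "projection e" "x \<in> carrier A"
    and k: "e \<otimes> x = k" "star A x \<otimes> e = k" "star A x \<otimes> x = k" and "k \<in> carrier A"
  shows "(nrm A (e \<oplus> t \<odot> x))\<^sup>2 = nrm A (e \<oplus> complex_of_real (2 * Re t + (cmod t)\<^sup>2) \<odot> k)"
proof -
  have "star A (e \<oplus> t \<odot> x) \<otimes> (e \<oplus> t \<odot> x) = e \<oplus> (t \<odot> k \<oplus> (cnj t \<odot> k \<oplus> (cnj t * t) \<odot> k))"
    using assms by (simp add: star_add star_smult mult_distrib_left mult_distrib_right
        mult_smult_left mult_smult_right M.a_ac scale_add_right mult.commute)
  also have "t \<odot> k \<oplus> (cnj t \<odot> k \<oplus> (cnj t * t) \<odot> k) = (t + (cnj t + cnj t * t)) \<odot> k"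
    using assms by (simp add: scale_add_left)
  also have "t + (cnj t + cnj t * t) = complex_of_real (2 * Re t + (cmod t)\<^sup>2)"
    by (simp add: complex_eq_iff complex_norm_square[symmetric] cmod_power2 power2_eq_square
        mult.commute)
  finally show ?thesis using cstar_identity[of "e \<oplus> t \<odot> x"] assms by simp
qed

text \<open>Compressing \<open>Q\<close> by \<open>e = q i\<close> gives \<open>e\<close>, so the
  compressions \<open>k l\<close> of the other \<open>q l\<close> add up to zero. As positive
  elements they would have to vanish. In place of positivity the proof uses contractions: each
  \<open>e - 2 k l\<close> has norm at most 1, and averaging such elements with \<open>e\<close>
  gives a contraction \<open>e + (2 / N) k j\<close>. So \<open>e\<close> is an interior point of a
  segment of contractions in the direction of \<open>k j\<close>. The bound is carried over to
  complex multiples of \<open>k j\<close>, and \<open>zero_if_perturbation_le_one\<close> then gives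
  \<open>k j = 0\<close>, whence \<open>q j \<otimes> e = \<zero>\<close> by the
  C*-identity.\<close>

lemma orthogonal_if_sum_projection:
  assumes "finite S" and proj: "\<And>i. i \<in> S \<Longrightarrow> projection (q i)"
    and Q: "finsum A q S = Q" "\<And>i. i \<in> S \<Longrightarrow> q i \<otimes> Q = q i"
    and ij: "i \<in> S" "j \<in> S" "i \<noteq> j"
  shows "q i \<otimes> q j = \<zero>"
proof -
  define e where "e = q i"
  have e: "projection e" "nrm A e \<le> 1" using proj ij norm_projection_le by (auto simp: e_def)
  define k where "k l = e \<otimes> (q l \<otimes> e)" for l
  have [simp]: "q l \<in> carrier A" "q l \<otimes> q l = q l" "star A (q l) = q l" if "l \<in> S" for l
    using proj[OF that] by auto
  have [simp]: "e \<in> carrier A" "e \<otimes> e = e" "star A e = e" using e by auto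
  have [simp]: "k l \<in> carrier A" if "l \<in> S" for l using that by (simp add: k_def)
  have ke: "e \<otimes> k l = k l" "k l \<otimes> e = k l" if "l \<in> S" for l
    using that by (simp_all add: k_def mult_assoc) (simp add: mult_assoc[symmetric])
  have x: "e \<otimes> (q l \<otimes> e) = k l" "star A (q l \<otimes> e) \<otimes> e = k l" "star A (q l \<otimes> e) \<otimes> (q l \<otimes> e) = k l"
    if "l \<in> S" for l
  proof -
    have "q l \<otimes> (q l \<otimes> e) = q l \<otimes> e" using that by (simp add: mult_assoc[symmetric])
    then show "star A (q l \<otimes> e) \<otimes> (q l \<otimes> e) = k l" "star A (q l \<otimes> e) \<otimes> e = k l"
      using that by (simp_all add: k_def star_mult mult_assoc)
  qed (simp add: k_def)
  \<comment> \<open>At \<open>t = -2\<close> the coefficient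
    \<open>2 * Re t + (cmod t)\<^sup>2\<close> in \<open>norm_corner_square\<close>
    vanishes.\<close>
  have two: "nrm A (e \<oplus> (-2) \<odot> k l) \<le> 1" if "l \<in> S" for l
  proof -
    have "(nrm A (e \<oplus> (-2) \<odot> (q l \<otimes> e)))\<^sup>2 = nrm A e"
      using norm_corner_square[OF e(1) _ x[OF that], of "-2"] that by simp
    then have "(nrm A (e \<oplus> (-2) \<odot> (q l \<otimes> e)))\<^sup>2 \<le> 1\<^sup>2" using e by simp
    then have le: "nrm A (e \<oplus> (-2) \<odot> (q l \<otimes> e)) \<le> 1" by (rule power2_le_imp_le) simp
    have "e \<oplus> (-2) \<odot> k l = e \<otimes> (e \<oplus> (-2) \<odot> (q l \<otimes> e))"
      using that by (simp add: mult_distrib_left mult_smult_right k_def)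
    then have "nrm A (e \<oplus> (-2) \<odot> k l) \<le> nrm A e * nrm A (e \<oplus> (-2) \<odot> (q l \<otimes> e))"
      using norm_mult that by simp
    also have "\<dots> \<le> 1 * 1" using le e that by (intro mult_mono) (auto simp: norm_nonneg)
    finally show ?thesis by simp
  qed
  \<comment> \<open>The compression of \<open>Q\<close> is \<open>e\<close>, and so is the summand
    \<open>k i\<close>; the remaining summands must cancel.\<close>
  have sum_zero: "finsum A k (S - {i}) = \<zero>"
  proof -
    have "finsum A k S = e \<otimes> (Q \<otimes> e)"
      unfolding Q(1)[symmetric] k_def[abs_def]
      by (subst mult_finsum_right, simp, simp) (subst mult_finsum_left, auto)
    also have "\<dots> = k i"
    proof -
      have "Q \<in> carrier A" unfolding Q(1)[symmetric] by (intro finsum_closed') simp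
      then have "e \<otimes> (Q \<otimes> e) = (e \<otimes> Q) \<otimes> e" by (simp add: mult_assoc)
      then show ?thesis using Q(2)[OF ij(1)] by (simp add: k_def flip: e_def)
    qed
    finally have "k i \<oplus> finsum A k (S - {i}) = k i \<oplus> \<zero>"
      using ij \<open>finite S\<close> M.finsum_insert[of "S - {i}" i k] by (simp add: insert_absorb Pi_iff)
    then show ?thesis using ij by (simp add: Pi_iff)
  qed
  define R where "R = S - {i} - {j}"
  \<comment> \<open>\<open>N\<close> is the number of terms averaged in \<open>plus\<close>: the
    contractions \<open>e - 2 k l\<close> for \<open>l\<close> in \<open>R\<close>, and
    \<open>e\<close> itself.\<close>
  define N where "N = real (card R) + 1"
  have N: "N \<ge> 1" by (simp add: N_def)
  have "finite R" "R \<subseteq> S" using \<open>finite S\<close> by (auto simp: R_def)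
  have kj: "k j \<oplus> finsum A k R = \<zero>"
    using sum_zero ij \<open>finite S\<close> M.finsum_insert[of R j k] \<open>finite R\<close>
    by (simp add: R_def insert_absorb Pi_iff insert_Diff_if)
  have sumR: "finsum A (\<lambda>l. e \<oplus> (-2) \<odot> k l) R = of_nat (card R) \<odot> e \<oplus> (-2) \<odot> finsum A k R"
    using \<open>finite R\<close> \<open>R \<subseteq> S\<close>
  proof (induction R)
    case (insert l R)
    then show ?case
      by (simp add: Pi_iff subset_iff scale_add_left scale_add_right M.a_ac)
  qed simp
  \<comment> \<open>The \<open>k l\<close> with \<open>l\<close> in \<open>R\<close> add up to
    \<open>- k j\<close>, which is why the average moves away from \<open>e\<close> in the direction
    opposite to \<open>e - 2 k j\<close>.\<close>
  have plus: "nrm A (e \<oplus> complex_of_real (2 / N) \<odot> k j) \<le> 1"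
  proof -
    have kj2: "(-2) \<odot> finsum A k R = 2 \<odot> k j"
    proof -
      have "finsum A k R = (-1) \<odot> k j"
      proof -
        have c: "finsum A k R \<in> carrier A" using \<open>R \<subseteq> S\<close> by (intro finsum_closed') auto
        then have "\<ominus> k j = finsum A k R"
          using kj ij by (intro M.minus_equality) (auto simp: M.a_comm)
        then show ?thesis using ij by (simp add: neg_eq_scale)
      qed
      then show ?thesis using ij by simp
    qed
    have "N * nrm A (e \<oplus> complex_of_real (2 / N) \<odot> k j) = nrm A (complex_of_real N \<odot> (e \<oplus>
        complex_of_real (2 / N) \<odot> k j))"
      using ij N by (simp add: norm_smult)
    also have "complex_of_real N \<odot> (e \<oplus> complex_of_real (2 / N) \<odot> k j) = complex_of_real N \<odot> e \<oplus> 2 \<odot> k j"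
      using ij N by (simp add: scale_add_right)
    also have "complex_of_real N \<odot> e \<oplus> 2 \<odot> k j = finsum A (\<lambda>l. e \<oplus> (-2) \<odot> k l) R \<oplus> e"
    proof -
      have "complex_of_real N \<odot> e = of_nat (card R) \<odot> e \<oplus> e"
        unfolding N_def by (simp add: scale_add_left)
      then show ?thesis unfolding sumR kj2 using ij by (simp add: M.a_ac)
    qed
    also have "nrm A \<dots> \<le> nrm A (finsum A (\<lambda>l. e \<oplus> (-2) \<odot> k l) R) + nrm A e"
      using \<open>R \<subseteq> S\<close> by (intro norm_triangle) (auto intro!: finsum_closed')
    also have "\<dots> \<le> real (card R) * 1 + 1"
      using e \<open>finite R\<close> \<open>R \<subseteq> S\<close> two by (intro add_mono norm_finsum) auto
    finally show ?thesis by (simp add: N_def)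
  qed
  have real_bound: "nrm A (e \<oplus> complex_of_real \<tau> \<odot> k j) \<le> 1" if \<tau>: "-2 \<le> \<tau>" "\<tau> \<le> 2 / N" for \<tau>
  proof -
    \<comment> \<open>The weights that write \<open>\<tau>\<close> as a convex combination of the
      end points \<open>-2\<close> and \<open>2 / N\<close>.\<close>
    define a where "a = (2 / N - \<tau>) / (2 / N + 2)"
    define b where "b = (\<tau> + 2) / (2 / N + 2)"
    have pos: "2 / N + 2 > 0" using N by (simp add: add_pos_pos)
    have ab: "0 \<le> a" "0 \<le> b" "a + b = 1" "- 2 * a + 2 / N * b = \<tau>"
    proof -
      show "0 \<le> a" "0 \<le> b" using \<tau> pos by (simp_all add: a_def b_def)
      have "a + b = (2 / N + 2) / (2 / N + 2)" unfolding a_def b_def add_divide_distrib[symmetric]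
          by simp
      then show "a + b = 1" using pos by simp
      have "- 2 * a + 2 / N * b = \<tau> * (2 / N + 2) / (2 / N + 2)"
        unfolding a_def b_def times_divide_eq_right add_divide_distrib[symmetric]
        by (simp add: algebra_simps add_divide_distrib)
      then show "- 2 * a + 2 / N * b = \<tau>" using pos by simp
    qed
    have "e \<oplus> complex_of_real \<tau> \<odot> k j =
        complex_of_real a \<odot> (e \<oplus> (-2) \<odot> k j) \<oplus> complex_of_real b \<odot> (e \<oplus> complex_of_real (2 / N) \<odot> k j)"
    proof -
      have "complex_of_real a \<odot> (e \<oplus> (-2) \<odot> k j) \<oplus> complex_of_real b \<odot> (e \<oplus> complex_of_real (2 / N)
          \<odot> k j) =
        (complex_of_real a \<odot> e \<oplus> complex_of_real b \<odot> e) \<oplus>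
        ((complex_of_real a * (-2)) \<odot> k j \<oplus> (complex_of_real b * complex_of_real (2 / N)) \<odot> k j)"
        using ij by (simp add: scale_add_right M.a_ac)
      also have "\<dots> = (complex_of_real (a + b)) \<odot> e \<oplus> complex_of_real (- 2 * a + 2 / N * b) \<odot> k j"
      proof -
        have "complex_of_real (a + b) = complex_of_real a + complex_of_real b"
          "complex_of_real (- 2 * a + 2 / N * b) = complex_of_real a * (-2) + complex_of_real b *
              complex_of_real (2 / N)"
          by simp_all
        then show ?thesis using ij by (simp only: scale_add_left \<open>e \<in> carrier A\<close> \<open>\<And>l. l \<in> S \<Longrightarrow> k l \<in>
            carrier A\<close>)
      qed
      finally show ?thesis unfolding ab(3,4) by simp
    qed
    then show ?thesis
      using norm_convex[OF _ _ two[OF ij(2)] plus ab(1-3)] ij by simp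
  qed
  \<comment> \<open>The real bound extends to complex \<open>t\<close> because
    \<open>norm_corner_square\<close> depends on \<open>t\<close> only through the real number
    \<open>2 * Re t + (cmod t)\<^sup>2\<close>. For \<open>cmod t\<close> at most
    \<open>1 / (2 * N)\<close> this number lies between \<open>-1\<close> and
    \<open>3 / (2 * N)\<close>, inside the range of \<open>real_bound\<close>.\<close>
  have "k j = \<zero>"
  proof (rule zero_if_perturbation_le_one[where e = e and \<delta> = "1 / (2 * N)"])
    fix t :: complex assume t: "cmod t \<le> 1 / (2 * N)"
    have "\<bar>Re t\<bar> \<le> 1 / (2 * N)" using t abs_Re_le_cmod[of t] by linarith
    moreover have "(cmod t)\<^sup>2 \<le> 1 / (2 * N)"
    proof -
      have "1 / (2 * N) \<le> 1" using N by simp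
      then have "(cmod t)\<^sup>2 \<le> 1 / (2 * N) * 1"
        unfolding power2_eq_square using t N \<open>1 / (2 * N) \<le> 1\<close> order_trans[OF t] by (intro
            mult_mono) auto
      then show ?thesis by simp
    qed
    moreover have "1 / (2 * N) \<le> 1 / 2" "3 * (1 / (2 * N)) \<le> 2 / N" using N by (simp_all add:
        field_simps)
    moreover have "0 \<le> (cmod t)\<^sup>2" by simp
    ultimately have "-2 \<le> 2 * Re t + (cmod t)\<^sup>2" "2 * Re t + (cmod t)\<^sup>2 \<le> 2 / N"
      unfolding abs_le_iff by linarith+
    then have "nrm A (e \<oplus> complex_of_real (2 * Re t + (cmod t)\<^sup>2) \<odot> k j) \<le> 1"
      by (rule real_bound)
    then have "(nrm A (e \<oplus> t \<odot> (q j \<otimes> e)))\<^sup>2 \<le> 1\<^sup>2"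
      using norm_corner_square[OF e(1) _ x[OF ij(2)], of t] ij by simp
    then have le: "nrm A (e \<oplus> t \<odot> (q j \<otimes> e)) \<le> 1" by (rule power2_le_imp_le) simp
    have "e \<oplus> t \<odot> k j = e \<otimes> (e \<oplus> t \<odot> (q j \<otimes> e))"
      using ij by (simp add: mult_distrib_left mult_smult_right k_def)
    then have "nrm A (e \<oplus> t \<odot> k j) \<le> nrm A e * nrm A (e \<oplus> t \<odot> (q j \<otimes> e))"
      using norm_mult ij by simp
    also have "\<dots> \<le> 1 * 1" using le e ij by (intro mult_mono) (auto simp: norm_nonneg)
    finally show "nrm A (e \<oplus> t \<odot> k j) \<le> 1" by simp
  next
    show "0 < 1 / (2 * N)" using N by simp
  qed (use ij ke e in simp_all)
  then have "nrm A (q j \<otimes> e) = 0"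
    using x(3)[OF ij(2)] cstar_identity[of "q j \<otimes> e"] ij by simp
  then have "q j \<otimes> e = \<zero>" using norm_eq_zero ij by simp
  then have "star A (q j \<otimes> e) = \<zero>" by simp
  then show ?thesis using ij by (simp add: star_mult e_def)
qed

end

section \<open>Continuity of *-homomorphisms\<close>

context complex_normed_space
begin

lemma eq_zero_if_norm_le_all:
  assumes "x \<in> carrier V" "\<And>\<epsilon>. \<epsilon> > 0 \<Longrightarrow> nrm V x \<le> K * \<epsilon>"
  shows "x = \<zero>"
proof -
  have "nrm V x \<le> 0"
  proof (rule field_le_epsilon)
    fix \<epsilon> :: real assume "\<epsilon> > 0"
    \<comment> \<open>\<open>K\<close> may be zero or negative, hence the divisor
      \<open>\<bar>K\<bar> + 1\<close>.\<close>
    then have "nrm V x \<le> K * (\<epsilon> / (\<bar>K\<bar> + 1))" by (intro assms) (auto intro: add_nonneg_pos)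
    also have "\<dots> \<le> (\<bar>K\<bar> + 1) * (\<epsilon> / (\<bar>K\<bar> + 1))"
      using \<open>\<epsilon> > 0\<close> by (intro mult_right_mono) (auto intro: add_nonneg_pos)
    also have "\<dots> = \<epsilon>" using abs_ge_zero[of K] by (simp del: abs_ge_zero)
    finally show "nrm V x \<le> 0 + \<epsilon>" by simp
  qed
  then show ?thesis using assms norm_nonneg[of x] norm_eq_zero[of x] by simp
qed

lemma diff_add_diff: "x \<in> carrier V \<Longrightarrow> y \<in> carrier V \<Longrightarrow> z \<in> carrier V \<Longrightarrow> (x \<ominus> y) \<oplus> (y \<ominus> z) = x \<ominus> z"
  by (simp add: a_minus_def M.a_assoc M.r_neg1)

lemma eq_if_diff_zero: "x \<in> carrier V \<Longrightarrow> y \<in> carrier V \<Longrightarrow> x \<ominus> y = \<zero> \<Longrightarrow> x = y"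
  using zero[of x y] by (simp add: norm_dist_def)

end

lemma (in complex_banach_space) convergent_if_geometric:
  assumes r: "\<And>n. r n \<in> carrier V" and c: "0 \<le> c" "c < 1"
    and le: "\<And>n. nrm V (r n \<ominus> r (Suc n)) \<le> K * c ^ n"
  obtains x where "x \<in> carrier V" "\<And>\<epsilon>. \<epsilon> > 0 \<Longrightarrow> \<exists>N. \<forall>n\<ge>N. nrm V (r n \<ominus> x) < \<epsilon>"
proof -
  have K: "0 \<le> K" using le[of 0] r norm_nonneg[of "r 0 \<ominus> r (Suc 0)"] by simp
  have "nrm V (r m \<ominus> r (m + p)) \<le> K * c ^ m * (\<Sum>i<p. c ^ i)" for m p
  proof (induction p)
    case 0
    then show ?case using r by (simp add: a_minus_def M.r_neg)
  next
    case (Suc p)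
    have "r m \<ominus> r (m + Suc p) = (r m \<ominus> r (m + p)) \<oplus> (r (m + p) \<ominus> r (Suc (m + p)))"
      using r by (simp add: diff_add_diff)
    then have "nrm V (r m \<ominus> r (m + Suc p)) \<le> nrm V (r m \<ominus> r (m + p)) + nrm V (r (m + p) \<ominus> r (Suc (m
        + p)))"
      using r norm_triangle by simp
    also have "\<dots> \<le> K * c ^ m * (\<Sum>i<p. c ^ i) + K * c ^ (m + p)"
      by (intro add_mono Suc le)
    finally show ?case by (simp add: algebra_simps power_add)
  qed
  moreover have "(\<Sum>i<p. c ^ i) \<le> 1 / (1 - c)" for p
    using c by (subst sum_gp_strict) (auto intro!: divide_right_mono)
  ultimately have bound: "nrm V (r m \<ominus> r (m + p)) \<le> K * c ^ m * (1 / (1 - c))" for m p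
    using K c by (meson mult_left_mono mult_nonneg_nonneg order_trans zero_le_power)
  have "(\<lambda>m. K * c ^ m * (1 / (1 - c))) \<longlonglongrightarrow> K * 0 * (1 / (1 - c))"
    using c by (intro tendsto_intros LIMSEQ_realpow_zero) auto
  then have small: "\<exists>N. \<forall>m\<ge>N. K * c ^ m * (1 / (1 - c)) < \<epsilon>" if "\<epsilon> > 0" for \<epsilon>
    using order_tendstoD(2)[of _ "K * 0 * (1 / (1 - c))" sequentially \<epsilon>] that
    by (auto simp: eventually_sequentially)
  have "MCauchy r"
    unfolding MCauchy_def
  proof (intro conjI allI impI)
    fix \<epsilon> :: real assume "\<epsilon> > 0"
    then obtain N where N: "\<And>m. m \<ge> N \<Longrightarrow> K * c ^ m * (1 / (1 - c)) < \<epsilon>" using small by blast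
    have "norm_dist V (r m) (r n) < \<epsilon>" if "N \<le> m" "m \<le> n" for m n
      using bound[of m "n - m"] N[of m] that r by (simp add: norm_dist_def)
    then show "\<exists>N. \<forall>n n'. N \<le> n \<longrightarrow> N \<le> n' \<longrightarrow> norm_dist V (r n) (r n') < \<epsilon>"
      by (metis commute nle_le)
  qed (use r in auto)
  then obtain x where x: "limitin mtopology r x sequentially" using complete mcomplete_def by blast
  then have xc: "x \<in> carrier V" using limitin_mspace by blast
  show thesis
  proof (rule that[OF xc])
    fix \<epsilon> :: real assume "\<epsilon> > 0"
    then show "\<exists>N. \<forall>n\<ge>N. nrm V (r n \<ominus> x) < \<epsilon>"
      using x xc r by (auto simp: limit_metric_sequentially norm_dist_def)
  qed
qed

section \<open>Square roots near the unit\<close>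

context cstar_algebra
begin

lemma mult_diff_left: "x \<in> carrier A \<Longrightarrow> y \<in> carrier A \<Longrightarrow> z \<in> carrier A \<Longrightarrow> z \<otimes> (x \<ominus> y) = z \<otimes> x \<ominus> z \<otimes> y"
  by (simp add: diff_eq_scale mult_distrib_left mult_smult_right)

lemma mult_diff_right: "x \<in> carrier A \<Longrightarrow> y \<in> carrier A \<Longrightarrow> z \<in> carrier A \<Longrightarrow> (x \<ominus> y) \<otimes> z = x \<otimes> z \<ominus> y \<otimes> z"
  by (simp add: diff_eq_scale mult_distrib_right mult_smult_left)

lemma star_diff: "x \<in> carrier A \<Longrightarrow> y \<in> carrier A \<Longrightarrow> star A (x \<ominus> y) = star A x \<ominus> star A y"
  by (simp add: diff_eq_scale star_add star_smult)

lemma subalgebraD: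
  assumes "cstar_subalgebra A S"
  shows "submodule S complex_ring A" "closedin (norm_topology A) S" "S \<subseteq> carrier A"
    "x \<in> S \<Longrightarrow> y \<in> S \<Longrightarrow> x \<otimes> y \<in> S" "x \<in> S \<Longrightarrow> star A x \<in> S"
    "x \<in> S \<Longrightarrow> y \<in> S \<Longrightarrow> x \<oplus> y \<in> S" "x \<in> S \<Longrightarrow> z \<odot> x \<in> S"
  using assms unfolding cstar_subalgebra_def
  by (auto intro: submodule_scale submoduleE(5) dest: submoduleE(1))

text \<open>The solution \<open>r\<close> is \<open>(1 - h\<^sup>2)\<^bsup>1/2\<^esup> - 1\<close>, obtained as a fixed point so that no
  unit is needed.\<close>

lemma exists_sqrt:
  assumes S: "cstar_subalgebra A S" and h: "h \<in> S" "star A h = h" "nrm A h \<le> 1 / 2"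
  obtains r where "r \<in> S" "star A r = r" "h \<otimes> r = r \<otimes> h" "h \<otimes> h \<oplus> r \<otimes> r \<oplus> 2 \<odot> r = \<zero>"
proof -
  note Sc = subalgebraD[OF S]
  have hc: "h \<in> carrier A" using h Sc by blast
  \<comment> \<open>A fixed point of \<open>T\<close> satisfies
    \<open>h\<^sup>2 + x\<^sup>2 + 2 x = 0\<close>, that is,
    \<open>(1 + x)\<^sup>2 = 1 - h\<^sup>2\<close>.\<close>
  define T where "T x = (-1/2) \<odot> (h \<otimes> h \<oplus> x \<otimes> x)" for x
  define r where "r n = (T ^^ n) \<zero>" for n
  have r_Suc: "r (Suc n) = T (r n)" for n by (simp add: r_def)
  \<comment> \<open>The ball of radius 1/4 is invariant since
    \<open>(1/4 + 1/16) / 2 \<le> 1/4\<close>, and by \<open>lip\<close> the map \<open>T\<close>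
    contracts it by the factor 1/4. Membership in \<open>S\<close>, self-adjointness and commutation
    with \<open>h\<close> are carried along because they survive the limit.\<close>
  have r: "r n \<in> S \<and> star A (r n) = r n \<and> h \<otimes> r n = r n \<otimes> h \<and> nrm A (r n) \<le> 1 / 4" for n
  proof (induction n)
    case 0
    then show ?case using submodule_zero[OF Sc(1)] hc by (simp add: r_def)
  next
    case (Suc n)
    then have c: "r n \<in> carrier A" using Sc by blast
    have hr: "h \<otimes> r n = r n \<otimes> h" using Suc by blast
    have "h \<otimes> (r n \<otimes> r n) = (h \<otimes> r n) \<otimes> r n" using c hc by (simp add: mult_assoc)
    also have "\<dots> = r n \<otimes> (h \<otimes> r n)" unfolding hr using c hc by (simp add: mult_assoc hr)
    also have "\<dots> = (r n \<otimes> r n) \<otimes> h" unfolding hr using c hc by (simp add: mult_assoc)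
    finally have comm: "h \<otimes> (r n \<otimes> r n) = (r n \<otimes> r n) \<otimes> h" .
    have "nrm A (h \<otimes> h \<oplus> r n \<otimes> r n) \<le> nrm A (h \<otimes> h) + nrm A (r n \<otimes> r n)"
      using c hc by (intro norm_triangle) auto
    also have "\<dots> \<le> nrm A h * nrm A h + nrm A (r n) * nrm A (r n)"
      using c hc by (intro add_mono norm_mult) auto
    also have "\<dots> \<le> 1/2 * (1/2) + 1/4 * (1/4)"
      using Suc c h hc by (intro add_mono mult_mono) (auto simp: norm_nonneg)
    finally show ?case
      using Suc h Sc comm c hc unfolding r_Suc T_def
      by (simp add: star_smult star_add star_mult mult_distrib_left mult_distrib_right
          mult_smult_left mult_smult_right mult_assoc norm_smult)
  qed
  have rc: "r n \<in> carrier A" for n using r[of n] Sc by blast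
  \<comment> \<open>The identity \<open>x\<^sup>2 - y\<^sup>2 = x (x - y) + (x - y) y\<close> holds
    without commutativity.\<close>
  have diff: "T x \<ominus> T y = (-1/2) \<odot> (x \<otimes> (x \<ominus> y) \<oplus> (x \<ominus> y) \<otimes> y)"
    if "x \<in> carrier A" "y \<in> carrier A" for x y
  proof -
    have "x \<otimes> (x \<ominus> y) \<oplus> (x \<ominus> y) \<otimes> y = x \<otimes> x \<ominus> y \<otimes> y"
      using that by (simp add: mult_diff_left mult_diff_right diff_add_diff)
    moreover have "T x \<ominus> T y = (-1/2) \<odot> (x \<otimes> x \<ominus> y \<otimes> y)"
    proof -
      have "h \<otimes> h \<oplus> x \<otimes> x \<ominus> (h \<otimes> h \<oplus> y \<otimes> y) = x \<otimes> x \<ominus> y \<otimes> y"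
      proof -
        have "h \<otimes> h \<oplus> x \<otimes> x \<ominus> (h \<otimes> h \<oplus> y \<otimes> y) = (h \<otimes> h \<oplus> \<ominus> (h \<otimes> h)) \<oplus> (x \<otimes> x \<oplus> \<ominus> (y \<otimes> y))"
          using that hc by (simp add: a_minus_def M.minus_add M.a_ac)
        then show ?thesis using that hc by (simp add: M.r_neg a_minus_def)
      qed
      moreover have "T x \<ominus> T y = (-1/2) \<odot> (h \<otimes> h \<oplus> x \<otimes> x \<ominus> (h \<otimes> h \<oplus> y \<otimes> y))"
        unfolding T_def using that hc by (simp add: diff_eq_scale scale_add_right)
      ultimately show ?thesis by simp
    qed
    ultimately show ?thesis by simp
  qed
  have lip: "nrm A (T x \<ominus> T y) \<le> 1 / 2 * ((nrm A x + nrm A y) * nrm A (x \<ominus> y))"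
    if "x \<in> carrier A" "y \<in> carrier A" for x y
  proof -
    have "nrm A (x \<otimes> (x \<ominus> y) \<oplus> (x \<ominus> y) \<otimes> y) \<le> nrm A x * nrm A (x \<ominus> y) + nrm A (x \<ominus> y) * nrm A y"
      using that by (intro order_trans[OF norm_triangle] add_mono norm_mult) auto
    then show ?thesis unfolding diff[OF that] using that by (simp add: norm_smult algebra_simps)
  qed
  have step: "nrm A (r n \<ominus> r (Suc n)) \<le> 1 * (1 / 4) ^ n" for n
  proof (induction n)
    case 0
    have "nrm A (r 0 \<ominus> r (Suc 0)) \<le> nrm A (r 0) + nrm A (r (Suc 0))" using rc by (intro
        norm_diff_triangle)
    then show ?case using r[of 0] r[of "Suc 0"] by simp
  next
    case (Suc n)
    have "nrm A (r (Suc n) \<ominus> r (Suc (Suc n))) \<le> 1 / 2 * ((nrm A (r n) + nrm A (r (Suc n))) * nrm A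
        (r n \<ominus> r (Suc n)))"
      using lip[OF rc rc, of n "Suc n"] unfolding r_Suc[symmetric] .
    also have "\<dots> \<le> 1 / 2 * ((1 / 4 + 1 / 4) * (1 * (1 / 4) ^ n))"
      using r[of n] r[of "Suc n"] rc by (intro mult_left_mono mult_mono add_mono Suc) (auto simp:
          norm_nonneg)
    finally show ?case by simp
  qed
  obtain x where x: "x \<in> carrier A" "\<And>\<epsilon>. \<epsilon> > 0 \<Longrightarrow> \<exists>N. \<forall>n\<ge>N. nrm A (r n \<ominus> x) < \<epsilon>"
    using convergent_if_geometric[OF rc _ _ step] by auto
  \<comment> \<open>Two consecutive iterates close to \<open>x\<close> are wanted in order to pass
    to the limit in \<open>r (Suc n) = T (r n)\<close>.\<close>
  have near: "\<exists>n. nrm A (x \<ominus> r n) < \<epsilon> \<and> nrm A (x \<ominus> r (Suc n)) < \<epsilon>" if "\<epsilon> > 0" for \<epsilon>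
  proof -
    obtain N where "\<forall>n\<ge>N. nrm A (r n \<ominus> x) < \<epsilon>" using x(2)[OF \<open>\<epsilon> > 0\<close>] by blast
    then show ?thesis using norm_diff_commute[OF x(1) rc] by (metis le_add1 le_refl plus_1_eq_Suc
        add.commute)
  qed
  have "x \<in> S"
    using near r by (intro closedin_approx[OF Sc(2) x(1)]) blast
  moreover have "star A x = x"
  proof (rule eq_if_diff_zero)
    show "star A x \<ominus> x = \<zero>"
    proof (rule eq_zero_if_norm_le_all[where K = 2])
      fix \<epsilon> :: real assume "\<epsilon> > 0"
      then obtain n where n: "nrm A (x \<ominus> r n) < \<epsilon>" using near by blast
      have "star A x \<ominus> x = star A (x \<ominus> r n) \<oplus> (r n \<ominus> x)"
        using x rc r[of n] by (simp add: star_diff diff_add_diff)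
      then have "nrm A (star A x \<ominus> x) \<le> nrm A (x \<ominus> r n) + nrm A (x \<ominus> r n)"
        using norm_triangle[of "star A (x \<ominus> r n)" "r n \<ominus> x"] x rc
        by (simp add: norm_diff_commute[OF x(1) rc])
      then show "nrm A (star A x \<ominus> x) \<le> 2 * \<epsilon>" using n by simp
    qed (use x in simp)
  qed (use x in simp_all)
  moreover have "h \<otimes> x = x \<otimes> h"
  proof (rule eq_if_diff_zero)
    show "h \<otimes> x \<ominus> x \<otimes> h = \<zero>"
    proof (rule eq_zero_if_norm_le_all[where K = 1])
      fix \<epsilon> :: real assume "\<epsilon> > 0"
      then obtain n where n: "nrm A (x \<ominus> r n) < \<epsilon>" using near by blast
      have "h \<otimes> x \<ominus> x \<otimes> h = h \<otimes> (x \<ominus> r n) \<oplus> (r n \<ominus> x) \<otimes> h"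
        using x rc r[of n] hc by (simp add: mult_diff_left mult_diff_right diff_add_diff)
      then have "nrm A (h \<otimes> x \<ominus> x \<otimes> h) \<le> nrm A h * nrm A (x \<ominus> r n) + nrm A (r n \<ominus> x) * nrm A h"
        using x rc hc by (auto intro!: order_trans[OF norm_triangle] add_mono norm_mult)
      also have "\<dots> = (2 * nrm A h) * nrm A (x \<ominus> r n)"
        by (simp add: norm_diff_commute[OF x(1) rc])
      also have "\<dots> \<le> 1 * \<epsilon>" using n h x rc hc by (intro mult_mono) (auto simp: norm_nonneg)
      finally show "nrm A (h \<otimes> x \<ominus> x \<otimes> h) \<le> 1 * \<epsilon>" .
    qed (use x hc in simp)
  qed (use x hc in simp_all)
  moreover have "x = T x"
  proof (rule eq_if_diff_zero)
    have Tc: "T y \<in> carrier A" if "y \<in> carrier A" for y using that hc by (simp add: T_def)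
    show "x \<ominus> T x = \<zero>"
    proof (rule eq_zero_if_norm_le_all[where K = "1 + (1 + nrm A x)"])
      fix \<epsilon> :: real assume "\<epsilon> > 0"
      then obtain n where n: "nrm A (x \<ominus> r n) < \<epsilon>" "nrm A (x \<ominus> r (Suc n)) < \<epsilon>" using near by blast
      have "x \<ominus> T x = (x \<ominus> r (Suc n)) \<oplus> (T (r n) \<ominus> T x)"
        using x rc Tc r_Suc by (simp add: diff_add_diff)
      then have "nrm A (x \<ominus> T x) \<le> nrm A (x \<ominus> r (Suc n)) + nrm A (T (r n) \<ominus> T x)"
        using x rc Tc norm_triangle by simp
      also have "\<dots> \<le> nrm A (x \<ominus> r (Suc n)) + 1 / 2 * ((nrm A (r n) + nrm A x) * nrm A (x \<ominus> r n))"
        using lip[OF rc x(1), of n] by (simp add: norm_diff_commute[OF x(1) rc])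
      also have "\<dots> \<le> \<epsilon> + 1 * ((1 + nrm A x) * \<epsilon>)"
        using n r[of n] x rc by (intro add_mono mult_mono) (auto simp: norm_nonneg)
      finally show "nrm A (x \<ominus> T x) \<le> (1 + (1 + nrm A x)) * \<epsilon>" by (simp add: algebra_simps)
    qed (use x Tc in simp)
  qed (use x hc in \<open>simp_all add: T_def\<close>)
  then have "h \<otimes> h \<oplus> x \<otimes> x \<oplus> 2 \<odot> x = h \<otimes> h \<oplus> x \<otimes> x \<oplus> 2 \<odot> T x" by simp
  then have "h \<otimes> h \<oplus> x \<otimes> x \<oplus> 2 \<odot> x = \<zero>"
    using x hc M.r_neg[of "h \<otimes> h \<oplus> x \<otimes> x"] by (simp add: T_def neg_eq_scale)
  ultimately show thesis using that by blast
qed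

text \<open>In a unitization \<open>X + \<i>(1 + R)\<close> would be a unitary with real part \<open>X\<close>.\<close>

lemma norm_le_one_if_sqrt:
  assumes X: "X \<in> carrier A" "star A X = X" and R: "R \<in> carrier A" "star A R = R"
    and comm: "X \<otimes> R = R \<otimes> X" and eq: "X \<otimes> X \<oplus> R \<otimes> R \<oplus> 2 \<odot> R = \<zero>"
  shows "nrm A X \<le> 1"
proof -
  \<comment> \<open>\<open>a + \<i> b\<close> is \<open>X\<close> times the unitary of the
    unitization. It lies in the algebra itself and has the norm of \<open>X\<close>, and so does
    \<open>a - \<i> b\<close>. Half of their sum is \<open>X\<^sup>2\<close>, so the square of the
    norm of \<open>X\<close> is at most that norm.\<close>
  define a where "a = X \<otimes> X"
  define b where "b = X \<oplus> R \<otimes> X"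
  have ab: "a \<in> carrier A" "b \<in> carrier A" "star A a = a" "star A b = b"
    using X R comm by (simp_all add: a_def b_def star_add star_mult)
  have comm': "a \<otimes> b = b \<otimes> a"
  proof -
    have "X \<otimes> (X \<otimes> (R \<otimes> X)) = R \<otimes> (X \<otimes> (X \<otimes> X))"
      using X R comm by (metis mult_assoc mult_closed)
    then show ?thesis using X R by (simp add: a_def b_def mult_distrib_left mult_distrib_right
        mult_assoc)
  qed
  have sum: "a \<otimes> a \<oplus> b \<otimes> b = X \<otimes> X"
  proof -
    have RX: "R \<otimes> X = X \<otimes> R" and RXy: "R \<otimes> (X \<otimes> y) = X \<otimes> (R \<otimes> y)" if "y \<in> carrier A" for y
      using X R comm that by (simp_all flip: mult_assoc)
    have "b \<otimes> b = X \<otimes> X \<oplus> (X \<otimes> (X \<otimes> R) \<oplus> (X \<otimes> (X \<otimes> R) \<oplus> X \<otimes> (X \<otimes> (R \<otimes> R))))"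
      using X R by (simp add: b_def mult_distrib_left mult_distrib_right mult_assoc RX[OF X(1)] RXy
          M.a_ac)
    moreover have "a \<otimes> a = X \<otimes> (X \<otimes> (X \<otimes> X))" using X by (simp add: a_def mult_assoc)
    ultimately have "a \<otimes> a \<oplus> b \<otimes> b = X \<otimes> X \<oplus>
       (X \<otimes> (X \<otimes> (X \<otimes> X)) \<oplus> (X \<otimes> (X \<otimes> (R \<otimes> R)) \<oplus> (X \<otimes> (X \<otimes> R) \<oplus> X \<otimes> (X \<otimes> R))))"
      using X R by (simp add: M.a_ac)
    also have "X \<otimes> (X \<otimes> (X \<otimes> X)) \<oplus> (X \<otimes> (X \<otimes> (R \<otimes> R)) \<oplus> (X \<otimes> (X \<otimes> R) \<oplus> X \<otimes> (X \<otimes> R))) =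
        X \<otimes> (X \<otimes> (X \<otimes> X \<oplus> R \<otimes> R \<oplus> 2 \<odot> R))"
      using X R scale_add_left[of "X \<otimes> (X \<otimes> R)" 1 1]
      by (simp add: mult_distrib_left mult_smult_right M.a_assoc)
    finally show ?thesis unfolding eq using X by simp
  qed
  have norm_eq: "nrm A (a \<oplus> s \<odot> b) = nrm A X" if "cnj s = - s" "cnj s * s = 1" for s
  proof -
    have "star A (a \<oplus> s \<odot> b) \<otimes> (a \<oplus> s \<odot> b) = a \<otimes> a \<oplus> (s \<odot> (a \<otimes> b) \<oplus> (cnj s \<odot> (b \<otimes> a) \<oplus> (cnj s * s) \<odot>
        (b \<otimes> b)))"
      using ab by (simp add: star_add star_smult mult_distrib_left mult_distrib_right
          mult_smult_left mult_smult_right M.a_ac mult.commute scale_add_right)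
    also have "\<dots> = (a \<otimes> a \<oplus> b \<otimes> b) \<oplus> (s \<odot> (a \<otimes> b) \<oplus> (- s) \<odot> (a \<otimes> b))"
      unfolding that(2) unfolding that(1) comm' using ab by (simp add: M.a_ac)
    also have "\<dots> = X \<otimes> X"
      using ab scale_add_left[of "a \<otimes> b" s "- s"] X by (simp add: sum)
    finally have "(nrm A (a \<oplus> s \<odot> b))\<^sup>2 = nrm A (X \<otimes> X)"
      using cstar_identity[of "a \<oplus> s \<odot> b"] ab by simp
    then have "(nrm A (a \<oplus> s \<odot> b))\<^sup>2 = (nrm A X)\<^sup>2"
      using cstar_identity[of X] X by simp
    then show ?thesis using ab X by (simp add: norm_nonneg)
  qed
  have "(a \<oplus> \<i> \<odot> b) \<oplus> (a \<oplus> (- \<i>) \<odot> b) = (a \<oplus> a) \<oplus> (\<i> \<odot> b \<oplus> (- \<i>) \<odot> b)"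
    using ab by (simp add: M.a_ac)
  also have "\<dots> = 2 \<odot> a"
    using ab scale_add_left[of b \<i> "- \<i>"] scale_add_left[of a 1 1] by simp
  finally have "nrm A (2 \<odot> a) \<le> nrm A (a \<oplus> \<i> \<odot> b) + nrm A (a \<oplus> (- \<i>) \<odot> b)"
    using norm_triangle[of "a \<oplus> \<i> \<odot> b" "a \<oplus> (- \<i>) \<odot> b"] ab by simp
  then have "nrm A a \<le> nrm A X" using ab by (simp add: norm_eq norm_smult)
  moreover have "nrm A a = (nrm A X)\<^sup>2" using cstar_identity[of X] X by (simp add: a_def)
  ultimately show ?thesis using X norm_nonneg[of X]
    by (cases "nrm A X = 0") (auto simp: power2_eq_square)
qed

end

text \<open>For \<open>h\<close> of norm at most 1/2, \<open>exists_sqrt\<close> finds a partner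
  \<open>r\<close> inside \<open>S\<close>. The algebraic relation between \<open>h\<close> and
  \<open>r\<close> is preserved by \<open>\<phi>\<close>, and by itself it bounds the norm of
  \<open>\<phi> h\<close> by 1. Rescaling to norm 1/2 is the origin of the factor 2.\<close>

lemma star_hom_bounded:
  assumes "cstar_algebra A" "cstar_algebra C" and S: "cstar_subalgebra A S"
    and \<phi>: "\<And>x. x \<in> S \<Longrightarrow> \<phi> x \<in> carrier C"
    and add: "\<And>x y. x \<in> S \<Longrightarrow> y \<in> S \<Longrightarrow> \<phi> (x \<oplus>\<^bsub>A\<^esub> y) = \<phi> x \<oplus>\<^bsub>C\<^esub> \<phi> y"
    and mult: "\<And>x y. x \<in> S \<Longrightarrow> y \<in> S \<Longrightarrow> \<phi> (x \<otimes>\<^bsub>A\<^esub> y) = \<phi> x \<otimes>\<^bsub>C\<^esub> \<phi> y"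
    and scale: "\<And>x z. x \<in> S \<Longrightarrow> \<phi> (z \<odot>\<^bsub>A\<^esub> x) = z \<odot>\<^bsub>C\<^esub> \<phi> x"
    and star: "\<And>x. x \<in> S \<Longrightarrow> \<phi> (star A x) = star C (\<phi> x)"
    and h: "h \<in> S" "star A h = h"
  shows "nrm C (\<phi> h) \<le> 2 * nrm A h"
proof -
  interpret A: cstar_algebra A by fact
  interpret C: cstar_algebra C by fact
  note Sc = A.subalgebraD[OF S]
  have zero: "\<phi> \<zero>\<^bsub>A\<^esub> = \<zero>\<^bsub>C\<^esub>"
    using scale[OF h(1), of 0] h Sc \<phi> by (auto simp: subset_iff)
  have le: "nrm C (\<phi> h) \<le> 1" if h: "h \<in> S" "star A h = h" "nrm A h \<le> 1 / 2" for h
  proof -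
    obtain r where r: "r \<in> S" "star A r = r" "h \<otimes>\<^bsub>A\<^esub> r = r \<otimes>\<^bsub>A\<^esub> h"
      "h \<otimes>\<^bsub>A\<^esub> h \<oplus>\<^bsub>A\<^esub> r \<otimes>\<^bsub>A\<^esub> r \<oplus>\<^bsub>A\<^esub> 2 \<odot>\<^bsub>A\<^esub> r = \<zero>\<^bsub>A\<^esub>"
      using A.exists_sqrt[OF S h] by blast
    have "\<phi> (h \<otimes>\<^bsub>A\<^esub> h \<oplus>\<^bsub>A\<^esub> r \<otimes>\<^bsub>A\<^esub> r \<oplus>\<^bsub>A\<^esub> 2 \<odot>\<^bsub>A\<^esub> r) =
        \<phi> h \<otimes>\<^bsub>C\<^esub> \<phi> h \<oplus>\<^bsub>C\<^esub> \<phi> r \<otimes>\<^bsub>C\<^esub> \<phi> r \<oplus>\<^bsub>C\<^esub> 2 \<odot>\<^bsub>C\<^esub> \<phi> r"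
      using h r(1) Sc by (simp add: add mult scale)
    then show ?thesis
      using h r \<phi> mult[OF h(1) r(1)] mult[OF r(1) h(1)] star[of h] star[of r] zero
      by (intro C.norm_le_one_if_sqrt[of _ "\<phi> r"]) auto
  qed
  show ?thesis
  proof (cases "nrm A h = 0")
    case True
    then have "h = \<zero>\<^bsub>A\<^esub>" using A.norm_eq_zero h Sc by blast
    then show ?thesis using zero by simp
  next
    case False
    have hc: "h \<in> carrier A" using h Sc by blast
    then have pos: "0 < nrm A h" using False A.norm_nonneg[of h] by simp
    define c where "c = 1 / (2 * nrm A h)"
    have c: "0 \<le> c" "c * nrm A h = 1 / 2" using pos by (simp_all add: c_def)
    then have "nrm C (\<phi> (complex_of_real c \<odot>\<^bsub>A\<^esub> h)) \<le> 1"
      using h hc Sc by (intro le) (auto simp: A.star_smult A.norm_smult)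
    then have "c * nrm C (\<phi> h) \<le> 1"
      using h \<phi> c by (simp add: scale C.norm_smult)
    then show ?thesis using pos by (simp add: c_def field_simps)
  qed
qed

section \<open>Aperiodic paths\<close>

lemma Nk_add [simp]: "m \<in> Nk k \<Longrightarrow> n \<in> Nk k \<Longrightarrow> m + n \<in> Nk k"
  by (simp add: Nk_def)

lemma Nk_diff [simp]: "m \<in> Nk k \<Longrightarrow> m - n \<in> Nk k"
  by (simp add: Nk_def)

lemma Nk_sup [simp]: "m \<in> Nk k \<Longrightarrow> n \<in> Nk k \<Longrightarrow> sup m n \<in> Nk k"
  by (simp add: Nk_def)

lemma Nk_zero [simp]: "0 \<in> Nk k"
  by (simp add: Nk_def)

context k_graph
begin

declare rng_closed [simp] src_closed [simp] pcomp_closed [simp] rng_pcomp [simp] src_pcomp [simp]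
  deg_closed [simp] deg_pcomp [simp] rng_rng [simp] src_rng [simp] rng_src [simp] src_src [simp]
  pcomp_rng [simp] pcomp_src [simp] deg_identity [simp]

lemma deg_src [simp]: "\<kappa> \<in> paths \<Lambda> \<Longrightarrow> deg \<Lambda> (src \<Lambda> \<kappa>) = 0"
  using deg_identity[of "src \<Lambda> \<kappa>"] by simp

lemma rng_vertex [simp]: "\<kappa> \<in> paths \<Lambda> \<Longrightarrow> rng \<Lambda> \<kappa> \<in> vertices \<Lambda>"
  and src_vertex [simp]: "\<kappa> \<in> paths \<Lambda> \<Longrightarrow> src \<Lambda> \<kappa> \<in> vertices \<Lambda>"
  by (simp_all add: vertices_def)

lemma factor:
  assumes "\<kappa> \<in> paths \<Lambda>" "m \<in> Nk k" "n \<in> Nk k" "deg \<Lambda> \<kappa> = m + n"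
  obtains \<mu> \<nu> where "\<mu> \<in> paths \<Lambda>" "\<nu> \<in> paths \<Lambda>" "src \<Lambda> \<mu> = rng \<Lambda> \<nu>" "\<kappa> = pcomp \<Lambda> \<mu> \<nu>"
    "deg \<Lambda> \<mu> = m" "deg \<Lambda> \<nu> = n"
  using ex1_implies_ex[OF factorisation[OF assms]] by auto

lemma factor_unique:
  assumes "\<mu> \<in> paths \<Lambda>" "\<nu> \<in> paths \<Lambda>" "src \<Lambda> \<mu> = rng \<Lambda> \<nu>"
    and "\<mu>' \<in> paths \<Lambda>" "\<nu>' \<in> paths \<Lambda>" "src \<Lambda> \<mu>' = rng \<Lambda> \<nu>'"
    and eq: "pcomp \<Lambda> \<mu> \<nu> = pcomp \<Lambda> \<mu>' \<nu>'" and deg: "deg \<Lambda> \<mu> = deg \<Lambda> \<mu>'"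
  shows "\<mu> = \<mu>'" "\<nu> = \<nu>'"
proof -
  have "deg \<Lambda> \<mu> + deg \<Lambda> \<nu> = deg \<Lambda> \<mu>' + deg \<Lambda> \<nu>'"
    using assms deg_pcomp[of \<mu> \<nu>] deg_pcomp[of \<mu>' \<nu>'] by simp
  then have "deg \<Lambda> \<nu> = deg \<Lambda> \<nu>'" using deg by simp
  moreover have "\<exists>!(x, y). x \<in> paths \<Lambda> \<and> y \<in> paths \<Lambda> \<and> src \<Lambda> x = rng \<Lambda> y \<and>
     pcomp \<Lambda> x y = pcomp \<Lambda> \<mu> \<nu> \<and> deg \<Lambda> x = deg \<Lambda> \<mu> \<and> deg \<Lambda> y = deg \<Lambda> \<nu>"
    using assms(1-3) by (intro factorisation) auto
  ultimately have "(\<mu>, \<nu>) = (\<mu>', \<nu>')"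
    using assms by (elim ex1E) (metis (mono_tags, lifting) case_prodI)
  then show "\<mu> = \<mu>'" "\<nu> = \<nu>'" by auto
qed

text \<open>A path \<open>v\<close> of degree zero has the two factorisations
  \<open>pcomp \<Lambda> (rng \<Lambda> v) v\<close> and
  \<open>pcomp \<Lambda> v (src \<Lambda> v)\<close>, whose first factors both have degree zero;
  uniqueness identifies \<open>v\<close> with its range.\<close>

lemma vertex_simps [simp]:
  assumes "v \<in> vertices \<Lambda>" shows "v \<in> paths \<Lambda>" "rng \<Lambda> v = v" "src \<Lambda> v = v" "deg \<Lambda> v = 0"
proof -
  show v: "v \<in> paths \<Lambda>" "deg \<Lambda> v = 0" using assms by (auto simp: vertices_def)
  show "rng \<Lambda> v = v" using factor_unique(1)[of "rng \<Lambda> v" v v "src \<Lambda> v"] v by simp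
  then show "src \<Lambda> v = v" using src_rng[OF v(1)] by simp
qed

lemma pcomp_vertex [simp]: "\<kappa> \<in> paths \<Lambda> \<Longrightarrow> src \<Lambda> \<kappa> = v \<Longrightarrow> pcomp \<Lambda> \<kappa> v = \<kappa>"
  "\<kappa> \<in> paths \<Lambda> \<Longrightarrow> rng \<Lambda> \<kappa> = v \<Longrightarrow> pcomp \<Lambda> v \<kappa> = \<kappa>"
  using pcomp_src pcomp_rng by auto

text \<open>The segments \<open>\<xi>(a, a + d)\<close> and \<open>\<xi>(b, b + d)\<close> differ for some \<open>d\<close>.\<close>

definition shift_distinct :: "'l \<Rightarrow> (nat \<Rightarrow> nat) \<Rightarrow> (nat \<Rightarrow> nat) \<Rightarrow> bool" where
  "shift_distinct \<xi> a b \<longleftrightarrow> (\<exists>\<alpha>\<in>paths \<Lambda>. \<exists>\<mu>\<in>paths \<Lambda>. \<exists>\<beta>\<in>paths \<Lambda>. \<exists>\<gamma>\<in>paths \<Lambda>. \<exists>\<nu>\<in>paths \<Lambda>. \<exists>\<delta>\<in>paths \<Lambda>.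
     src \<Lambda> \<alpha> = rng \<Lambda> \<mu> \<and> src \<Lambda> \<mu> = rng \<Lambda> \<beta> \<and> src \<Lambda> \<gamma> = rng \<Lambda> \<nu> \<and> src \<Lambda> \<nu> = rng \<Lambda> \<delta> \<and>
     \<xi> = pcomp \<Lambda> \<alpha> (pcomp \<Lambda> \<mu> \<beta>) \<and> \<xi> = pcomp \<Lambda> \<gamma> (pcomp \<Lambda> \<nu> \<delta>) \<and>
     deg \<Lambda> \<alpha> = a \<and> deg \<Lambda> \<gamma> = b \<and> deg \<Lambda> \<mu> = deg \<Lambda> \<nu> \<and> \<mu> \<noteq> \<nu>)"

lemma shift_distinctI:
  assumes "\<alpha> \<in> paths \<Lambda>" "\<mu> \<in> paths \<Lambda>" "\<beta> \<in> paths \<Lambda>" "\<gamma> \<in> paths \<Lambda>" "\<nu> \<in> paths \<Lambda>" "\<delta> \<in> paths \<Lambda>"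
    "src \<Lambda> \<alpha> = rng \<Lambda> \<mu>" "src \<Lambda> \<mu> = rng \<Lambda> \<beta>" "src \<Lambda> \<gamma> = rng \<Lambda> \<nu>" "src \<Lambda> \<nu> = rng \<Lambda> \<delta>"
    "\<xi> = pcomp \<Lambda> \<alpha> (pcomp \<Lambda> \<mu> \<beta>)" "\<xi> = pcomp \<Lambda> \<gamma> (pcomp \<Lambda> \<nu> \<delta>)"
    "deg \<Lambda> \<alpha> = a" "deg \<Lambda> \<gamma> = b" "deg \<Lambda> \<mu> = deg \<Lambda> \<nu>" "\<mu> \<noteq> \<nu>"
  shows "shift_distinct \<xi> a b"
  unfolding shift_distinct_def using assms by blast

lemma shift_distinctE:
  assumes "shift_distinct \<xi> a b"
  obtains \<alpha> \<mu> \<beta> \<gamma> \<nu> \<delta> where "\<alpha> \<in> paths \<Lambda>" "\<mu> \<in> paths \<Lambda>" "\<beta> \<in> paths \<Lambda>" "\<gamma> \<in> paths \<Lambda>" "\<nu> \<in> paths \<Lambda>" "\<delta>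
      \<in> paths \<Lambda>"
    "src \<Lambda> \<alpha> = rng \<Lambda> \<mu>" "src \<Lambda> \<mu> = rng \<Lambda> \<beta>" "src \<Lambda> \<gamma> = rng \<Lambda> \<nu>" "src \<Lambda> \<nu> = rng \<Lambda> \<delta>"
    "\<xi> = pcomp \<Lambda> \<alpha> (pcomp \<Lambda> \<mu> \<beta>)" "\<xi> = pcomp \<Lambda> \<gamma> (pcomp \<Lambda> \<nu> \<delta>)"
    "deg \<Lambda> \<alpha> = a" "deg \<Lambda> \<gamma> = b" "deg \<Lambda> \<mu> = deg \<Lambda> \<nu>" "\<mu> \<noteq> \<nu>"
  using assms unfolding shift_distinct_def by blast

lemma shift_distinct_extend_right:
  assumes "shift_distinct \<xi> a b" "\<zeta> \<in> paths \<Lambda>" "src \<Lambda> \<xi> = rng \<Lambda> \<zeta>"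
  shows "shift_distinct (pcomp \<Lambda> \<xi> \<zeta>) a b"
proof -
  obtain \<alpha> \<mu> \<beta> \<gamma> \<nu> \<delta> where *: "\<alpha> \<in> paths \<Lambda>" "\<mu> \<in> paths \<Lambda>" "\<beta> \<in> paths \<Lambda>" "\<gamma> \<in> paths \<Lambda>" "\<nu> \<in> paths \<Lambda>"
      "\<delta> \<in> paths \<Lambda>"
     "src \<Lambda> \<alpha> = rng \<Lambda> \<mu>" "src \<Lambda> \<mu> = rng \<Lambda> \<beta>" "src \<Lambda> \<gamma> = rng \<Lambda> \<nu>" "src \<Lambda> \<nu> = rng \<Lambda> \<delta>"
     "\<xi> = pcomp \<Lambda> \<alpha> (pcomp \<Lambda> \<mu> \<beta>)" "\<xi> = pcomp \<Lambda> \<gamma> (pcomp \<Lambda> \<nu> \<delta>)"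
     "deg \<Lambda> \<alpha> = a" "deg \<Lambda> \<gamma> = b" "deg \<Lambda> \<mu> = deg \<Lambda> \<nu>" "\<mu> \<noteq> \<nu>"
    using shift_distinctE[OF assms(1)] by metis
  have "src \<Lambda> \<xi> = src \<Lambda> \<beta>" unfolding *(11) using *(1-10) by simp
  moreover have "src \<Lambda> \<xi> = src \<Lambda> \<delta>" unfolding *(12) using *(1-10) by simp
  ultimately have src: "src \<Lambda> \<beta> = rng \<Lambda> \<zeta>" "src \<Lambda> \<delta> = rng \<Lambda> \<zeta>" using assms(3) by simp_all
  have "pcomp \<Lambda> \<xi> \<zeta> = pcomp \<Lambda> \<alpha> (pcomp \<Lambda> \<mu> (pcomp \<Lambda> \<beta> \<zeta>))"
    unfolding *(11) using *(1-10) assms(2) src by (simp add: pcomp_assoc)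
  moreover have "pcomp \<Lambda> \<xi> \<zeta> = pcomp \<Lambda> \<gamma> (pcomp \<Lambda> \<nu> (pcomp \<Lambda> \<delta> \<zeta>))"
    unfolding *(12) using *(1-10) assms(2) src by (simp add: pcomp_assoc)
  ultimately show ?thesis
    using *(1-10) *(13-16) assms(2) src
    by (intro shift_distinctI[of \<alpha> \<mu> "pcomp \<Lambda> \<beta> \<zeta>" \<gamma> \<nu> "pcomp \<Lambda> \<delta> \<zeta>"]) simp_all
qed

text \<open>Prefixing \<open>\<zeta>\<close> moves the differing segments to positions
  \<open>a + deg \<Lambda> \<zeta>\<close> and \<open>b + deg \<Lambda> \<zeta>\<close>. To return
  to \<open>a\<close> and \<open>b\<close>, the new prefixes are cut again at these degrees, and the
  leftover pieces \<open>g\<close> and \<open>h\<close>, both of the degree of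
  \<open>\<zeta>\<close>, are absorbed into the segments. The longer segments still differ by unique
  factorisation.\<close>

lemma shift_distinct_extend_left:
  assumes "shift_distinct \<xi> a b" "\<zeta> \<in> paths \<Lambda>" "src \<Lambda> \<zeta> = rng \<Lambda> \<xi>"
  shows "shift_distinct (pcomp \<Lambda> \<zeta> \<xi>) a b"
proof -
  obtain \<alpha> \<mu> \<beta> \<gamma> \<nu> \<delta> where *: "\<alpha> \<in> paths \<Lambda>" "\<mu> \<in> paths \<Lambda>" "\<beta> \<in> paths \<Lambda>" "\<gamma> \<in> paths \<Lambda>" "\<nu> \<in> paths \<Lambda>"
      "\<delta> \<in> paths \<Lambda>"
     "src \<Lambda> \<alpha> = rng \<Lambda> \<mu>" "src \<Lambda> \<mu> = rng \<Lambda> \<beta>" "src \<Lambda> \<gamma> = rng \<Lambda> \<nu>" "src \<Lambda> \<nu> = rng \<Lambda> \<delta>"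
     "\<xi> = pcomp \<Lambda> \<alpha> (pcomp \<Lambda> \<mu> \<beta>)" "\<xi> = pcomp \<Lambda> \<gamma> (pcomp \<Lambda> \<nu> \<delta>)"
     "deg \<Lambda> \<alpha> = a" "deg \<Lambda> \<gamma> = b" "deg \<Lambda> \<mu> = deg \<Lambda> \<nu>" "\<mu> \<noteq> \<nu>"
    using shift_distinctE[OF assms(1)] by metis
  have "rng \<Lambda> \<xi> = rng \<Lambda> \<alpha>" unfolding *(11) using *(1-10) by simp
  moreover have "rng \<Lambda> \<xi> = rng \<Lambda> \<gamma>" unfolding *(12) using *(1-10) by simp
  ultimately have rng: "src \<Lambda> \<zeta> = rng \<Lambda> \<alpha>" "src \<Lambda> \<zeta> = rng \<Lambda> \<gamma>" using assms(3) by simp_all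
  have deg: "a \<in> Nk k" "b \<in> Nk k" "deg \<Lambda> (pcomp \<Lambda> \<zeta> \<alpha>) = a + deg \<Lambda> \<zeta>" "deg \<Lambda> (pcomp \<Lambda> \<zeta> \<gamma>) = b + deg \<Lambda> \<zeta>"
    using *(1,4) *(13,14) rng assms(2) by (auto simp: add.commute)
  obtain \<alpha>' g where g: "\<alpha>' \<in> paths \<Lambda>" "g \<in> paths \<Lambda>" "src \<Lambda> \<alpha>' = rng \<Lambda> g"
    "pcomp \<Lambda> \<zeta> \<alpha> = pcomp \<Lambda> \<alpha>' g" "deg \<Lambda> \<alpha>' = a" "deg \<Lambda> g = deg \<Lambda> \<zeta>"
    using factor[OF _ deg(1) _ deg(3)] *(1) rng assms(2) by auto
  obtain \<gamma>' h where h: "\<gamma>' \<in> paths \<Lambda>" "h \<in> paths \<Lambda>" "src \<Lambda> \<gamma>' = rng \<Lambda> h"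
    "pcomp \<Lambda> \<zeta> \<gamma> = pcomp \<Lambda> \<gamma>' h" "deg \<Lambda> \<gamma>' = b" "deg \<Lambda> h = deg \<Lambda> \<zeta>"
    using factor[OF _ deg(2) _ deg(4)] *(4) rng assms(2) by auto
  have src: "src \<Lambda> g = rng \<Lambda> \<mu>" "src \<Lambda> h = rng \<Lambda> \<nu>"
    using src_pcomp[of \<zeta> \<alpha>] src_pcomp[of \<alpha>' g] src_pcomp[of \<zeta> \<gamma>] src_pcomp[of \<gamma>' h]
      g(1-4) h(1-4) *(1,4,7,9) rng assms(2) by simp_all
  have "pcomp \<Lambda> \<zeta> \<xi> = pcomp \<Lambda> (pcomp \<Lambda> \<zeta> \<alpha>) (pcomp \<Lambda> \<mu> \<beta>)"
    unfolding *(11) using *(1-10) rng assms(2) by (simp add: pcomp_assoc)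
  also have "\<dots> = pcomp \<Lambda> \<alpha>' (pcomp \<Lambda> (pcomp \<Lambda> g \<mu>) \<beta>)"
    unfolding g(4) using g(1-3) src *(1-10) by (simp add: pcomp_assoc)
  finally have 1: "pcomp \<Lambda> \<zeta> \<xi> = pcomp \<Lambda> \<alpha>' (pcomp \<Lambda> (pcomp \<Lambda> g \<mu>) \<beta>)" .
  have "pcomp \<Lambda> \<zeta> \<xi> = pcomp \<Lambda> (pcomp \<Lambda> \<zeta> \<gamma>) (pcomp \<Lambda> \<nu> \<delta>)"
    unfolding *(12) using *(1-10) rng assms(2) by (simp add: pcomp_assoc)
  also have "\<dots> = pcomp \<Lambda> \<gamma>' (pcomp \<Lambda> (pcomp \<Lambda> h \<nu>) \<delta>)"
    unfolding h(4) using h(1-3) src *(1-10) by (simp add: pcomp_assoc)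
  finally have 2: "pcomp \<Lambda> \<zeta> \<xi> = pcomp \<Lambda> \<gamma>' (pcomp \<Lambda> (pcomp \<Lambda> h \<nu>) \<delta>)" .
  have "pcomp \<Lambda> g \<mu> \<noteq> pcomp \<Lambda> h \<nu>"
    using factor_unique(2)[of g \<mu> h \<nu>] g h src * by auto
  then show ?thesis
    by (rule shift_distinctI[OF _ _ _ _ _ _ _ _ _ _ 1 2, rotated -1])
      (use *(1-10) *(13-15) g h src in simp_all)
qed

text \<open>Turns the definite description into a factorisation, bracketed as in
  \<open>shift_distinct\<close>.\<close>

lemma segment:
  assumes "\<kappa> \<in> paths \<Lambda>" "m \<in> Nk k" "n \<in> Nk k" "m \<le> n" "n \<le> deg \<Lambda> \<kappa>"
  obtains \<kappa>' \<kappa>'' where "segment \<Lambda> \<kappa> m n \<in> paths \<Lambda>" "deg \<Lambda> (segment \<Lambda> \<kappa> m n) = n - m"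
    "\<kappa>' \<in> paths \<Lambda>" "\<kappa>'' \<in> paths \<Lambda>" "src \<Lambda> \<kappa>' = rng \<Lambda> (segment \<Lambda> \<kappa> m n)"
    "src \<Lambda> (segment \<Lambda> \<kappa> m n) = rng \<Lambda> \<kappa>''" "deg \<Lambda> \<kappa>' = m"
    "\<kappa> = pcomp \<Lambda> \<kappa>' (pcomp \<Lambda> (segment \<Lambda> \<kappa> m n) \<kappa>'')"
proof -
  let ?P = "\<lambda>\<nu>. \<nu> \<in> paths \<Lambda> \<and> deg \<Lambda> \<nu> = n - m \<and>
     (\<exists>\<kappa>'\<in>paths \<Lambda>. \<exists>\<kappa>''\<in>paths \<Lambda>. src \<Lambda> \<kappa>' = rng \<Lambda> \<nu> \<and> src \<Lambda> \<nu> = rng \<Lambda> \<kappa>'' \<and>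
        deg \<Lambda> \<kappa>' = m \<and> deg \<Lambda> \<kappa>'' = deg \<Lambda> \<kappa> - n \<and>
        \<kappa> = pcomp \<Lambda> (pcomp \<Lambda> \<kappa>' \<nu>) \<kappa>'')"
  have deg: "deg \<Lambda> \<kappa> = m + ((n - m) + (deg \<Lambda> \<kappa> - n))"
  proof
    fix i
    have "m i \<le> n i" "n i \<le> deg \<Lambda> \<kappa> i" using assms(4,5) by (auto simp: le_fun_def)
    then show "deg \<Lambda> \<kappa> i = (m + ((n - m) + (deg \<Lambda> \<kappa> - n))) i" by simp
  qed
  obtain \<kappa>' \<rho> where 1: "\<kappa>' \<in> paths \<Lambda>" "\<rho> \<in> paths \<Lambda>" "src \<Lambda> \<kappa>' = rng \<Lambda> \<rho>" "\<kappa> = pcomp \<Lambda> \<kappa>' \<rho>"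
    "deg \<Lambda> \<kappa>' = m" "deg \<Lambda> \<rho> = (n - m) + (deg \<Lambda> \<kappa> - n)"
    using factor[OF assms(1,2) _ deg] assms by auto
  obtain \<nu> \<kappa>'' where 2: "\<nu> \<in> paths \<Lambda>" "\<kappa>'' \<in> paths \<Lambda>" "src \<Lambda> \<nu> = rng \<Lambda> \<kappa>''" "\<rho> = pcomp \<Lambda> \<nu> \<kappa>''"
    "deg \<Lambda> \<nu> = n - m" "deg \<Lambda> \<kappa>'' = deg \<Lambda> \<kappa> - n"
    using factor[OF 1(2) _ _ 1(6)] assms by auto
  have src: "src \<Lambda> \<kappa>' = rng \<Lambda> \<nu>" using 1(3) 2(1-3) by (simp add: 2(4))
  have "\<kappa> = pcomp \<Lambda> (pcomp \<Lambda> \<kappa>' \<nu>) \<kappa>''"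
    using 1(1) 2(1-3) src by (simp add: 1(4) 2(4) pcomp_assoc)
  then have ex: "?P \<nu>" using 1(1,5) 2(1-3,5,6) src by blast
  have "\<nu>1 = \<nu>2" if P1: "?P \<nu>1" and P2: "?P \<nu>2" for \<nu>1 \<nu>2
  proof -
    obtain a c a' c' where a: "a \<in> paths \<Lambda>" "c \<in> paths \<Lambda>" "src \<Lambda> a = rng \<Lambda> \<nu>1" "src \<Lambda> \<nu>1 = rng \<Lambda> c"
        "deg \<Lambda> a = m" "\<kappa> = pcomp \<Lambda> (pcomp \<Lambda> a \<nu>1) c"
      and a': "a' \<in> paths \<Lambda>" "c' \<in> paths \<Lambda>" "src \<Lambda> a' = rng \<Lambda> \<nu>2" "src \<Lambda> \<nu>2 = rng \<Lambda> c'" "deg \<Lambda> a' =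
          m" "\<kappa> = pcomp \<Lambda> (pcomp \<Lambda> a' \<nu>2) c'"
      using P1 P2 by blast
    have \<nu>: "\<nu>1 \<in> paths \<Lambda>" "\<nu>2 \<in> paths \<Lambda>" "deg \<Lambda> \<nu>1 = n - m" "deg \<Lambda> \<nu>2 = n - m" using P1 P2 by auto
    have "pcomp \<Lambda> (pcomp \<Lambda> a \<nu>1) c = pcomp \<Lambda> (pcomp \<Lambda> a' \<nu>2) c'" using a(6) a'(6) by (rule subst)
    then have "pcomp \<Lambda> a \<nu>1 = pcomp \<Lambda> a' \<nu>2"
      by (intro factor_unique(1)[of "pcomp \<Lambda> a \<nu>1" c "pcomp \<Lambda> a' \<nu>2" c'])
        (use a(1-5) a'(1-5) \<nu> in simp_all)
    then show ?thesis
      by (intro factor_unique(2)[of a \<nu>1 a' \<nu>2]) (use a(1-5) a'(1-5) \<nu> in simp_all)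
  qed
  then have "?P (THE \<nu>. ?P \<nu>)" using ex by (intro theI'[of ?P]) blast
  then have "?P (segment \<Lambda> \<kappa> m n)" by (simp only: segment_def)
  then obtain \<kappa>1 \<kappa>2 where "\<kappa>1 \<in> paths \<Lambda>" "\<kappa>2 \<in> paths \<Lambda>" "src \<Lambda> \<kappa>1 = rng \<Lambda> (segment \<Lambda> \<kappa> m n)"
    "src \<Lambda> (segment \<Lambda> \<kappa> m n) = rng \<Lambda> \<kappa>2" "deg \<Lambda> \<kappa>1 = m"
    "\<kappa> = pcomp \<Lambda> (pcomp \<Lambda> \<kappa>1 (segment \<Lambda> \<kappa> m n)) \<kappa>2"
    "segment \<Lambda> \<kappa> m n \<in> paths \<Lambda>" "deg \<Lambda> (segment \<Lambda> \<kappa> m n) = n - m"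
    by blast
  then show thesis
    using that[of \<kappa>1 \<kappa>2] pcomp_assoc[of \<kappa>1 "segment \<Lambda> \<kappa> m n" \<kappa>2] by presburger
qed

text \<open>Aperiodicity in a form that persists when the path is extended at either end; this is
  what allows finitely many pairs to be treated by one path.\<close>

lemma exists_shift_distinct:
  assumes "kgraph_aperiodic k \<Lambda>" "v \<in> vertices \<Lambda>" "m \<in> Nk k" "n \<in> Nk k" "m \<noteq> n"
  obtains \<xi> where "\<xi> \<in> paths \<Lambda>" "rng \<Lambda> \<xi> = v" "shift_distinct \<xi> m n"
proof -
  obtain \<kappa> where "\<kappa> \<in> paths_at \<Lambda> v" and le: "sup m n \<le> deg \<Lambda> \<kappa>" and
    ne: "segment \<Lambda> \<kappa> m (m + deg \<Lambda> \<kappa> - sup m n) \<noteq> segment \<Lambda> \<kappa> n (n + deg \<Lambda> \<kappa> - sup m n)"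
    using assms unfolding kgraph_aperiodic_def by blast
  then have \<kappa>: "\<kappa> \<in> paths \<Lambda>" "rng \<Lambda> \<kappa> = v" by (auto simp: paths_at_def)
  have le': "m i \<le> deg \<Lambda> \<kappa> i" "n i \<le> deg \<Lambda> \<kappa> i" for i using le by (auto simp: le_fun_def)
  let ?\<mu> = "segment \<Lambda> \<kappa> m (m + deg \<Lambda> \<kappa> - sup m n)" and ?\<nu> = "segment \<Lambda> \<kappa> n (n + deg \<Lambda> \<kappa> - sup m n)"
  have m: "m \<le> m + deg \<Lambda> \<kappa> - sup m n" "m + deg \<Lambda> \<kappa> - sup m n \<le> deg \<Lambda> \<kappa>"
    and n: "n \<le> n + deg \<Lambda> \<kappa> - sup m n" "n + deg \<Lambda> \<kappa> - sup m n \<le> deg \<Lambda> \<kappa>"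
    and eq: "m + deg \<Lambda> \<kappa> - sup m n - m = n + deg \<Lambda> \<kappa> - sup m n - n"
  proof -
    have *: "m i \<le> m i + deg \<Lambda> \<kappa> i - sup (m i) (n i)" "m i + deg \<Lambda> \<kappa> i - sup (m i) (n i) \<le> deg \<Lambda> \<kappa> i"
      "n i \<le> n i + deg \<Lambda> \<kappa> i - sup (m i) (n i)" "n i + deg \<Lambda> \<kappa> i - sup (m i) (n i) \<le> deg \<Lambda> \<kappa> i"
      "m i + deg \<Lambda> \<kappa> i - sup (m i) (n i) - m i = n i + deg \<Lambda> \<kappa> i - sup (m i) (n i) - n i" for i
      using le'[of i] by (auto simp: sup_nat_def)
    show "m \<le> m + deg \<Lambda> \<kappa> - sup m n" "m + deg \<Lambda> \<kappa> - sup m n \<le> deg \<Lambda> \<kappa>"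
      "n \<le> n + deg \<Lambda> \<kappa> - sup m n" "n + deg \<Lambda> \<kappa> - sup m n \<le> deg \<Lambda> \<kappa>"
      "m + deg \<Lambda> \<kappa> - sup m n - m = n + deg \<Lambda> \<kappa> - sup m n - n"
      unfolding le_fun_def fun_eq_iff using * by simp_all
  qed
  obtain a c where s1: "a \<in> paths \<Lambda>" "c \<in> paths \<Lambda>"
    "?\<mu> \<in> paths \<Lambda>"
    "deg \<Lambda> ?\<mu> = m + deg \<Lambda> \<kappa> - sup m n - m"
    "src \<Lambda> a = rng \<Lambda> ?\<mu>"
    "src \<Lambda> ?\<mu> = rng \<Lambda> c" "deg \<Lambda> a = m"
    "\<kappa> = pcomp \<Lambda> a (pcomp \<Lambda> ?\<mu> c)"
    using segment[OF \<kappa>(1) assms(3) _ m] assms(3) \<kappa> by (metis Nk_add Nk_diff deg_closed)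
  obtain a' c' where s2: "a' \<in> paths \<Lambda>" "c' \<in> paths \<Lambda>"
    "?\<nu> \<in> paths \<Lambda>"
    "deg \<Lambda> ?\<nu> = n + deg \<Lambda> \<kappa> - sup m n - n"
    "src \<Lambda> a' = rng \<Lambda> ?\<nu>"
    "src \<Lambda> ?\<nu> = rng \<Lambda> c'" "deg \<Lambda> a' = n"
    "\<kappa> = pcomp \<Lambda> a' (pcomp \<Lambda> ?\<nu> c')"
    using segment[OF \<kappa>(1) assms(4) _ n] assms(4) \<kappa> by (metis Nk_add Nk_diff deg_closed)
  have "shift_distinct \<kappa> m n"
    by (rule shift_distinctI[OF s1(1,3,2) s2(1,3,2) s1(5,6) s2(5,6) s1(8) s2(8) s1(7) s2(7)])
      (unfold s1(4) s2(4), rule eq, rule ne)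
  then show thesis using that \<kappa> by blast
qed

text \<open>A path that separates the next pair is appended at the source: for the pairs already
  separated this is an extension on the right, for the new pair an extension on the left.\<close>

lemma exists_shift_distinct_finite:
  assumes "kgraph_aperiodic k \<Lambda>" "w \<in> vertices \<Lambda>" "finite F"
    and "\<And>a b. (a, b) \<in> F \<Longrightarrow> a \<in> Nk k \<and> b \<in> Nk k \<and> a \<noteq> b"
  shows "\<exists>\<xi>\<in>paths \<Lambda>. rng \<Lambda> \<xi> = w \<and> (\<forall>(a, b)\<in>F. shift_distinct \<xi> a b)"
  using assms(3,4)
proof (induction F)
  case empty
  then show ?case using assms(2) by (intro bexI[of _ w]) auto
next
  case (insert p F)
  then obtain \<xi> where \<xi>: "\<xi> \<in> paths \<Lambda>" "rng \<Lambda> \<xi> = w" "\<forall>(a, b)\<in>F. shift_distinct \<xi> a b" by auto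
  obtain a b where p: "p = (a, b)" by fastforce
  obtain \<zeta> where \<zeta>: "\<zeta> \<in> paths \<Lambda>" "rng \<Lambda> \<zeta> = src \<Lambda> \<xi>" "shift_distinct \<zeta> a b"
    using exists_shift_distinct[OF assms(1) src_vertex[OF \<xi>(1)]] insert.prems[of a b] p by blast
  then show ?case using \<xi> p
    by (intro bexI[of _ "pcomp \<Lambda> \<xi> \<zeta>"])
      (auto intro: shift_distinct_extend_left shift_distinct_extend_right)
qed

end

section \<open>Twisted Cuntz--Krieger families\<close>

context cstar_algebra
begin

lemma mult_linear_span:
  assumes "submodule W complex_ring A" "S \<subseteq> carrier A" "T \<subseteq> carrier A"
    and "\<And>a b. a \<in> S \<Longrightarrow> b \<in> T \<Longrightarrow> a \<otimes> b \<in> W"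
    and x: "x \<in> linear_span A S" and y: "y \<in> linear_span A T"
  shows "x \<otimes> y \<in> W"
  using x
proof (induction rule: linear_span.induct)
  case (base a)
  from y show ?case
    by (induction rule: linear_span.induct)
      (use base assms linear_span_closed[OF _ assms(3)] in
        \<open>auto simp: mult_distrib_left mult_smult_right subset_iff intro: submoduleE(5)
            submodule_scale submodule_zero\<close>)
qed (use assms y linear_span_closed[OF _ assms(2)] linear_span_closed[OF y assms(3)] in
        \<open>auto simp: mult_distrib_right mult_smult_left intro: submoduleE(5) submodule_scale
            submodule_zero\<close>)

lemma star_linear_span:
  assumes "submodule W complex_ring A" "S \<subseteq> carrier A"
    and S: "\<And>a. a \<in> S \<Longrightarrow> star A a \<in> W" and x: "x \<in> linear_span A S"
  shows "star A x \<in> W"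
  using x
  by (induction rule: linear_span.induct)
    (use assms linear_span_closed[OF _ assms(2)] in
      \<open>auto simp: star_add star_smult intro: submoduleE(5) submodule_scale submodule_zero\<close>)

lemma linear_span_singleton:
  assumes "p \<in> carrier A" "x \<in> linear_span A {p}" shows "\<exists>z. x = z \<odot> p"
  using assms(2)
proof (induction rule: linear_span.induct)
  case (base x)
  then show ?case using assms(1) by (intro exI[of _ 1]) simp
next
  case zero
  show ?case using assms(1) by (intro exI[of _ 0]) simp
next
  case (add x y)
  then show ?case using assms(1) by (auto simp: scale_add_left[symmetric])
next
  case (scale x z)
  then show ?case using assms(1) by auto
qed

end

text \<open>The cocycle enters only through the unspecified scalar in \<open>t_mult\<close>, to
  which linear spans are insensitive; the other relations hold exactly.\<close>

locale twisted_family = cstar_algebra A + k_graph k \<Lambda>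
  for A :: "'a cstar" (structure) and k and \<Lambda> :: "'l kgraph" +
  fixes t :: "'l \<Rightarrow> 'a"
  assumes row_finite: "row_finite_no_sources k \<Lambda>"
    and t_closed [simp]: "\<kappa> \<in> paths \<Lambda> \<Longrightarrow> t \<kappa> \<in> carrier A"
    and t_projection: "v \<in> vertices \<Lambda> \<Longrightarrow> projection (t v)"
    and t_vertices_orth: "v \<in> vertices \<Lambda> \<Longrightarrow> w \<in> vertices \<Lambda> \<Longrightarrow> v \<noteq> w \<Longrightarrow> t v \<otimes> t w = \<zero>"
    and t_mult: "\<kappa> \<in> paths \<Lambda> \<Longrightarrow> \<mu> \<in> paths \<Lambda> \<Longrightarrow> src \<Lambda> \<kappa> = rng \<Lambda> \<mu>
          \<Longrightarrow> \<exists>z. cmod z = 1 \<and> t \<kappa> \<otimes> t \<mu> = z \<odot> t (pcomp \<Lambda> \<kappa> \<mu>)"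
    and t_star_mult: "\<kappa> \<in> paths \<Lambda> \<Longrightarrow> star A (t \<kappa>) \<otimes> t \<kappa> = t (src \<Lambda> \<kappa>)"
    and t_sum: "v \<in> vertices \<Lambda> \<Longrightarrow> n \<in> Nk k
          \<Longrightarrow> t v = finsum A (\<lambda>\<kappa>. t \<kappa> \<otimes> star A (t \<kappa>)) (paths_at_deg \<Lambda> v n)"
begin

lemma t_vertex [simp]:
  assumes "v \<in> vertices \<Lambda>" shows "t v \<otimes> t v = t v" "star A (t v) = t v"
  using projectionD[OF t_projection[OF assms]] by blast+

text \<open>Even when one factor is a vertex, \<open>t_mult\<close> leaves a scalar open.
  Idempotence of the vertex projection yields the third premise, which forces that scalar to act
  trivially.\<close>

lemma scalar_idempotent:
  assumes "x \<in> carrier A" "cmod z = 1" "z \<odot> x = (z * z) \<odot> x" shows "x = z \<odot> x"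
proof -
  have "z \<noteq> 0" using assms by auto
  have "x = inverse z \<odot> (z \<odot> x)" using assms(1) \<open>z \<noteq> 0\<close> by simp
  also have "\<dots> = inverse z \<odot> ((z * z) \<odot> x)" using assms(3) by simp
  also have "\<dots> = z \<odot> x" using assms(1) \<open>z \<noteq> 0\<close> by (simp flip: mult.assoc)
  finally show ?thesis .
qed

lemma t_rng [simp]:
  assumes "\<kappa> \<in> paths \<Lambda>" shows "t (rng \<Lambda> \<kappa>) \<otimes> t \<kappa> = t \<kappa>"
proof -
  obtain z where z: "cmod z = 1" "t (rng \<Lambda> \<kappa>) \<otimes> t \<kappa> = z \<odot> t \<kappa>"
    using t_mult[of "rng \<Lambda> \<kappa>" \<kappa>] assms by auto
  have "z \<odot> t \<kappa> = (t (rng \<Lambda> \<kappa>) \<otimes> t (rng \<Lambda> \<kappa>)) \<otimes> t \<kappa>" using z assms by simp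
  also have "\<dots> = t (rng \<Lambda> \<kappa>) \<otimes> (t (rng \<Lambda> \<kappa>) \<otimes> t \<kappa>)"
    by (rule mult_assoc) (use assms in simp_all)
  also have "\<dots> = (z * z) \<odot> t \<kappa>" unfolding z using assms by (simp add: mult_smult_right z)
  finally show ?thesis using scalar_idempotent[of "t \<kappa>" z] assms z by simp
qed

lemma t_src [simp]:
  assumes "\<kappa> \<in> paths \<Lambda>" shows "t \<kappa> \<otimes> t (src \<Lambda> \<kappa>) = t \<kappa>"
proof -
  obtain z where z: "cmod z = 1" "t \<kappa> \<otimes> t (src \<Lambda> \<kappa>) = z \<odot> t \<kappa>"
    using t_mult[of \<kappa> "src \<Lambda> \<kappa>"] assms by auto
  have "z \<odot> t \<kappa> = t \<kappa> \<otimes> (t (src \<Lambda> \<kappa>) \<otimes> t (src \<Lambda> \<kappa>))" using z assms by simp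
  also have "\<dots> = (t \<kappa> \<otimes> t (src \<Lambda> \<kappa>)) \<otimes> t (src \<Lambda> \<kappa>)"
    by (rule mult_assoc[symmetric]) (use assms in simp_all)
  also have "\<dots> = (z * z) \<odot> t \<kappa>" unfolding z using assms by (simp add: mult_smult_left z)
  finally show ?thesis using scalar_idempotent[of "t \<kappa>" z] assms z by simp
qed

lemma star_t_src [simp]: "\<kappa> \<in> paths \<Lambda> \<Longrightarrow> t (src \<Lambda> \<kappa>) \<otimes> star A (t \<kappa>) = star A (t \<kappa>)"
  using star_mult[of "t \<kappa>" "t (src \<Lambda> \<kappa>)"] by simp

lemma star_t_rng [simp]: "\<kappa> \<in> paths \<Lambda> \<Longrightarrow> star A (t \<kappa>) \<otimes> t (rng \<Lambda> \<kappa>) = star A (t \<kappa>)"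
  using star_mult[of "t (rng \<Lambda> \<kappa>)" "t \<kappa>"] by simp

lemma norm_t_le: "\<kappa> \<in> paths \<Lambda> \<Longrightarrow> nrm A (t \<kappa>) \<le> 1"
proof -
  assume \<kappa>: "\<kappa> \<in> paths \<Lambda>"
  have "(nrm A (t \<kappa>))\<^sup>2 = nrm A (t (src \<Lambda> \<kappa>))" using cstar_identity[of "t \<kappa>"] \<kappa> t_star_mult by simp
  also have "\<dots> \<le> 1\<^sup>2" using \<kappa> by (simp add: norm_projection_le t_projection)
  finally show ?thesis by (rule power2_le_imp_le) simp
qed

lemma range_projection:
  assumes "\<kappa> \<in> paths \<Lambda>" shows "projection (t \<kappa> \<otimes> star A (t \<kappa>))"
proof -
  have "(t \<kappa> \<otimes> star A (t \<kappa>)) \<otimes> (t \<kappa> \<otimes> star A (t \<kappa>)) = t \<kappa> \<otimes> ((star A (t \<kappa>) \<otimes> t \<kappa>) \<otimes> star A (t \<kappa>))"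
    using assms by (simp add: mult_assoc)
  then show ?thesis unfolding projection_def using assms by (simp add: star_mult t_star_mult)
qed

text \<open>For paths with the same range, \<open>t_sum\<close> exhibits both range projections as
  members of a finite family of projections that sums to one vertex projection, so
  \<open>orthogonal_if_sum_projection\<close> applies. Different ranges are separated by the vertex
  projections.\<close>

lemma t_orth:
  assumes "\<kappa> \<in> paths \<Lambda>" "\<mu> \<in> paths \<Lambda>" "deg \<Lambda> \<kappa> = deg \<Lambda> \<mu>" "\<kappa> \<noteq> \<mu>"
  shows "star A (t \<kappa>) \<otimes> t \<mu> = \<zero>"
proof (cases "rng \<Lambda> \<kappa> = rng \<Lambda> \<mu>")
  case False
  have "star A (t \<kappa>) \<otimes> t \<mu> = (star A (t \<kappa>) \<otimes> t (rng \<Lambda> \<kappa>)) \<otimes> (t (rng \<Lambda> \<mu>) \<otimes> t \<mu>)"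
    using assms by simp
  also have "\<dots> = star A (t \<kappa>) \<otimes> ((t (rng \<Lambda> \<kappa>) \<otimes> t (rng \<Lambda> \<mu>)) \<otimes> t \<mu>)"
    using assms by (simp only: mult_assoc mult_closed star_closed t_closed rng_closed)
  finally show ?thesis using t_vertices_orth[OF _ _ False] assms by simp
next
  case True
  define v where "v = rng \<Lambda> \<kappa>"
  define q where "q \<kappa> = t \<kappa> \<otimes> star A (t \<kappa>)" for \<kappa>
  let ?S = "paths_at_deg \<Lambda> v (deg \<Lambda> \<kappa>)"
  have v: "v \<in> vertices \<Lambda>" using assms by (simp add: v_def)
  have S: "\<kappa> \<in> ?S" "\<mu> \<in> ?S" "finite ?S"
    using assms True row_finite v by (auto simp: v_def paths_at_deg_def paths_at_def
        row_finite_no_sources_def)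
  have "q \<kappa> \<otimes> q \<mu> = \<zero>"
  proof (rule orthogonal_if_sum_projection[OF S(3) _ _ _ S(1,2) assms(4), where Q = "t v"])
    show "projection (q \<nu>)" if "\<nu> \<in> ?S" for \<nu>
      using that range_projection by (simp add: q_def paths_at_deg_def paths_at_def)
    show "finsum A q ?S = t v" using t_sum[OF v, of "deg \<Lambda> \<kappa>"] assms by (simp add: q_def[abs_def])
    show "q \<nu> \<otimes> t v = q \<nu>" if "\<nu> \<in> ?S" for \<nu>
    proof -
      have "\<nu> \<in> paths \<Lambda>" "v = rng \<Lambda> \<nu>" using that by (auto simp: paths_at_deg_def paths_at_def)
      then show ?thesis by (simp add: q_def mult_assoc)
    qed
  qed
  \<comment> \<open>Multiplication by \<open>star A (t \<kappa>)\<close> and \<open>t \<mu>\<close>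
    on the outside recovers \<open>star A (t \<kappa>) \<otimes> t \<mu>\<close> from the product of
    the range projections.\<close>
  then have "star A (t \<kappa>) \<otimes> ((q \<kappa> \<otimes> q \<mu>) \<otimes> t \<mu>) = \<zero>" using assms by simp
  moreover have "star A (t \<kappa>) \<otimes> ((q \<kappa> \<otimes> q \<mu>) \<otimes> t \<mu>) =
      ((star A (t \<kappa>) \<otimes> t \<kappa>) \<otimes> star A (t \<kappa>)) \<otimes> (t \<mu> \<otimes> (star A (t \<mu>) \<otimes> t \<mu>))"
    using assms by (simp only: q_def mult_assoc mult_closed star_closed t_closed)
  ultimately show ?thesis using assms by (simp add: t_star_mult)
qed

lemma t_mult_star_zero:
  assumes "\<kappa> \<in> paths \<Lambda>" "\<mu> \<in> paths \<Lambda>" "src \<Lambda> \<kappa> \<noteq> src \<Lambda> \<mu>"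
  shows "t \<kappa> \<otimes> star A (t \<mu>) = \<zero>"
proof -
  have "t \<kappa> \<otimes> star A (t \<mu>) = (t \<kappa> \<otimes> t (src \<Lambda> \<kappa>)) \<otimes> (t (src \<Lambda> \<mu>) \<otimes> star A (t \<mu>))"
    using assms by simp
  also have "\<dots> = t \<kappa> \<otimes> ((t (src \<Lambda> \<kappa>) \<otimes> t (src \<Lambda> \<mu>)) \<otimes> star A (t \<mu>))"
    using assms by (simp only: mult_assoc mult_closed star_closed t_closed src_closed)
  finally show ?thesis using t_vertices_orth assms by simp
qed

lemma t_pcomp:
  assumes "\<kappa> \<in> paths \<Lambda>" "\<mu> \<in> paths \<Lambda>" "src \<Lambda> \<kappa> = rng \<Lambda> \<mu>"
  shows "\<exists>z. t (pcomp \<Lambda> \<kappa> \<mu>) = z \<odot> (t \<kappa> \<otimes> t \<mu>)"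
proof -
  obtain z where z: "cmod z = 1" "t \<kappa> \<otimes> t \<mu> = z \<odot> t (pcomp \<Lambda> \<kappa> \<mu>)" using t_mult[OF assms] by blast
  then have "z \<noteq> 0" by auto
  then show ?thesis using z assms by (intro exI[of _ "inverse z"]) simp
qed

text \<open>Up to scalars the product compares the paths
  \<open>\<kappa>\<xi> = (\<kappa>\<alpha>)\<mu>\<beta>\<close> and
  \<open>\<theta>\<xi> = (\<theta>\<gamma>)\<nu>\<delta>\<close>, whose prefixes
  \<open>\<kappa>\<alpha>\<close> and \<open>\<theta>\<gamma>\<close> have equal degree by
  \<open>deg\<close>. Either the prefixes differ, or they cancel and the distinct segments
  \<open>\<mu>\<close> and \<open>\<nu>\<close> meet; \<open>t_orth\<close> gives zero in both
  cases.\<close>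

lemma t_mult_shift_distinct:
  assumes \<xi>: "shift_distinct \<xi> a b" and "\<xi> \<in> paths \<Lambda>" and \<kappa>: "\<kappa> \<in> paths \<Lambda>" "src \<Lambda> \<kappa> = rng \<Lambda> \<xi>"
    and \<theta>: "\<theta> \<in> paths \<Lambda>" "src \<Lambda> \<theta> = rng \<Lambda> \<xi>" and deg: "deg \<Lambda> \<kappa> + a = deg \<Lambda> \<theta> + b"
  shows "star A (t \<xi>) \<otimes> ((star A (t \<kappa>) \<otimes> t \<theta>) \<otimes> t \<xi>) = \<zero>"
proof -
  obtain \<alpha> \<mu> \<beta> \<gamma> \<nu> \<delta> where *: "\<alpha> \<in> paths \<Lambda>" "\<mu> \<in> paths \<Lambda>" "\<beta> \<in> paths \<Lambda>" "\<gamma> \<in> paths \<Lambda>" "\<nu> \<in> paths \<Lambda>"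
      "\<delta> \<in> paths \<Lambda>"
    "src \<Lambda> \<alpha> = rng \<Lambda> \<mu>" "src \<Lambda> \<mu> = rng \<Lambda> \<beta>" "src \<Lambda> \<gamma> = rng \<Lambda> \<nu>" "src \<Lambda> \<nu> = rng \<Lambda> \<delta>"
    "\<xi> = pcomp \<Lambda> \<alpha> (pcomp \<Lambda> \<mu> \<beta>)" "\<xi> = pcomp \<Lambda> \<gamma> (pcomp \<Lambda> \<nu> \<delta>)"
    "deg \<Lambda> \<alpha> = a" "deg \<Lambda> \<gamma> = b" "deg \<Lambda> \<mu> = deg \<Lambda> \<nu>" "\<mu> \<noteq> \<nu>"
    using shift_distinctE[OF \<xi>] by metis
  \<comment> \<open>Moves the prefix of the second factor into the first one, up to a scalar; it
    serves both factorisations of \<open>\<xi>\<close>.\<close>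
  have three: "\<exists>z. t \<kappa> \<otimes> t (pcomp \<Lambda> \<alpha> (pcomp \<Lambda> \<mu> \<beta>)) = z \<odot> (t (pcomp \<Lambda> \<kappa> \<alpha>) \<otimes> (t \<mu> \<otimes> t \<beta>))"
    if p: "\<kappa> \<in> paths \<Lambda>" "\<alpha> \<in> paths \<Lambda>" "\<mu> \<in> paths \<Lambda>" "\<beta> \<in> paths \<Lambda>"
      "src \<Lambda> \<kappa> = rng \<Lambda> \<alpha>" "src \<Lambda> \<alpha> = rng \<Lambda> \<mu>" "src \<Lambda> \<mu> = rng \<Lambda> \<beta>" for \<kappa> \<alpha> \<mu> \<beta>
  proof -
    obtain z1 where 1: "t (pcomp \<Lambda> \<alpha> (pcomp \<Lambda> \<mu> \<beta>)) = z1 \<odot> (t \<alpha> \<otimes> t (pcomp \<Lambda> \<mu> \<beta>))"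
      using t_pcomp[of \<alpha> "pcomp \<Lambda> \<mu> \<beta>"] p by auto
    obtain z2 where 2: "t (pcomp \<Lambda> \<mu> \<beta>) = z2 \<odot> (t \<mu> \<otimes> t \<beta>)" using t_pcomp[of \<mu> \<beta>] p by auto
    obtain z3 where 3: "t \<kappa> \<otimes> t \<alpha> = z3 \<odot> t (pcomp \<Lambda> \<kappa> \<alpha>)" using t_mult[of \<kappa> \<alpha>] p by auto
    have "t \<kappa> \<otimes> t (pcomp \<Lambda> \<alpha> (pcomp \<Lambda> \<mu> \<beta>)) = (z1 * z2) \<odot> ((t \<kappa> \<otimes> t \<alpha>) \<otimes> (t \<mu> \<otimes> t \<beta>))"
      unfolding 1 2 using p by (simp add: mult_smult_right mult_assoc)
    also have "\<dots> = (z1 * z2 * z3) \<odot> (t (pcomp \<Lambda> \<kappa> \<alpha>) \<otimes> (t \<mu> \<otimes> t \<beta>))"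
      unfolding 3 using p by (simp add: mult_smult_left)
    finally show ?thesis by blast
  qed
  have rng: "src \<Lambda> \<kappa> = rng \<Lambda> \<alpha>" "src \<Lambda> \<theta> = rng \<Lambda> \<gamma>"
    unfolding \<kappa>(2) \<theta>(2) by (subst *(11), use *(1-10) in simp, subst *(12), use *(1-10) in simp)
  obtain z1 where 1: "t \<kappa> \<otimes> t \<xi> = z1 \<odot> (t (pcomp \<Lambda> \<kappa> \<alpha>) \<otimes> (t \<mu> \<otimes> t \<beta>))"
    using three[of \<kappa> \<alpha> \<mu> \<beta>] \<kappa>(1) rng *(1-10) unfolding *(11) by blast
  obtain z2 where 2: "t \<theta> \<otimes> t \<xi> = z2 \<odot> (t (pcomp \<Lambda> \<theta> \<gamma>) \<otimes> (t \<nu> \<otimes> t \<delta>))"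
    using three[of \<theta> \<gamma> \<nu> \<delta>] \<theta>(1) rng *(1-10) unfolding *(12) by blast
  \<comment> \<open>Equal prefixes cancel to a vertex projection that \<open>t \<nu>\<close>
    absorbs; different prefixes are orthogonal.\<close>
  have "(star A (t (pcomp \<Lambda> \<kappa> \<alpha>)) \<otimes> t (pcomp \<Lambda> \<theta> \<gamma>)) \<otimes> t \<nu> = t \<nu> \<or>
      star A (t (pcomp \<Lambda> \<kappa> \<alpha>)) \<otimes> t (pcomp \<Lambda> \<theta> \<gamma>) = \<zero>"
  proof (cases "pcomp \<Lambda> \<kappa> \<alpha> = pcomp \<Lambda> \<theta> \<gamma>")
    case True
    then show ?thesis using \<kappa>(1) \<theta>(1) rng *(4,5,9) by (simp add: t_star_mult)
  next
    case False
    then show ?thesis using \<kappa>(1) \<theta>(1) rng *(1,4,13,14) deg t_orth[OF _ _ _ False] by simp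
  qed
  then have zero: "star A (t \<mu>) \<otimes> ((star A (t (pcomp \<Lambda> \<kappa> \<alpha>)) \<otimes> t (pcomp \<Lambda> \<theta> \<gamma>)) \<otimes> t \<nu>) = \<zero>"
    using t_orth[of \<mu> \<nu>] *(2,5,15,16) by auto
  have "star A (t \<xi>) \<otimes> ((star A (t \<kappa>) \<otimes> t \<theta>) \<otimes> t \<xi>) = star A (t \<kappa> \<otimes> t \<xi>) \<otimes> (t \<theta> \<otimes> t \<xi>)"
    using assms by (simp add: star_mult mult_assoc)
  also have "\<dots> = (cnj z1 * z2) \<odot> ((star A (t \<beta>) \<otimes> (star A (t \<mu>) \<otimes> ((star A (t (pcomp \<Lambda> \<kappa> \<alpha>)) \<otimes> t
      (pcomp \<Lambda> \<theta> \<gamma>)) \<otimes> t \<nu>))) \<otimes> t \<delta>)"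
    unfolding 1 2 using \<kappa>(1) \<theta>(1) rng *(1-10)
    by (simp add: star_mult star_smult mult_smult_left mult_smult_right mult_assoc mult.commute)
  also have "\<dots> = \<zero>" unfolding zero using * by simp
  finally show ?thesis .
qed

section \<open>Matrix units and the Hilbert spaces on which they act\<close>

definition gens :: "(nat \<Rightarrow> nat) \<Rightarrow> (nat \<Rightarrow> nat) \<Rightarrow> 'a set" where
  "gens m n = {t \<theta> \<otimes> star A (t \<mu>) |\<theta> \<mu>. \<theta> \<in> paths \<Lambda> \<and> \<mu> \<in> paths \<Lambda> \<and>
     deg \<Lambda> \<theta> = m \<and> deg \<Lambda> \<mu> = n \<and> src \<Lambda> \<theta> = src \<Lambda> \<mu>}"

lemma gensI:
  assumes "\<kappa> \<in> paths \<Lambda>" "\<mu> \<in> paths \<Lambda>" "deg \<Lambda> \<kappa> = m" "deg \<Lambda> \<mu> = n" "src \<Lambda> \<kappa> = src \<Lambda> \<mu>"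
  shows "t \<kappa> \<otimes> star A (t \<mu>) \<in> gens m n"
  unfolding gens_def using assms by blast

abbreviation E :: "(nat \<Rightarrow> nat) \<Rightarrow> (nat \<Rightarrow> nat) \<Rightarrow> 'a set" where
  "E m n \<equiv> linear_span A (gens m n)"

definition isom_gens :: "'l \<Rightarrow> (nat \<Rightarrow> nat) \<Rightarrow> 'a set" where
  "isom_gens w n = {t \<mu> |\<mu>. \<mu> \<in> paths \<Lambda> \<and> deg \<Lambda> \<mu> = n \<and> src \<Lambda> \<mu> = w}"

text \<open>\<open>H w n\<close> is a Hilbert space: its inner product is \<open>V\<^sup>* W\<close>, a multiple of the projection \<open>t w\<close>.\<close>

abbreviation H :: "'l \<Rightarrow> (nat \<Rightarrow> nat) \<Rightarrow> 'a set" where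
  "H w n \<equiv> linear_span A (isom_gens w n)"

lemma gens_closed: "gens m n \<subseteq> carrier A" and isom_gens_closed: "isom_gens w n \<subseteq> carrier A"
  by (auto simp: gens_def isom_gens_def)

lemma E_closed: "x \<in> E m n \<Longrightarrow> x \<in> carrier A"
  using linear_span_closed gens_closed by blast

lemma H_closed: "y \<in> H w n \<Longrightarrow> y \<in> carrier A"
  using linear_span_closed isom_gens_closed by blast

lemmas submodule_E = submodule_linear_span[OF gens_closed]
lemmas submodule_H = submodule_linear_span[OF isom_gens_closed]

text \<open>When the inner paths have the same degree, products
  \<open>t \<kappa> \<otimes> star A (t \<mu>)\<close> multiply like matrix units.\<close>

lemma mult_middle:
  assumes "\<mu> \<in> paths \<Lambda>" "\<nu> \<in> paths \<Lambda>" "deg \<Lambda> \<mu> = deg \<Lambda> \<nu>" "x \<in> carrier A" "y \<in> carrier A"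
  shows "(x \<otimes> star A (t \<mu>)) \<otimes> (t \<nu> \<otimes> y) = (if \<mu> = \<nu> then x \<otimes> (t (src \<Lambda> \<mu>) \<otimes> y) else \<zero>)"
proof -
  have "(x \<otimes> star A (t \<mu>)) \<otimes> (t \<nu> \<otimes> y) = x \<otimes> ((star A (t \<mu>) \<otimes> t \<nu>) \<otimes> y)"
    using assms by (simp add: mult_assoc)
  then show ?thesis using assms t_orth[of \<mu> \<nu>] t_star_mult by auto
qed

lemma E_mult_E:
  assumes "x \<in> E l m" "y \<in> E m n" shows "x \<otimes> y \<in> E l n"
proof (rule mult_linear_span[OF submodule_E gens_closed gens_closed _ assms])
  fix a b assume "a \<in> gens l m" "b \<in> gens m n"
  then obtain \<kappa> \<mu> \<nu> \<rho> where *: "\<kappa> \<in> paths \<Lambda>" "\<mu> \<in> paths \<Lambda>" "\<nu> \<in> paths \<Lambda>" "\<rho> \<in> paths \<Lambda>"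
    "deg \<Lambda> \<kappa> = l" "deg \<Lambda> \<mu> = m" "deg \<Lambda> \<nu> = m" "deg \<Lambda> \<rho> = n" "src \<Lambda> \<kappa> = src \<Lambda> \<mu>" "src \<Lambda> \<nu> = src \<Lambda> \<rho>"
    "a = t \<kappa> \<otimes> star A (t \<mu>)" "b = t \<nu> \<otimes> star A (t \<rho>)" unfolding gens_def by blast
  show "a \<otimes> b \<in> E l n"
  proof (cases "\<mu> = \<nu>")
    case True
    then have "a \<otimes> b = t \<kappa> \<otimes> star A (t \<rho>)" using * by (simp add: mult_middle)
    then show ?thesis using * True by (intro linear_span.base) (auto simp: gens_def)
  qed (use * in \<open>simp add: mult_middle linear_span.zero\<close>)
qed

lemma E_mult_H:
  assumes "x \<in> E m n" "V \<in> H w n" shows "x \<otimes> V \<in> H w m"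
proof (rule mult_linear_span[OF submodule_H gens_closed isom_gens_closed _ assms])
  fix a b assume "a \<in> gens m n" "b \<in> isom_gens w n"
  then obtain \<kappa> \<mu> \<nu> where *: "\<kappa> \<in> paths \<Lambda>" "\<mu> \<in> paths \<Lambda>" "\<nu> \<in> paths \<Lambda>"
    "deg \<Lambda> \<kappa> = m" "deg \<Lambda> \<mu> = n" "deg \<Lambda> \<nu> = n" "src \<Lambda> \<kappa> = src \<Lambda> \<mu>" "src \<Lambda> \<nu> = w"
    "a = t \<kappa> \<otimes> star A (t \<mu>)" "b = t \<nu>" unfolding gens_def isom_gens_def by blast
  \<comment> \<open>The factor \<open>t w\<close> is inserted to bring the product into the shape of
    \<open>mult_middle\<close>.\<close>
  then have "a \<otimes> b = (t \<kappa> \<otimes> star A (t \<mu>)) \<otimes> (t \<nu> \<otimes> t w)" using t_src[of \<nu>] by simp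
  also have "\<dots> = (if \<mu> = \<nu> then t \<kappa> else \<zero>)" using * src_vertex[of \<nu>] t_src[of \<kappa>] by (auto simp:
      mult_middle)
  finally show "a \<otimes> b \<in> H w m" using *
    by (auto simp: isom_gens_def intro: linear_span.base linear_span.zero)
qed

lemma star_E:
  assumes "x \<in> E m n" shows "star A x \<in> E n m"
proof (rule star_linear_span[OF submodule_E gens_closed _ assms])
  fix a assume "a \<in> gens m n"
  then show "star A a \<in> E n m" by (auto simp: gens_def star_mult intro!: linear_span.base) metis
qed

text \<open>Between \<open>t \<kappa>\<close> and \<open>star A (t \<mu>)\<close> the vertex
  projection of the common source can be inserted and expanded by \<open>t_sum\<close> over the
  paths of degree \<open>j\<close>. Both degrees rise by \<open>j\<close> and their difference is
  kept, so different elements can be brought to a common right degree.\<close>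

lemma E_refine:
  assumes "j \<in> Nk k" "x \<in> E m n" shows "x \<in> E (m + j) (n + j)"
proof -
  have "gens m n \<subseteq> E (m + j) (n + j)"
  proof
    fix a assume "a \<in> gens m n"
    then obtain \<kappa> \<mu> where *: "\<kappa> \<in> paths \<Lambda>" "\<mu> \<in> paths \<Lambda>" "deg \<Lambda> \<kappa> = m" "deg \<Lambda> \<mu> = n" "src \<Lambda> \<kappa> = src \<Lambda> \<mu>"
      "a = t \<kappa> \<otimes> star A (t \<mu>)" unfolding gens_def by blast
    define w where "w = src \<Lambda> \<kappa>"
    have w: "w \<in> vertices \<Lambda>" using * by (simp add: w_def)
    let ?S = "paths_at_deg \<Lambda> w j"
    have S: "\<alpha> \<in> paths \<Lambda>" "rng \<Lambda> \<alpha> = w" "deg \<Lambda> \<alpha> = j" if "\<alpha> \<in> ?S" for \<alpha>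
      using that by (auto simp: paths_at_deg_def paths_at_def)
    have "a = t \<kappa> \<otimes> (t w \<otimes> star A (t \<mu>))" using * by (simp add: w_def)
    also have "t w = finsum A (\<lambda>\<alpha>. t \<alpha> \<otimes> star A (t \<alpha>)) ?S" using t_sum[OF w assms(1)] .
    also have "t \<kappa> \<otimes> (\<dots> \<otimes> star A (t \<mu>)) = finsum A (\<lambda>\<alpha>. t \<kappa> \<otimes> ((t \<alpha> \<otimes> star A (t \<alpha>)) \<otimes> star A (t \<mu>))) ?S"
      using * S by (subst mult_finsum_right, simp, simp) (subst mult_finsum_left, auto)
    also have "\<dots> \<in> E (m + j) (n + j)"
    proof (rule submodule_finsum[OF submodule_E])
      fix \<alpha> assume \<alpha>: "\<alpha> \<in> ?S"
      obtain y z where y: "t \<kappa> \<otimes> t \<alpha> = y \<odot> t (pcomp \<Lambda> \<kappa> \<alpha>)" and z: "t \<mu> \<otimes> t \<alpha> = z \<odot> t (pcomp \<Lambda> \<mu> \<alpha>)"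
        using t_mult[of \<kappa> \<alpha>] t_mult[of \<mu> \<alpha>] S[OF \<alpha>] * by (auto simp: w_def)
      have "t \<kappa> \<otimes> ((t \<alpha> \<otimes> star A (t \<alpha>)) \<otimes> star A (t \<mu>)) = (t \<kappa> \<otimes> t \<alpha>) \<otimes> star A (t \<mu> \<otimes> t \<alpha>)"
        using S[OF \<alpha>] * by (simp add: star_mult mult_assoc)
      also have "\<dots> = (y * cnj z) \<odot> (t (pcomp \<Lambda> \<kappa> \<alpha>) \<otimes> star A (t (pcomp \<Lambda> \<mu> \<alpha>)))"
        unfolding y z using S[OF \<alpha>] * by (simp add: star_smult mult_smult_left mult_smult_right
            w_def mult.commute)
      finally have eq: "t \<kappa> \<otimes> ((t \<alpha> \<otimes> star A (t \<alpha>)) \<otimes> star A (t \<mu>)) =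
        (y * cnj z) \<odot> (t (pcomp \<Lambda> \<kappa> \<alpha>) \<otimes> star A (t (pcomp \<Lambda> \<mu> \<alpha>)))" .
      have "t (pcomp \<Lambda> \<kappa> \<alpha>) \<otimes> star A (t (pcomp \<Lambda> \<mu> \<alpha>)) \<in> gens (m + j) (n + j)"
        by (rule gensI) (use S[OF \<alpha>] *(1-5) in \<open>simp_all add: w_def\<close>)
      then show "t \<kappa> \<otimes> ((t \<alpha> \<otimes> star A (t \<alpha>)) \<otimes> star A (t \<mu>)) \<in> E (m + j) (n + j)"
        unfolding eq by (intro linear_span.scale linear_span.base)
    qed
    finally show "a \<in> E (m + j) (n + j)" .
  qed
  then show ?thesis using linear_span_subset assms(2) by blast
qed

lemma E_refine_to:
  assumes "x \<in> E m n" "n' \<in> Nk k" "n \<le> n'" shows "x \<in> E (m + (n' - n)) n'"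
proof -
  have "n + (n' - n) = n'" using assms(3) by (simp add: fun_eq_iff le_fun_def)
  then show ?thesis using E_refine[of "n' - n" x m n] assms by simp
qed

lemma H_inner:
  assumes "U \<in> H w n" "V \<in> H w n" "w \<in> vertices \<Lambda>" shows "\<exists>r. star A U \<otimes> V = r \<odot> t w"
proof -
  have sub: "submodule (linear_span A {t w}) complex_ring A" using assms by (intro
      submodule_linear_span) simp
  have U: "star A U \<in> linear_span A (star A ` isom_gens w n)"
    by (rule star_linear_span[OF submodule_linear_span isom_gens_closed _ assms(1)])
      (use isom_gens_closed[of w n] in \<open>auto intro: linear_span.base\<close>)
  have "star A U \<otimes> V \<in> linear_span A {t w}"
  proof (rule mult_linear_span[OF sub _ isom_gens_closed _ U assms(2)])
    show "star A ` isom_gens w n \<subseteq> carrier A" using isom_gens_closed[of w n] by auto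
    fix a b assume "a \<in> star A ` isom_gens w n" "b \<in> isom_gens w n"
    then obtain \<mu> \<nu> where "\<mu> \<in> paths \<Lambda>" "\<nu> \<in> paths \<Lambda>" "deg \<Lambda> \<mu> = n" "deg \<Lambda> \<nu> = n" "src \<Lambda> \<mu> = w"
      "a = star A (t \<mu>)" "b = t \<nu>" unfolding isom_gens_def by blast
    then show "a \<otimes> b \<in> linear_span A {t w}"
      using t_orth[of \<mu> \<nu>] t_star_mult[of \<mu>]
      by (cases "\<mu> = \<nu>") (auto intro: linear_span.base linear_span.zero)
  qed
  then show ?thesis by (rule linear_span_singleton[rotated]) (use assms(3) in simp)
qed

end

section \<open>Scalar multiples of a projection modulo an ideal\<close>

context cstar_algebra
begin

lemma scale_finsum:
  "f \<in> S \<rightarrow> carrier A \<Longrightarrow> z \<odot> finsum A f S = finsum A (\<lambda>i. z \<odot> f i) S"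
proof (induction S rule: infinite_finite_induct)
  case (insert i S)
  then show ?case by (simp add: Pi_iff scale_add_right)
qed (auto simp: M.finsum_infinite)

lemma closed_idealD:
  assumes "closed_ideal A I"
  shows "submodule I complex_ring A" "closedin (norm_topology A) I" "I \<subseteq> carrier A"
    "a \<in> I \<Longrightarrow> x \<in> carrier A \<Longrightarrow> x \<otimes> a \<in> I" "a \<in> I \<Longrightarrow> x \<in> carrier A \<Longrightarrow> a \<otimes> x \<in> I"
  using assms unfolding closed_ideal_def by (auto dest: submoduleE(1))

text \<open>In the quotient by \<open>I\<close> the element \<open>x\<close> becomes
  \<open>r\<close> times a projection of norm 1. To argue inside the algebra, suppose that the norm
  of \<open>x\<close> is below \<open>cmod r\<close>. Then \<open>y\<close>, the compression of
  \<open>x\<close> by \<open>p\<close> divided by \<open>r\<close>, has norm below 1 and agrees with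
  \<open>p\<close> modulo \<open>I\<close>. So do its iterated squares, which tend to zero, and
  \<open>p\<close> lies in the closed set \<open>I\<close>.\<close>

lemma scalar_le_norm_if_projection_notin_ideal:
  assumes I: "closed_ideal A I" and p: "projection p" "p \<notin> I"
    and x: "x \<in> carrier A" "x \<ominus> r \<odot> p \<in> I"
  shows "cmod r \<le> nrm A x"
proof (rule ccontr)
  assume less: "\<not> cmod r \<le> nrm A x"
  then have "0 < cmod r" using norm_nonneg[OF x(1)] by linarith
  then have "r \<noteq> 0" by auto
  note Id = closed_idealD[OF I]
  note [simp] = projectionD[OF p(1)]
  define y where "y = (1 / r) \<odot> (p \<otimes> (x \<otimes> p))"
  have yc: "y \<in> carrier A" using x by (simp add: y_def)
  have py: "p \<otimes> y = y" "y \<otimes> p = y"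
    using x by (simp_all add: y_def mult_smult_left mult_smult_right mult_assoc) (simp flip: mult_assoc)
  have "p \<otimes> ((x \<ominus> r \<odot> p) \<otimes> p) = p \<otimes> (x \<otimes> p) \<ominus> r \<odot> p"
    using x by (simp add: mult_diff_left mult_diff_right mult_smult_left mult_smult_right)
  then have "p \<otimes> (x \<otimes> p) \<ominus> r \<odot> p \<in> I" using Id(4,5) x(2) by (metis \<open>p \<in> carrier A\<close>)
  then have "(- 1 / r) \<odot> (p \<otimes> (x \<otimes> p) \<ominus> r \<odot> p) \<in> I" by (rule submodule_scale[OF Id(1)])
  also have "(- 1 / r) \<odot> (p \<otimes> (x \<otimes> p) \<ominus> r \<odot> p) = p \<ominus> y"
    using x \<open>r \<noteq> 0\<close> by (simp add: diff_eq_scale y_def scale_add_right M.a_comm)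
  finally have py_I: "p \<ominus> y \<in> I" .
  have "nrm A y < 1"
  proof -
    have "nrm A (p \<otimes> (x \<otimes> p)) \<le> nrm A p * (nrm A x * nrm A p)"
      using x by (intro order_trans[OF norm_mult] mult_left_mono norm_mult) (auto simp: norm_nonneg)
    also have "\<dots> \<le> 1 * (nrm A x * 1)"
      using p x by (intro mult_mono norm_projection_le) (auto simp: norm_nonneg)
    also have "\<dots> < cmod r" using less by simp
    finally show ?thesis using x \<open>0 < cmod r\<close> by (simp add: y_def norm_smult norm_divide)
  qed
  have u: "p \<otimes> (sq ^^ j) y = (sq ^^ j) y \<and> (sq ^^ j) y \<otimes> p = (sq ^^ j) y \<and> p \<ominus> (sq ^^ j) y \<in> I" for j
  proof (induction j)
    case 0
    then show ?case using py py_I by simp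
  next
    case (Suc j)
    let ?u = "(sq ^^ j) y"
    have uc: "?u \<in> carrier A" using yc by simp
    have "p \<otimes> (?u \<otimes> ?u) = (p \<otimes> ?u) \<otimes> ?u" using uc by (simp add: mult_assoc)
    moreover have "(?u \<otimes> ?u) \<otimes> p = ?u \<otimes> (?u \<otimes> p)" using uc by (simp add: mult_assoc)
    \<comment> \<open>Since \<open>?u \<otimes> p = ?u\<close>, the two terms \<open>?u\<close> on
      the right cancel.\<close>
    moreover have "p \<ominus> ?u \<otimes> ?u = (p \<ominus> ?u) \<oplus> ?u \<otimes> (p \<ominus> ?u)"
      using Suc uc by (simp add: mult_diff_left diff_add_diff)
    moreover have "(p \<ominus> ?u) \<oplus> ?u \<otimes> (p \<ominus> ?u) \<in> I"
      using Suc uc Id by (intro submoduleE(5)[OF Id(1)]) auto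
    ultimately show ?case using Suc unfolding sq_pow_Suc by simp
  qed
  have "p \<in> I"
  proof (rule closedin_approx[OF Id(2)])
    fix \<epsilon> :: real assume "\<epsilon> > 0"
    have "(\<lambda>j. nrm A y ^ j) \<longlonglongrightarrow> 0"
      using \<open>nrm A y < 1\<close> yc by (intro LIMSEQ_realpow_zero) (auto simp: norm_nonneg)
    then have "eventually (\<lambda>j. nrm A y ^ j < \<epsilon>) sequentially"
      using \<open>\<epsilon> > 0\<close> by (intro order_tendstoD)
    then obtain j where j: "nrm A y ^ j < \<epsilon>" by (auto simp: eventually_sequentially)
    have "nrm A ((sq ^^ j) y) \<le> nrm A y ^ 2 ^ j" by (rule norm_sq_pow_le[OF yc])
    also have "\<dots> \<le> nrm A y ^ j"
      using \<open>nrm A y < 1\<close> yc by (intro power_decreasing) (auto simp: norm_nonneg less_imp_le)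
    also note j
    finally have "nrm A ((sq ^^ j) y) < \<epsilon>" .
    moreover have "p \<ominus> (p \<ominus> (sq ^^ j) y) = (sq ^^ j) y"
      using yc by (simp add: diff_eq_scale scale_add_right)
        (simp add: M.a_assoc[symmetric] flip: diff_eq_scale, simp add: a_minus_def M.r_neg)
    ultimately show "\<exists>z\<in>I. nrm A (p \<ominus> z) < \<epsilon>" using u[of j] by (intro bexI[of _ "p \<ominus> (sq ^^ j) y"]) auto
  qed simp
  then show False using p by simp
qed

end

section \<open>Grading and bandwidth\<close>

definition const_deg :: "nat \<Rightarrow> nat \<Rightarrow> nat \<Rightarrow> nat" where
  "const_deg k N = (\<lambda>i. if i < k then N else 0)"

text \<open>Once the right degree is fixed at \<open>const_deg k N\<close>, the left degree
  \<open>m\<close> encodes the integer grading \<open>m - N\<close> of a component. The box collects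
  the gradings with all entries of absolute value at most \<open>L\<close>, written without
  subtraction.\<close>

definition deg_box :: "nat \<Rightarrow> nat \<Rightarrow> nat \<Rightarrow> (nat \<Rightarrow> nat) set" where
  "deg_box k L N = {m \<in> Nk k. \<forall>i<k. N \<le> m i + L \<and> m i \<le> N + L}"

lemma const_deg_Nk [simp]: "const_deg k N \<in> Nk k"
  by (simp add: Nk_def const_deg_def)

text \<open>The bound is independent of \<open>N\<close>: passing to a larger right degree produces
  no further components.\<close>

lemma deg_box: "finite (deg_box k L N)" "card (deg_box k L N) \<le> (2 * L + 1) ^ k"
proof -
  let ?P = "PiE {..<k} (\<lambda>_. {N - L..N + L})"
  have inj: "inj_on (\<lambda>m. restrict m {..<k}) (deg_box k L N)"
  proof (rule inj_onI)
    fix m n assume mn: "m \<in> deg_box k L N" "n \<in> deg_box k L N" "restrict m {..<k} = restrict n {..<k}"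
    show "m = n"
    proof
      fix i show "m i = n i"
      proof (cases "i < k")
        case True
        then show ?thesis using fun_cong[OF mn(3), of i] by simp
      next
        case False
        then show ?thesis using mn(1,2) by (auto simp: deg_box_def Nk_def)
      qed
    qed
  qed
  have sub: "(\<lambda>m. restrict m {..<k}) ` deg_box k L N \<subseteq> ?P"
    by (auto simp: deg_box_def split: if_splits)
  have fin: "finite ?P" by (intro finite_PiE) auto
  show "finite (deg_box k L N)" by (rule inj_on_finite[OF inj sub fin])
  have "card (deg_box k L N) \<le> card ?P" by (rule card_inj_on_le[OF inj sub fin])
  also have "\<dots> = (card {N - L..N + L}) ^ k" by (simp add: card_PiE)
  also have "\<dots> \<le> (2 * L + 1) ^ k" by (intro power_mono) auto
  finally show "card (deg_box k L N) \<le> (2 * L + 1) ^ k" .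
qed

context twisted_family
begin

text \<open>Band matrices: \<open>L\<close> is the bandwidth, on which the estimates depend, and
  \<open>N\<close> is just a common level of refinement.\<close>

definition W :: "nat \<Rightarrow> nat \<Rightarrow> 'a set" where
  "W L N = linear_span A (\<Union>m\<in>deg_box k L N. gens m (const_deg k N))"

lemma W_gens_closed: "(\<Union>m\<in>deg_box k L N. gens m (const_deg k N)) \<subseteq> carrier A"
  using gens_closed by blast

lemma W_closed: "x \<in> W L N \<Longrightarrow> x \<in> carrier A"
  unfolding W_def using linear_span_closed W_gens_closed by blast

lemma submodule_W: "submodule (W L N) complex_ring A"
  unfolding W_def by (rule submodule_linear_span[OF W_gens_closed])

lemma E_subset_W: "m \<in> deg_box k L N \<Longrightarrow> E m (const_deg k N) \<subseteq> W L N"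
  unfolding W_def by (intro linear_span_mono) auto

lemma E_in_W:
  assumes x: "x \<in> E m n" and "m \<in> Nk k" "n \<in> Nk k"
    and le: "\<And>i. i < k \<Longrightarrow> n i \<le> N \<and> n i \<le> m i + L \<and> m i \<le> n i + L"
  shows "x \<in> W L N"
proof -
  have "x \<in> E (m + (const_deg k N - n)) (const_deg k N)"
    using le assms(3) by (intro E_refine_to[OF x]) (auto simp: const_deg_def le_fun_def Nk_def)
  moreover have "m + (const_deg k N - n) \<in> deg_box k L N"
    unfolding deg_box_def
  proof (intro CollectI conjI allI impI)
    fix i assume "i < k"
    then show "N \<le> (m + (const_deg k N - n)) i + L" "(m + (const_deg k N - n)) i \<le> N + L"
      using le[of i] by (auto simp: const_deg_def)
  qed (use assms in simp)
  ultimately show ?thesis using E_subset_W by blast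
qed

lemma W_mono:
  assumes "L \<le> L'" "N \<le> N'" shows "W L N \<subseteq> W L' N'"
proof -
  have "(\<Union>m\<in>deg_box k L N. gens m (const_deg k N)) \<subseteq> W L' N'"
  proof
    fix x assume "x \<in> (\<Union>m\<in>deg_box k L N. gens m (const_deg k N))"
    then obtain m where m: "m \<in> deg_box k L N" "x \<in> gens m (const_deg k N)" by blast
    show "x \<in> W L' N'"
    proof (rule E_in_W[OF linear_span.base[OF m(2)]])
      fix i assume "i < k"
      then show "const_deg k N i \<le> N' \<and> const_deg k N i \<le> m i + L' \<and> m i \<le> const_deg k N i + L'"
        using m(1) assms by (auto simp: deg_box_def const_deg_def intro: order_trans)
    qed (use m(1) in \<open>auto simp: deg_box_def\<close>)
  qed
  then show ?thesis unfolding W_def[of L N] by (rule linear_span_le_submodule[OF submodule_W])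
qed

text \<open>Gradings add under multiplication, hence so do the bandwidths, provided that the inner
  degrees are first refined to a common one.\<close>

lemma W_mult:
  assumes "x \<in> W L N" "y \<in> W L' N'"
  shows "x \<otimes> y \<in> W (L + L') (N + N' + L' + L')"
proof (rule mult_linear_span[OF submodule_W W_gens_closed W_gens_closed _ assms[unfolded W_def]])
  fix a b assume "a \<in> (\<Union>m\<in>deg_box k L N. gens m (const_deg k N))"
    "b \<in> (\<Union>m\<in>deg_box k L' N'. gens m (const_deg k N'))"
  then obtain l m where l: "l \<in> deg_box k L N" "a \<in> gens l (const_deg k N)"
    and m: "m \<in> deg_box k L' N'" "b \<in> gens m (const_deg k N')" by blast
  have Nk: "l \<in> Nk k" "m \<in> Nk k" using l m by (auto simp: deg_box_def)
  \<comment> \<open>A common inner degree: it dominates both the right degree \<open>N\<close> of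
    \<open>a\<close> and the left degree \<open>m\<close> of \<open>b\<close>, whose entries are at
    most \<open>N' + L'\<close>. After refinement the right degree of the product is at most
    \<open>P + L'\<close>, the level in the claim.\<close>
  define P where "P = N + N' + L'"
  have "a \<in> E (l + (const_deg k P - const_deg k N)) (const_deg k P)"
    by (rule E_refine_to[OF linear_span.base[OF l(2)]]) (auto simp: const_deg_def le_fun_def P_def
        Nk_def)
  moreover have "b \<in> E (const_deg k P) (const_deg k N' + (const_deg k P - m))"
  proof -
    \<comment> \<open>\<open>E_refine_to\<close> prescribes the right degree; the left degree of
      \<open>b\<close> is prescribed through the adjoint.\<close>
    have "star A b \<in> E (const_deg k N') m" using m(2) by (intro star_E linear_span.base)
    then have "star A b \<in> E (const_deg k N' + (const_deg k P - m)) (const_deg k P)"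
    proof (rule E_refine_to)
      show "m \<le> const_deg k P"
        using m(1) by (force simp: deg_box_def const_deg_def le_fun_def P_def Nk_def)
    qed simp
    then have "star A (star A b) \<in> E (const_deg k P) (const_deg k N' + (const_deg k P - m))" by
        (rule star_E)
    then show ?thesis using m(2) gens_closed[of m "const_deg k N'"] by auto
  qed
  ultimately have ab: "a \<otimes> b \<in> E (l + (const_deg k P - const_deg k N)) (const_deg k N' + (const_deg
      k P - m))"
    by (rule E_mult_E)
  show "a \<otimes> b \<in> W (L + L') (N + N' + L' + L')"
  proof (rule E_in_W[OF ab])
    fix i assume i: "i < k"
    have "N \<le> l i + L" "l i \<le> N + L" "N' \<le> m i + L'" "m i \<le> N' + L'"
      using l(1) m(1) i by (auto simp: deg_box_def)
    then show "(const_deg k N' + (const_deg k P - m)) i \<le> N + N' + L' + L' \<and>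
      (const_deg k N' + (const_deg k P - m)) i \<le> (l + (const_deg k P - const_deg k N)) i + (L + L') \<and>
      (l + (const_deg k P - const_deg k N)) i \<le> (const_deg k N' + (const_deg k P - m)) i + (L + L')"
      using i by (auto simp: const_deg_def P_def)
  qed (use Nk in simp_all)
qed

text \<open>Taking adjoints exchanges the two degrees and negates the grading. The new right degree
  \<open>m\<close> exceeds \<open>N\<close> by at most \<open>L\<close> in each coordinate.\<close>

lemma W_star:
  assumes "x \<in> W L N" shows "star A x \<in> W L (N + L)"
proof (rule star_linear_span[OF submodule_W W_gens_closed _ assms[unfolded W_def]])
  fix a assume "a \<in> (\<Union>m\<in>deg_box k L N. gens m (const_deg k N))"
  then obtain m where m: "m \<in> deg_box k L N" "a \<in> gens m (const_deg k N)" by blast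
  have a: "star A a \<in> E (const_deg k N) m" using m(2) by (intro star_E linear_span.base)
  show "star A a \<in> W L (N + L)"
    by (rule E_in_W[OF a]) (use m(1) in \<open>auto simp: deg_box_def const_deg_def Nk_def\<close>)
qed

lemma span_in_W:
  assumes "x \<in> linear_span A {t \<kappa> \<otimes> star A (t \<mu>) |\<kappa> \<mu>. \<kappa> \<in> paths \<Lambda> \<and> \<mu> \<in> paths \<Lambda>}"
  shows "\<exists>L N. x \<in> W L N"
  using assms
proof (induction rule: linear_span.induct)
  case (base x)
  then obtain \<kappa> \<mu> where x: "\<kappa> \<in> paths \<Lambda>" "\<mu> \<in> paths \<Lambda>" "x = t \<kappa> \<otimes> star A (t \<mu>)" by blast
  show ?case
  proof (cases "src \<Lambda> \<kappa> = src \<Lambda> \<mu>")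
    case True
    \<comment> \<open>A crude bound for all coordinates of both degrees; it serves as bandwidth and
      as level.\<close>
    define N where "N = (\<Sum>i<k. deg \<Lambda> \<kappa> i + deg \<Lambda> \<mu> i)"
    have "x \<in> E (deg \<Lambda> \<kappa>) (deg \<Lambda> \<mu>)" using x True by (auto intro: linear_span.base gensI)
    then have "x \<in> W N N"
    proof (rule E_in_W)
      fix i assume "i < k"
      then have "deg \<Lambda> \<kappa> i + deg \<Lambda> \<mu> i \<le> N" unfolding N_def by (intro member_le_sum) auto
      then show "deg \<Lambda> \<mu> i \<le> N \<and> deg \<Lambda> \<mu> i \<le> deg \<Lambda> \<kappa> i + N \<and> deg \<Lambda> \<kappa> i \<le> deg \<Lambda> \<mu> i + N" by auto
    qed (use x in simp_all)
    then show ?thesis by blast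
  next
    case False
    then show ?thesis using x t_mult_star_zero submodule_zero[OF submodule_W] by metis
  qed
next
  case zero
  show ?case using submodule_zero[OF submodule_W] by blast
next
  case (add x y)
  then obtain L N L' N' where "x \<in> W L N" "y \<in> W L' N'" by blast
  then have "x \<in> W (max L L') (max N N')" "y \<in> W (max L L') (max N N')"
    using W_mono[of L "max L L'" N "max N N'"] W_mono[of L' "max L L'" N' "max N N'"] by auto
  then show ?case using submoduleE(5)[OF submodule_W] by blast
next
  case (scale x z)
  then show ?case using submodule_scale[OF submodule_W] by blast
qed

lemma W_decompose:
  assumes "y \<in> W L N"
  shows "\<exists>f. (\<forall>m\<in>deg_box k L N. f m \<in> E m (const_deg k N)) \<and> y = finsum A f (deg_box k L N)"
  using assms unfolding W_def
proof (induction rule: linear_span.induct)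
  case (base x)
  then obtain m where m: "m \<in> deg_box k L N" "x \<in> gens m (const_deg k N)" by blast
  then have x: "x \<in> carrier A" "x \<in> E m (const_deg k N)" using gens_closed by (auto intro:
      linear_span.base)
  have "x = finsum A (\<lambda>i. if m = i then x else \<zero>) (deg_box k L N)"
    using M.finsum_singleton[OF m(1) deg_box(1), of "\<lambda>_. x"] x by simp
  then show ?case using x by (intro exI[of _ "\<lambda>i. if m = i then x else \<zero>"]) (auto intro:
      linear_span.zero)
next
  case zero
  have "finsum A (\<lambda>i. \<zero>) (deg_box k L N) = \<zero>" by simp
  then show ?case by (intro exI[of _ "\<lambda>i. \<zero>"]) (auto intro: linear_span.zero)
next
  case (add x y)
  then obtain f g where f: "\<forall>m\<in>deg_box k L N. f m \<in> E m (const_deg k N)" "x = finsum A f (deg_box k L N)"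
    and g: "\<forall>m\<in>deg_box k L N. g m \<in> E m (const_deg k N)" "y = finsum A g (deg_box k L N)" by blast
  have "x \<oplus> y = finsum A (\<lambda>m. f m \<oplus> g m) (deg_box k L N)"
    unfolding f g using f(1) g(1) E_closed by (intro M.finsum_addf[symmetric]) blast+
  then show ?case using f(1) g(1) by (intro exI[of _ "\<lambda>m. f m \<oplus> g m"]) (auto intro: linear_span.add)
next
  case (scale x z)
  then obtain f where f: "\<forall>m\<in>deg_box k L N. f m \<in> E m (const_deg k N)" "x = finsum A f (deg_box k L
      N)" by blast
  have "z \<odot> x = finsum A (\<lambda>m. z \<odot> f m) (deg_box k L N)"
    unfolding f using f(1) E_closed by (intro scale_finsum) blast
  then show ?case using f(1) by (intro exI[of _ "\<lambda>m. z \<odot> f m"]) (auto intro: linear_span.scale)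
qed

section \<open>Local units and norms of homogeneous elements\<close>

definition unit_sum :: "'l set \<Rightarrow> 'a" where
  "unit_sum T = finsum A (\<lambda>\<mu>. t \<mu> \<otimes> star A (t \<mu>)) T"

lemma star_t_unit_sum:
  assumes "finite T" "T \<subseteq> {\<mu> \<in> paths \<Lambda>. deg \<Lambda> \<mu> = n}" "\<mu> \<in> T"
  shows "star A (t \<mu>) \<otimes> unit_sum T = star A (t \<mu>)"
proof -
  have \<mu>: "\<mu> \<in> paths \<Lambda>" "deg \<Lambda> \<mu> = n" using assms by auto
  have c: "(\<lambda>\<nu>. t \<nu> \<otimes> star A (t \<nu>)) \<in> T \<rightarrow> carrier A" using assms(2) by auto
  have "star A (t \<mu>) \<otimes> unit_sum T = finsum A (\<lambda>\<nu>. star A (t \<mu>) \<otimes> (t \<nu> \<otimes> star A (t \<nu>))) T"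
    unfolding unit_sum_def using \<mu> c by (intro mult_finsum_left) auto
  also have "\<dots> = finsum A (\<lambda>\<nu>. if \<mu> = \<nu> then star A (t \<nu>) else \<zero>) T"
  proof (rule M.finsum_cong')
    fix \<nu> assume "\<nu> \<in> T"
    then have \<nu>: "\<nu> \<in> paths \<Lambda>" "deg \<Lambda> \<nu> = n" using assms by auto
    have "star A (t \<mu>) \<otimes> (t \<nu> \<otimes> star A (t \<nu>)) = (star A (t \<mu>) \<otimes> t \<nu>) \<otimes> star A (t \<nu>)"
      using \<mu> \<nu> by (simp add: mult_assoc)
    then show "star A (t \<mu>) \<otimes> (t \<nu> \<otimes> star A (t \<nu>)) = (if \<mu> = \<nu> then star A (t \<nu>) else \<zero>)"
      using \<mu> \<nu> t_orth[of \<mu> \<nu>] by (auto simp: t_star_mult)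
  qed (use assms(2) in auto)
  also have "\<dots> = star A (t \<mu>)"
    using assms(2) by (intro M.finsum_singleton[OF assms(3,1)]) auto
  finally show ?thesis .
qed

lemma unit_sum_closed [simp]: "T \<subseteq> paths \<Lambda> \<Longrightarrow> unit_sum T \<in> carrier A"
  unfolding unit_sum_def by (intro finsum_closed') auto

text \<open>The claim covers all larger finite sets \<open>T'\<close> so that the induction passes
  to sums: the union of the sets of two summands works for both.\<close>

lemma E_local_unit:
  assumes "b \<in> E m n"
  shows "\<exists>T. finite T \<and> T \<subseteq> {\<mu> \<in> paths \<Lambda>. deg \<Lambda> \<mu> = n} \<and>
    (\<forall>T'. finite T' \<and> T \<subseteq> T' \<and> T' \<subseteq> {\<mu> \<in> paths \<Lambda>. deg \<Lambda> \<mu> = n} \<longrightarrow> b \<otimes> unit_sum T' = b)"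
    (is "\<exists>T. ?P T b")
  using assms
proof (induction rule: linear_span.induct)
  case (base b)
  then obtain \<kappa> \<mu> where *: "\<kappa> \<in> paths \<Lambda>" "\<mu> \<in> paths \<Lambda>" "deg \<Lambda> \<mu> = n" "b = t \<kappa> \<otimes> star A (t \<mu>)"
    unfolding gens_def by blast
  have "b \<otimes> unit_sum T' = b" if T': "finite T'" "{\<mu>} \<subseteq> T'" "T' \<subseteq> {\<mu> \<in> paths \<Lambda>. deg \<Lambda> \<mu> = n}" for T'
  proof -
    have "unit_sum T' \<in> carrier A" using T' by (intro unit_sum_closed) auto
    then have "b \<otimes> unit_sum T' = t \<kappa> \<otimes> (star A (t \<mu>) \<otimes> unit_sum T')" using * by (simp add: mult_assoc)
    then show ?thesis using star_t_unit_sum[OF T'(1,3), of \<mu>] T' * by simp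
  qed
  then have "?P {\<mu>} b" using * by simp
  then show ?case by blast
next
  case zero
  have "\<zero> \<otimes> unit_sum T' = \<zero>" if T': "T' \<subseteq> {\<mu> \<in> paths \<Lambda>. deg \<Lambda> \<mu> = n}" for T'
    using T' by (intro mult_zero_left unit_sum_closed) auto
  then have "?P {} \<zero>" by simp
  then show ?case by blast
next
  case (add x y)
  then obtain S T where S: "?P S x" and T: "?P T y" by blast
  have "(x \<oplus> y) \<otimes> unit_sum T' = x \<oplus> y"
    if T': "finite T'" "S \<union> T \<subseteq> T'" "T' \<subseteq> {\<mu> \<in> paths \<Lambda>. deg \<Lambda> \<mu> = n}" for T'
  proof -
    have "unit_sum T' \<in> carrier A" using T' by (intro unit_sum_closed) auto
    then have "(x \<oplus> y) \<otimes> unit_sum T' = x \<otimes> unit_sum T' \<oplus> y \<otimes> unit_sum T'"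
      using add E_closed by (intro mult_distrib_right) auto
    moreover have "x \<otimes> unit_sum T' = x" "y \<otimes> unit_sum T' = y" using S T T' by auto
    ultimately show ?thesis by simp
  qed
  then have "?P (S \<union> T) (x \<oplus> y)" using S T by auto
  then show ?case by blast
next
  case (scale x z)
  then obtain T where T: "?P T x" by blast
  have "(z \<odot> x) \<otimes> unit_sum T' = z \<odot> x"
    if T': "finite T'" "T \<subseteq> T'" "T' \<subseteq> {\<mu> \<in> paths \<Lambda>. deg \<Lambda> \<mu> = n}" for T'
  proof -
    have "unit_sum T' \<in> carrier A" using T' by (intro unit_sum_closed) auto
    moreover have "x \<otimes> unit_sum T' = x" using T T' by auto
    ultimately show ?thesis using scale E_closed by (simp add: mult_smult_left)
  qed
  then have "?P T (z \<odot> x)" using T by auto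
  then show ?case by blast
qed

lemma t_in_H: "\<mu> \<in> paths \<Lambda> \<Longrightarrow> t \<mu> \<in> H (src \<Lambda> \<mu>) (deg \<Lambda> \<mu>)"
  by (intro linear_span.base) (auto simp: isom_gens_def)

text \<open>\<open>b\<close> acts on the Hilbert spaces \<open>H w n\<close> as a matrix with finitely many nonzero entries. Its
  operator norm controls the entries of powers of \<open>b\<^sup>* b\<close>, hence, by the C*-identity, the norm of \<open>b\<close>.\<close>

lemma norm_E_le:
  assumes b: "b \<in> E m n" and K: "0 \<le> K"
    and le: "\<And>w V. w \<in> vertices \<Lambda> \<Longrightarrow> V \<in> H w n \<Longrightarrow> nrm A (b \<otimes> V) \<le> K * nrm A V"
  shows "nrm A b \<le> K"
proof -
  have bc: "b \<in> carrier A" using b by (rule E_closed)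
  define x where "x = star A b \<otimes> b"
  have x: "x \<in> carrier A" "star A x = x" "x \<in> E n n"
    using bc b by (auto simp: x_def star_mult intro: E_mult_E star_E)
  have x_bound: "nrm A (x \<otimes> V) \<le> K\<^sup>2 * nrm A V" if w: "w \<in> vertices \<Lambda>" and V: "V \<in> H w n" for w V
  proof -
    have Vc: "V \<in> carrier A" using V by (rule H_closed)
    define Y where "Y = x \<otimes> V"
    have Y: "Y \<in> H w n" "Y \<in> carrier A" using E_mult_H[OF x(3) V] H_closed by (auto simp: Y_def)
    \<comment> \<open>In Hilbert space terms, the inner product of \<open>Y = b\<^sup>* b V\<close>
      with itself is that of \<open>b V\<close> with \<open>b Y\<close>; so bounds on the action of
      \<open>b\<close> alone are enough.\<close>
    have "star A Y \<otimes> Y = star A (b \<otimes> V) \<otimes> (b \<otimes> Y)"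
      using bc Vc Y(2) by (simp add: Y_def x_def star_mult mult_assoc)
    then have "(nrm A Y)\<^sup>2 \<le> nrm A (b \<otimes> V) * nrm A (b \<otimes> Y)"
      using cstar_identity[OF Y(2)] norm_mult[of "star A (b \<otimes> V)" "b \<otimes> Y"] bc Vc Y(2) by simp
    also have "\<dots> \<le> (K * nrm A V) * (K * nrm A Y)"
      using le[OF w V] le[OF w Y(1)] K bc Vc Y(2) by (intro mult_mono) (auto simp: norm_nonneg)
    finally have "nrm A Y * nrm A Y \<le> (K\<^sup>2 * nrm A V) * nrm A Y" by (simp add: power2_eq_square mult_ac)
    then show ?thesis
      using K norm_nonneg[OF Y(2)] norm_nonneg[OF Vc]
      by (cases "nrm A Y = 0") (auto simp: Y_def mult_le_cancel_right)
  qed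
  have xj: "(sq ^^ j) x \<otimes> V \<in> H w n \<and> nrm A ((sq ^^ j) x \<otimes> V) \<le> (K\<^sup>2) ^ (2 ^ j) * nrm A V"
    if w: "w \<in> vertices \<Lambda>" and V: "V \<in> H w n" for w V j
    using V
  proof (induction j arbitrary: V)
    case 0
    then show ?case using x_bound[OF w] E_mult_H[OF x(3)] by simp
  next
    case (Suc j)
    have Vc: "V \<in> carrier A" using Suc.prems by (rule H_closed)
    let ?u = "(sq ^^ j) x"
    have eq: "(sq ^^ Suc j) x \<otimes> V = ?u \<otimes> (?u \<otimes> V)" unfolding sq_pow_Suc using x Vc by (simp add:
        mult_assoc)
    have "nrm A (?u \<otimes> (?u \<otimes> V)) \<le> (K\<^sup>2) ^ (2 ^ j) * nrm A (?u \<otimes> V)" using Suc by blast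
    also have "\<dots> \<le> (K\<^sup>2) ^ (2 ^ j) * ((K\<^sup>2) ^ (2 ^ j) * nrm A V)"
      using Suc by (intro mult_left_mono) auto
    also have "\<dots> = (K\<^sup>2) ^ (2 ^ Suc j) * nrm A V" by (simp only: power_Suc mult_2 power_add mult.assoc)
    finally show ?case unfolding eq using Suc by blast
  qed
  obtain T where T: "finite T" "T \<subseteq> {\<mu> \<in> paths \<Lambda>. deg \<Lambda> \<mu> = n}" "x \<otimes> unit_sum T = x"
    using E_local_unit[OF x(3)] by blast
  have uc: "unit_sum T \<in> carrier A" using T(2) by (intro unit_sum_closed) auto
  have unit: "(sq ^^ j) x \<otimes> unit_sum T = (sq ^^ j) x" for j
  proof (induction j)
    case (Suc j)
    then show ?case unfolding sq_pow_Suc using x(1) uc by (simp add: mult_assoc)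
  qed (use T(3) in simp)
  \<comment> \<open>The iterated square splits into \<open>card T\<close> columns, each bounded
    through its action on one \<open>t \<mu>\<close>. The number \<open>card T\<close> does not
    change with \<open>j\<close> and so disappears on taking roots.\<close>
  have "nrm A ((sq ^^ j) x) \<le> real (card T) * (K\<^sup>2) ^ (2 ^ j)" for j
  proof -
    let ?u = "(sq ^^ j) x"
    have "?u = finsum A (\<lambda>\<mu>. ?u \<otimes> (t \<mu> \<otimes> star A (t \<mu>))) T"
      using unit[of j] x(1) T(2) unfolding unit_sum_def by (subst (asm) mult_finsum_left) auto
    moreover have "nrm A (finsum A (\<lambda>\<mu>. ?u \<otimes> (t \<mu> \<otimes> star A (t \<mu>))) T) \<le> real (card T) * (K\<^sup>2) ^ (2 ^ j)"
    proof (rule norm_finsum[OF T(1)])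
      fix \<mu> assume "\<mu> \<in> T"
      then have \<mu>: "\<mu> \<in> paths \<Lambda>" "deg \<Lambda> \<mu> = n" using T by auto
      then show "?u \<otimes> (t \<mu> \<otimes> star A (t \<mu>)) \<in> carrier A" using x by simp
      have "?u \<otimes> (t \<mu> \<otimes> star A (t \<mu>)) = (?u \<otimes> t \<mu>) \<otimes> star A (t \<mu>)" using \<mu> x by (simp add: mult_assoc)
      then have "nrm A (?u \<otimes> (t \<mu> \<otimes> star A (t \<mu>))) \<le> nrm A (?u \<otimes> t \<mu>) * nrm A (t \<mu>)"
        using norm_mult[of "?u \<otimes> t \<mu>" "star A (t \<mu>)"] \<mu> x by simp
      also have "\<dots> \<le> ((K\<^sup>2) ^ (2 ^ j) * nrm A (t \<mu>)) * nrm A (t \<mu>)"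
        using xj[of "src \<Lambda> \<mu>" "t \<mu>" j] t_in_H[of \<mu>] \<mu> by (intro mult_right_mono) (auto simp: norm_nonneg)
      also have "\<dots> \<le> ((K\<^sup>2) ^ (2 ^ j) * 1) * 1"
        using norm_t_le[of \<mu>] \<mu> by (intro mult_mono) (auto simp: norm_nonneg)
      finally show "nrm A (?u \<otimes> (t \<mu> \<otimes> star A (t \<mu>))) \<le> (K\<^sup>2) ^ (2 ^ j)" by simp
    qed
    ultimately show ?thesis by simp
  qed
  then have le_j: "nrm A x ^ 2 ^ j \<le> real (card T) * (K\<^sup>2) ^ (2 ^ j)" for j
    using norm_sq_pow[OF x(1,2)] by simp
  \<comment> \<open>The maximum with 1 makes the powers of the base nondecreasing, so that each of
    them with exponent \<open>Suc j\<close> dominates \<open>card T\<close>.\<close>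
  have "nrm A x \<le> K\<^sup>2"
  proof (rule le_of_power_two_powers[where K = "max 1 (real (card T))"])
    fix j
    have "real (card T) \<le> max 1 (real (card T)) ^ 1" by simp
    also have "\<dots> \<le> max 1 (real (card T)) ^ Suc j" by (intro power_increasing) auto
    finally show "nrm A x ^ 2 ^ j \<le> max 1 (real (card T)) ^ Suc j * (K\<^sup>2) ^ 2 ^ j"
      using le_j[of j] by (meson mult_right_mono order_trans zero_le_power zero_le_power2)
  qed (use x norm_nonneg in auto)
  then have "(nrm A b)\<^sup>2 \<le> K\<^sup>2" using cstar_identity[OF bc] by (simp add: x_def)
  then show ?thesis using K by (rule power2_le_imp_le)
qed

end

section \<open>Ideals\<close>

context twisted_family
begin

text \<open>The elements annihilated by the compression with \<open>t \<xi>\<close> form a subspace,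
  so \<open>t_mult_shift_distinct\<close> extends from paths to vectors by bilinearity.\<close>

lemma H_cross_zero:
  assumes \<xi>: "shift_distinct \<xi> a b" "\<xi> \<in> paths \<Lambda>" and U: "U \<in> H (rng \<Lambda> \<xi>) m" and V: "V \<in> H (rng \<Lambda> \<xi>) n"
    and deg: "m + a = n + b"
  shows "star A (t \<xi>) \<otimes> ((star A U \<otimes> V) \<otimes> t \<xi>) = \<zero>"
proof -
  let ?w = "rng \<Lambda> \<xi>"
  let ?Z = "{x \<in> carrier A. star A (t \<xi>) \<otimes> (x \<otimes> t \<xi>) = \<zero>}"
  have sub: "submodule ?Z complex_ring A"
    using \<xi>(2) by (intro submoduleI)
      (auto simp: neg_eq_scale mult_distrib_left mult_distrib_right mult_smult_left mult_smult_right)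
  have U': "star A U \<in> linear_span A (star A ` isom_gens ?w m)"
    by (rule star_linear_span[OF submodule_linear_span isom_gens_closed _ U])
      (use isom_gens_closed[of ?w m] in \<open>auto intro: linear_span.base\<close>)
  have "star A U \<otimes> V \<in> ?Z"
  proof (rule mult_linear_span[OF sub _ isom_gens_closed _ U' V])
    show "star A ` isom_gens ?w m \<subseteq> carrier A" using isom_gens_closed[of ?w m] by auto
    fix x y assume "x \<in> star A ` isom_gens ?w m" "y \<in> isom_gens ?w n"
    then obtain \<mu> \<nu> where "\<mu> \<in> paths \<Lambda>" "\<nu> \<in> paths \<Lambda>" "deg \<Lambda> \<mu> = m" "deg \<Lambda> \<nu> = n" "src \<Lambda> \<mu> = ?w"
        "src \<Lambda> \<nu> = ?w"
      "x = star A (t \<mu>)" "y = t \<nu>" unfolding isom_gens_def by blast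
    then show "x \<otimes> y \<in> ?Z" using t_mult_shift_distinct[OF \<xi>, of \<mu> \<nu>] deg by simp
  qed
  then show ?thesis by simp
qed

text \<open>By \<open>norm_E_le\<close> it is enough to bound \<open>U = f m \<otimes> V\<close> for
  a vector \<open>V\<close>. The map \<open>\<Phi>\<close> sends \<open>f m\<close> to a multiple
  \<open>r\<close> of a vertex projection, with \<open>cmod r\<close> the square of the norm of
  \<open>U\<close>, and every other component to zero. Hence \<open>\<Phi> z\<close> is that
  multiple modulo \<open>I\<close>, so \<open>cmod r\<close> is at most the norm of
  \<open>\<Phi> z\<close>. This is at most the product of the norms of \<open>U\<close>,
  \<open>z\<close> and \<open>V\<close>, and one factor \<open>nrm A U\<close> cancels.\<close>

lemma norm_component_le:
  assumes I: "closed_ideal A I" and none: "\<And>v. v \<in> vertices \<Lambda> \<Longrightarrow> t v \<notin> I"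
    and ap: "kgraph_aperiodic k \<Lambda>" and F: "finite F" "F \<subseteq> Nk k" and f: "\<And>m. m \<in> F \<Longrightarrow> f m \<in> E m n"
    and z: "z \<in> carrier A" "z \<ominus> finsum A f F \<in> I" and m: "m \<in> F"
  shows "nrm A (f m) \<le> nrm A z"
proof (rule norm_E_le[OF f[OF m] norm_nonneg[OF z(1)]])
  fix w V assume w: "w \<in> vertices \<Lambda>" and V: "V \<in> H w n"
  note Id = closed_idealD[OF I]
  define U where "U = f m \<otimes> V"
  have U: "U \<in> H w m" unfolding U_def by (rule E_mult_H[OF f[OF m] V])
  have c: "U \<in> carrier A" "V \<in> carrier A" "\<And>i. i \<in> F \<Longrightarrow> f i \<in> carrier A"
    using U V f E_closed H_closed by blast+
  obtain r where r: "star A U \<otimes> U = r \<odot> t w" using H_inner[OF U U w] by blast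
  \<comment> \<open>The shifts raise both \<open>m\<close> and \<open>i\<close> to their supremum,
    as \<open>H_cross_zero\<close> demands; they differ because \<open>m\<close> and
    \<open>i\<close> do.\<close>
  let ?P = "(\<lambda>i. (sup m i - m, sup m i - i)) ` (F - {m})"
  have sup_diff: "x + (sup m i - x) = sup m i" if "x \<le> sup m i" for x i :: "nat \<Rightarrow> nat"
    using that by (auto simp: fun_eq_iff le_fun_def)
  have "\<exists>\<xi>\<in>paths \<Lambda>. rng \<Lambda> \<xi> = w \<and> (\<forall>(a, b)\<in>?P. shift_distinct \<xi> a b)"
  proof (rule exists_shift_distinct_finite[OF ap w])
    fix a b assume "(a, b) \<in> ?P"
    then obtain i where i: "i \<in> F" "i \<noteq> m" "a = sup m i - m" "b = sup m i - i" by auto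
    have "a \<noteq> b"
    proof
      assume "a = b"
      have "m + a = i + b" unfolding i(3,4) by (simp add: sup_diff)
      then have "m = i" using \<open>a = b\<close> by simp
      then show False using i(2) by simp
    qed
    moreover have "m \<in> Nk k" "i \<in> Nk k" using F m i(1) by auto
    ultimately show "a \<in> Nk k \<and> b \<in> Nk k \<and> a \<noteq> b" unfolding i(3,4) by simp
  qed (use F in simp)
  then obtain \<xi> where \<xi>: "\<xi> \<in> paths \<Lambda>" "rng \<Lambda> \<xi> = w" "\<And>a b. (a, b) \<in> ?P \<Longrightarrow> shift_distinct \<xi> a b" by blast
  \<comment> \<open>The matrix coefficient of \<open>x\<close> at the vectors \<open>U\<close> and
    \<open>V\<close>, compressed by \<open>t \<xi>\<close>.\<close>
  define \<Phi> where "\<Phi> x = star A (t \<xi>) \<otimes> ((star A U \<otimes> (x \<otimes> V)) \<otimes> t \<xi>)" for x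
  have \<Phi>_closed: "\<Phi> x \<in> carrier A" if "x \<in> carrier A" for x using that c \<xi>(1) by (simp add: \<Phi>_def)
  have \<Phi>_diff: "\<Phi> (x \<ominus> y) = \<Phi> x \<ominus> \<Phi> y" if "x \<in> carrier A" "y \<in> carrier A" for x y
    using that c \<xi>(1) by (simp add: \<Phi>_def mult_diff_left mult_diff_right)
  have \<Phi>_ideal: "\<Phi> x \<in> I" if "x \<in> I" for x
    using that c \<xi>(1) unfolding \<Phi>_def by (intro Id(4,5)) auto
  have \<Phi>_m: "\<Phi> (f m) = r \<odot> t (src \<Lambda> \<xi>)"
    using c \<xi>(1) r w \<xi>(2) t_rng[OF \<xi>(1)] t_star_mult[OF \<xi>(1)]
    by (simp add: \<Phi>_def flip: U_def) (simp add: mult_smult_left mult_smult_right)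
  have \<Phi>_other: "\<Phi> (f i) = \<zero>" if i: "i \<in> F" "m \<noteq> i" for i
    unfolding \<Phi>_def
  proof (rule H_cross_zero[OF _ \<xi>(1)])
    show "shift_distinct \<xi> (sup m i - m) (sup m i - i)" using i by (intro \<xi>(3)) auto
    show "U \<in> H (rng \<Lambda> \<xi>) m" "f i \<otimes> V \<in> H (rng \<Lambda> \<xi>) i"
      unfolding \<xi>(2) using U E_mult_H[OF f[OF i(1)] V] by auto
    show "m + (sup m i - m) = i + (sup m i - i)" by (simp add: sup_diff)
  qed
  have fin: "finsum A f F \<in> carrier A" using c by (intro finsum_closed') auto
  have "\<Phi> (finsum A f F) = finsum A (\<lambda>i. \<Phi> (f i)) F"
  proof -
    have "finsum A f F \<otimes> V = finsum A (\<lambda>i. f i \<otimes> V) F" using c by (intro mult_finsum_right) auto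
    then have "star A U \<otimes> (finsum A f F \<otimes> V) = finsum A (\<lambda>i. star A U \<otimes> (f i \<otimes> V)) F"
      using mult_finsum_left[of "star A U" "\<lambda>i. f i \<otimes> V" F] c by simp
    then have "(star A U \<otimes> (finsum A f F \<otimes> V)) \<otimes> t \<xi> = finsum A (\<lambda>i. (star A U \<otimes> (f i \<otimes> V)) \<otimes> t \<xi>) F"
      using mult_finsum_right[of "t \<xi>" "\<lambda>i. star A U \<otimes> (f i \<otimes> V)" F] c \<xi>(1) by simp
    then show ?thesis
      using mult_finsum_left[of "star A (t \<xi>)" "\<lambda>i. (star A U \<otimes> (f i \<otimes> V)) \<otimes> t \<xi>" F] c \<xi>(1)
      by (simp add: \<Phi>_def)
  qed
  also have "\<dots> = finsum A (\<lambda>i. if m = i then \<Phi> (f i) else \<zero>) F"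
    using \<Phi>_other \<Phi>_closed c by (intro M.finsum_cong') auto
  also have "\<dots> = \<Phi> (f m)" using \<Phi>_closed c by (intro M.finsum_singleton[OF m F(1)]) auto
  finally have "\<Phi> z \<ominus> r \<odot> t (src \<Lambda> \<xi>) \<in> I"
    using \<Phi>_ideal[OF z(2)] \<Phi>_diff[OF z(1) fin] \<Phi>_m by simp
  then have "cmod r \<le> nrm A (\<Phi> z)"
    using none[of "src \<Lambda> \<xi>"] t_projection[of "src \<Lambda> \<xi>"] \<xi>(1) z
    by (intro scalar_le_norm_if_projection_notin_ideal[OF I, of "t (src \<Lambda> \<xi>)"] \<Phi>_closed) auto
  also have "\<dots> \<le> nrm A (t \<xi>) * ((nrm A U * (nrm A z * nrm A V)) * nrm A (t \<xi>))"
  proof -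
    have "nrm A (\<Phi> z) \<le> nrm A (star A (t \<xi>)) * nrm A ((star A U \<otimes> (z \<otimes> V)) \<otimes> t \<xi>)"
      unfolding \<Phi>_def using c z \<xi>(1) by (intro norm_mult) auto
    also have "\<dots> \<le> nrm A (star A (t \<xi>)) * ((nrm A (star A U) * (nrm A z * nrm A V)) * nrm A (t \<xi>))"
      using c z \<xi>(1)
      by (intro mult_left_mono order_trans[OF norm_mult] mult_right_mono norm_mult) (auto simp:
          norm_nonneg)
    finally show ?thesis using c \<xi>(1) by simp
  qed
  also have "\<dots> \<le> 1 * ((nrm A U * (nrm A z * nrm A V)) * 1)"
    using c z \<xi>(1) by (intro mult_mono norm_t_le) (auto simp: norm_nonneg)
  finally have "cmod r \<le> (nrm A z * nrm A V) * nrm A U" by (simp add: mult_ac)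
  \<comment> \<open>The norm of \<open>t w\<close> must be exactly 1 here; \<open>t w\<close> is not
    zero because zero lies in \<open>I\<close>.\<close>
  moreover have "t w \<noteq> \<zero>" using none[OF w] submodule_zero[OF Id(1)] by auto
  then have "(nrm A U)\<^sup>2 = cmod r"
    using cstar_identity[OF c(1)] norm_projection[OF t_projection[OF w]] w by (simp add: r norm_smult)
  ultimately have "nrm A U * nrm A U \<le> (nrm A z * nrm A V) * nrm A U" by (simp add: power2_eq_square)
  then show "nrm A (f m \<otimes> V) \<le> nrm A z * nrm A V"
    using norm_nonneg[OF c(1)] norm_nonneg[OF c(2)] norm_nonneg[OF z(1)]
    by (cases "nrm A U = 0") (auto simp: U_def mult_le_cancel_right)
qed

lemma norm_W_le:
  assumes I: "closed_ideal A I" and none: "\<And>v. v \<in> vertices \<Lambda> \<Longrightarrow> t v \<notin> I"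
    and ap: "kgraph_aperiodic k \<Lambda>" and y: "y \<in> W L N" and z: "z \<in> carrier A" "z \<ominus> y \<in> I"
  shows "nrm A y \<le> real ((2 * L + 1) ^ k) * nrm A z"
proof -
  obtain f where f: "\<And>m. m \<in> deg_box k L N \<Longrightarrow> f m \<in> E m (const_deg k N)" "y = finsum A f (deg_box k L N)"
    using W_decompose[OF y] by blast
  have "nrm A (f m) \<le> nrm A z" if "m \<in> deg_box k L N" for m
    by (rule norm_component_le[OF I none ap deg_box(1) _ f(1) z(1) _ that])
      (use z(2) f(2) in \<open>auto simp: deg_box_def\<close>)
  then have "nrm A y \<le> real (card (deg_box k L N)) * nrm A z"
    unfolding f(2) using f(1) E_closed deg_box(1) by (intro norm_finsum) blast+
  also have "\<dots> \<le> real ((2 * L + 1) ^ k) * nrm A z"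
    using deg_box(2) norm_nonneg[OF z(1)] by (intro mult_right_mono of_nat_mono) auto
  finally show ?thesis .
qed

text \<open>The number of degrees occurring in the \<open>2 ^ j\<close>-th power of \<open>c\<^sup>* c\<close> grows polynomially in
  \<open>2 ^ j\<close>. So the crude estimate \<open>norm_W_le\<close> becomes sharp after taking roots. This replaces the
  gauge action and its faithful conditional expectation.\<close>

lemma norm_W_le_sharp:
  assumes I: "closed_ideal A I" and none: "\<And>v. v \<in> vertices \<Lambda> \<Longrightarrow> t v \<notin> I"
    and ap: "kgraph_aperiodic k \<Lambda>" and c: "c \<in> W L N" and z: "z \<in> carrier A" "z \<ominus> c \<in> I"
  shows "nrm A c \<le> nrm A z"
proof -
  note Id = closed_idealD[OF I]
  have cc: "c \<in> carrier A" using c by (rule W_closed)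
  define x where "x = star A c \<otimes> c"
  \<comment> \<open>\<open>y\<close> represents \<open>x\<close> modulo \<open>I\<close> and has
    norm at most \<open>nrm A c * nrm A z\<close>; \<open>x\<close> and \<open>y\<close> are squared
    in parallel.\<close>
  define y where "y = star A c \<otimes> z"
  have x: "x \<in> carrier A" "star A x = x" and y: "y \<in> carrier A"
    using cc z by (auto simp: x_def y_def star_mult)
  \<comment> \<open>Each squaring doubles the bandwidth. The level \<open>M\<close> may grow freely,
    since the bound in \<open>norm_W_le\<close> does not involve it.\<close>
  have x_W: "\<exists>M. (sq ^^ j) x \<in> W (2 ^ j * (2 * L)) M" for j
  proof (induction j)
    case 0
    have "x \<in> W (L + L) ((N + L) + N + L + L)" unfolding x_def by (rule W_mult[OF W_star[OF c] c])
    then show ?case by (auto simp: mult_2)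
  next
    case (Suc j)
    then obtain M where "(sq ^^ j) x \<in> W (2 ^ j * (2 * L)) M" by blast
    from W_mult[OF this this] show ?case unfolding sq_pow_Suc by (auto simp: mult_2 algebra_simps)
  qed
  have yx: "(sq ^^ j) y \<ominus> (sq ^^ j) x \<in> I" for j
  proof (induction j)
    case 0
    have "y \<ominus> x = star A c \<otimes> (z \<ominus> c)" using cc z by (simp add: x_def y_def mult_diff_left)
    then show ?case using Id(4)[OF z(2)] cc by simp
  next
    case (Suc j)
    let ?u = "(sq ^^ j) y" and ?v = "(sq ^^ j) x"
    have uv: "?u \<in> carrier A" "?v \<in> carrier A" using x y by auto
    have "?u \<otimes> ?u \<ominus> ?v \<otimes> ?v = ?u \<otimes> (?u \<ominus> ?v) \<oplus> (?u \<ominus> ?v) \<otimes> ?v"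
      using uv by (simp add: mult_diff_left mult_diff_right diff_add_diff)
    moreover have "?u \<otimes> (?u \<ominus> ?v) \<oplus> (?u \<ominus> ?v) \<otimes> ?v \<in> I"
      using Suc uv Id(4,5) by (intro submoduleE(5)[OF Id(1)]) auto
    ultimately show ?case unfolding sq_pow_Suc by simp
  qed
  \<comment> \<open>Bandwidth \<open>2 ^ j * (2 * L)\<close> allows at most
    \<open>(2 ^ j * (4 * L) + 1) ^ k\<close> components; \<open>K ^ Suc j\<close> dominates this
    number and has the form that \<open>le_of_power_two_powers\<close> accepts.\<close>
  define K where "K = real (2 * (4 * L + 1)) ^ k"
  have "nrm A x \<le> nrm A y"
  proof (rule le_of_power_two_powers[where K = K])
    fix j
    obtain M where M: "(sq ^^ j) x \<in> W (2 ^ j * (2 * L)) M" using x_W by blast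
    have "nrm A x ^ 2 ^ j = nrm A ((sq ^^ j) x)" using norm_sq_pow[OF x] by simp
    also have "\<dots> \<le> real ((2 * (2 ^ j * (2 * L)) + 1) ^ k) * nrm A ((sq ^^ j) y)"
      using y by (intro norm_W_le[OF I none ap M _ yx]) auto
    also have "\<dots> \<le> K ^ Suc j * nrm A y ^ 2 ^ j"
    proof (intro mult_mono norm_sq_pow_le[OF y])
      have "2 * (2 ^ j * (2 * L)) + 1 \<le> 2 ^ j * (4 * L + 1)" by (simp add: algebra_simps)
      also have "\<dots> \<le> 2 ^ Suc j * (4 * L + 1) ^ Suc j"
        by (intro mult_mono power_increasing self_le_power) auto
      also have "\<dots> = (2 * (4 * L + 1)) ^ Suc j" by (simp only: power_mult_distrib)
      finally have "(2 * (2 ^ j * (2 * L)) + 1) ^ k \<le> ((2 * (4 * L + 1)) ^ Suc j) ^ k" by (intro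
          power_mono) auto
      then have "real ((2 * (2 ^ j * (2 * L)) + 1) ^ k) \<le> real (((2 * (4 * L + 1)) ^ Suc j) ^ k)"
        by (rule of_nat_mono)
      also have "\<dots> = K ^ Suc j"
        unfolding K_def of_nat_power power_mult[symmetric] by (simp only: mult.commute)
      finally show "real ((2 * (2 ^ j * (2 * L)) + 1) ^ k) \<le> K ^ Suc j" .
    qed (use y in \<open>auto simp: norm_nonneg K_def\<close>)
    finally show "nrm A x ^ 2 ^ j \<le> K ^ Suc j * nrm A y ^ 2 ^ j" .
  qed (use x y norm_nonneg in auto)
  also have "nrm A y \<le> nrm A c * nrm A z" using norm_mult[of "star A c" z] cc z by (simp add: y_def)
  finally have "nrm A c * nrm A c \<le> nrm A z * nrm A c"
    using cstar_identity[OF cc] by (simp add: x_def power2_eq_square mult.commute)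
  then show ?thesis using norm_nonneg[OF cc] norm_nonneg[OF z(1)]
    by (cases "nrm A c = 0") (auto simp: mult_le_cancel_right)
qed

lemma simple_if_aperiodic_cofinal:
  assumes ap: "kgraph_aperiodic k \<Lambda>" and cof: "kgraph_cofinal k \<Lambda>"
    and gen: "closed_span A {t \<kappa> \<otimes> star A (t \<mu>) |\<kappa> \<mu>. \<kappa> \<in> paths \<Lambda> \<and> \<mu> \<in> paths \<Lambda>} = carrier A"
  shows "simple_cstar_algebra A"
  unfolding simple_cstar_algebra_def
proof (intro conjI allI impI)
  show "cstar_algebra A" by (rule cstar_algebra_axioms)
  let ?S = "{t \<kappa> \<otimes> star A (t \<mu>) |\<kappa> \<mu>. \<kappa> \<in> paths \<Lambda> \<and> \<mu> \<in> paths \<Lambda>}"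
  have S: "?S \<subseteq> carrier A" by auto
  have approx: "\<exists>c\<in>linear_span A ?S. nrm A (x \<ominus> c) < \<epsilon>" if "x \<in> carrier A" "\<epsilon> > 0" for x \<epsilon>
    using closed_span_iff[OF S, of x] gen that by blast
  fix I assume I: "closed_ideal A I"
  note Id = closed_idealD[OF I]
  show "I = {\<zero>} \<or> I = carrier A"
  proof (cases "\<exists>v\<in>vertices \<Lambda>. t v \<in> I")
    case True
    then obtain v where v: "v \<in> vertices \<Lambda>" "t v \<in> I" by blast
    \<comment> \<open>With \<open>t v\<close> the ideal contains
      \<open>t (src \<Lambda> \<mu>)\<close> for every path \<open>\<mu>\<close> with range
      \<open>v\<close>. Cofinality provides a degree \<open>n\<close> such that these sources
      include those of all paths of degree \<open>n\<close> at \<open>w\<close>, whose range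
      projections sum to \<open>t w\<close>.\<close>
    have vert: "t w \<in> I" if w: "w \<in> vertices \<Lambda>" for w
    proof -
      obtain n where n: "n \<in> Nk k" "\<And>\<kappa>. \<kappa> \<in> paths_at_deg \<Lambda> w n \<Longrightarrow> {\<mu> \<in> paths_at \<Lambda> v. src \<Lambda> \<mu> = src \<Lambda>
          \<kappa>} \<noteq> {}"
        using cof v(1) w unfolding kgraph_cofinal_def by blast
      have "t \<kappa> \<otimes> star A (t \<kappa>) \<in> I" if \<kappa>: "\<kappa> \<in> paths_at_deg \<Lambda> w n" for \<kappa>
      proof -
        have \<kappa>': "\<kappa> \<in> paths \<Lambda>" using \<kappa> by (auto simp: paths_at_deg_def paths_at_def)
        obtain \<mu> where \<mu>: "\<mu> \<in> paths \<Lambda>" "rng \<Lambda> \<mu> = v" "src \<Lambda> \<mu> = src \<Lambda> \<kappa>"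
          using n(2)[OF \<kappa>] by (auto simp: paths_at_def)
        have "star A (t \<mu>) \<otimes> (t v \<otimes> t \<mu>) \<in> I" using \<mu> v by (intro Id(4,5)) auto
        then have "t (src \<Lambda> \<kappa>) \<in> I" using \<mu> t_rng[OF \<mu>(1)] t_star_mult[OF \<mu>(1)] by simp
        then have "(t \<kappa> \<otimes> t (src \<Lambda> \<kappa>)) \<otimes> star A (t \<kappa>) \<in> I" using \<kappa>' by (intro Id(4,5)) auto
        then show ?thesis using \<kappa>' by simp
      qed
      then show ?thesis unfolding t_sum[OF w n(1)] by (rule submodule_finsum[OF Id(1)])
    qed
    have "?S \<subseteq> I"
    proof
      fix x assume "x \<in> ?S"
      then obtain \<kappa> \<mu> where x: "\<kappa> \<in> paths \<Lambda>" "\<mu> \<in> paths \<Lambda>" "x = t \<kappa> \<otimes> star A (t \<mu>)" by blast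
      have "(t (rng \<Lambda> \<kappa>) \<otimes> t \<kappa>) \<otimes> star A (t \<mu>) \<in> I" using x vert[of "rng \<Lambda> \<kappa>"] by (intro Id(5)) auto
      then show "x \<in> I" using x by simp
    qed
    then have "linear_span A ?S \<subseteq> I" by (rule linear_span_le_submodule[OF Id(1)])
    then have "x \<in> I" if "x \<in> carrier A" for x
      using approx[OF that] by (intro closedin_approx[OF Id(2) that]) blast
    then show ?thesis using Id(3) by blast
  next
    case False
    have "x = \<zero>" if x: "x \<in> I" for x
    proof (rule eq_zero_if_norm_le_all[where K = 2])
      show xc: "x \<in> carrier A" using x Id(3) by blast
      fix \<epsilon> :: real assume "\<epsilon> > 0"
      then obtain c where c: "c \<in> linear_span A ?S" "nrm A (x \<ominus> c) < \<epsilon>" using approx[OF xc] by blast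
      obtain L N where LN: "c \<in> W L N" using span_in_W[OF c(1)] by blast
      have cc: "c \<in> carrier A" using LN by (rule W_closed)
      \<comment> \<open>\<open>c \<ominus> x\<close> represents \<open>c\<close> modulo
        \<open>I\<close> and is small, so the sharp estimate makes \<open>c\<close> small, and with
        it \<open>x\<close>.\<close>
      have "(c \<ominus> x) \<ominus> c = (-1) \<odot> x"
        using xc cc by (simp add: diff_eq_scale M.a_ac)
          (simp add: M.a_assoc[symmetric] M.r_neg flip: neg_eq_scale)
      then have "(c \<ominus> x) \<ominus> c \<in> I" using submodule_scale[OF Id(1) x] by simp
      then have "nrm A c \<le> nrm A (c \<ominus> x)"
        using False xc cc by (intro norm_W_le_sharp[OF I _ ap LN]) auto
      then have "nrm A c \<le> nrm A (x \<ominus> c)" using norm_diff_commute[OF xc cc] by simp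
      then show "nrm A x \<le> 2 * \<epsilon>" using norm_le_add_diff[OF xc cc] c(2) by linarith
    qed
    then show ?thesis using submodule_zero[OF Id(1)] by blast
  qed
qed

end

section \<open>Deformed graph bundles\<close>

context cstar_algebra
begin

lemma cstar_subalgebra_closed_span:
  assumes S: "S \<subseteq> carrier A"
    and mult: "\<And>x y. x \<in> linear_span A S \<Longrightarrow> y \<in> linear_span A S \<Longrightarrow> x \<otimes> y \<in> linear_span A S"
    and star: "\<And>x. x \<in> linear_span A S \<Longrightarrow> star A x \<in> linear_span A S"
  shows "cstar_subalgebra A (closed_span A S)"
  unfolding cstar_subalgebra_def
proof (intro conjI ballI submodule_closed_span[OF S] closedin_closed_span)
  note lc = linear_span_closed[OF _ S]
  fix x assume x: "x \<in> closed_span A S"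
  then have xc: "x \<in> carrier A" by (simp add: closed_span_iff[OF S])
  show "star A x \<in> closed_span A S"
    unfolding closed_span_iff[OF S]
  proof (intro conjI allI impI)
    fix \<epsilon> :: real assume "\<epsilon> > 0"
    then obtain x' where x': "x' \<in> linear_span A S" "nrm A (x \<ominus> x') < \<epsilon>" using x by (auto simp:
        closed_span_iff[OF S])
    then have "nrm A (star A x \<ominus> star A x') < \<epsilon>" using xc lc[OF x'(1)] by (simp flip: star_diff)
    then show "\<exists>y\<in>linear_span A S. nrm A (star A x \<ominus> y) < \<epsilon>" using star[OF x'(1)] by blast
  qed (use xc in simp)
  fix y assume y: "y \<in> closed_span A S"
  then have yc: "y \<in> carrier A" by (simp add: closed_span_iff[OF S])
  show "x \<otimes> y \<in> closed_span A S"
    unfolding closed_span_iff[OF S]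
  proof (intro conjI allI impI)
    fix \<epsilon> :: real assume \<epsilon>: "\<epsilon> > 0"
    \<comment> \<open>\<open>y'\<close> is chosen before \<open>x'\<close> because the tolerance for
      \<open>x'\<close> depends on the norm of \<open>y'\<close>. Adding 1 in \<open>K\<close> and
      \<open>M\<close> keeps the divisors positive.\<close>
    define K where "K = nrm A x + 1"
    have K: "K > 0" using norm_nonneg[OF xc] by (simp add: K_def)
    obtain y' where y': "y' \<in> linear_span A S" "nrm A (y \<ominus> y') < \<epsilon> / (2 * K)"
      using y divide_pos_pos[OF \<epsilon>, of "2 * K"] K unfolding closed_span_iff[OF S] by auto
    define M where "M = nrm A y' + 1"
    have y'c: "y' \<in> carrier A" using lc[OF y'(1)] .
    have M: "M > 0" using norm_nonneg[OF y'c] by (simp add: M_def)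
    obtain x' where x': "x' \<in> linear_span A S" "nrm A (x \<ominus> x') < \<epsilon> / (2 * M)"
      using x divide_pos_pos[OF \<epsilon>, of "2 * M"] M unfolding closed_span_iff[OF S] by auto
    have x'c: "x' \<in> carrier A" using lc[OF x'(1)] .
    have "x \<otimes> y \<ominus> x' \<otimes> y' = x \<otimes> (y \<ominus> y') \<oplus> (x \<ominus> x') \<otimes> y'"
      using xc yc x'c y'c by (simp add: mult_diff_left mult_diff_right diff_add_diff)
    then have "nrm A (x \<otimes> y \<ominus> x' \<otimes> y') \<le> nrm A x * nrm A (y \<ominus> y') + nrm A (x \<ominus> x') * nrm A y'"
      using xc yc x'c y'c by (auto intro!: order_trans[OF norm_triangle] add_mono norm_mult)
    also have "\<dots> \<le> K * nrm A (y \<ominus> y') + nrm A (x \<ominus> x') * M"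
      using xc yc x'c y'c by (intro add_mono mult_mono) (auto simp: K_def M_def norm_nonneg)
    also have "\<dots> < \<epsilon>"
    proof -
      have "K * nrm A (y \<ominus> y') < \<epsilon> / 2" using y'(2) K by (simp add: field_simps)
      moreover have "nrm A (x \<ominus> x') * M < \<epsilon> / 2" using x'(2) M by (simp add: field_simps)
      ultimately show ?thesis by linarith
    qed
    finally show "\<exists>z\<in>linear_span A S. nrm A (x \<otimes> y \<ominus> z) < \<epsilon>" using mult[OF x'(1) y'(1)] by blast
  qed (use xc yc in simp)
qed

end

context twisted_family
begin

lemma cstar_subalgebra_span:
  "cstar_subalgebra A (closed_span A {t \<kappa> \<otimes> star A (t \<mu>) |\<kappa> \<mu>. \<kappa> \<in> paths \<Lambda> \<and> \<mu> \<in> paths \<Lambda>})"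
    (is "cstar_subalgebra A (closed_span A ?S)")
proof (rule cstar_subalgebra_closed_span)
  have W: "W L N \<subseteq> linear_span A ?S" for L N
    unfolding W_def by (intro linear_span_mono) (auto simp: gens_def)
  show "star A x \<in> linear_span A ?S" if x: "x \<in> linear_span A ?S" for x
    using span_in_W[OF x] W_star W by blast
  show "x \<otimes> y \<in> linear_span A ?S" if xy: "x \<in> linear_span A ?S" "y \<in> linear_span A ?S" for x y
    using span_in_W[OF xy(1)] span_in_W[OF xy(2)] W_mult W by blast
qed auto

end

section \<open>The generators in a representation of the deformed bundle\<close>

locale deformed_graph_bundle_rep =
  A: cstar_algebra A + C: cstar_algebra C + k_graph k \<Lambda> + G: group G
  for A :: "'a cstar" and C :: "'c cstar" and k and \<Lambda> :: "'l kgraph" and G :: "('g, 'm) monoid_scheme" +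
  fixes s :: "'l \<Rightarrow> 'a" and \<eta> :: "'l \<Rightarrow> 'g" and \<sigma> :: "'g \<Rightarrow> 'g \<Rightarrow> complex" and \<pi> :: "'a \<times> 'g \<Rightarrow> 'c"
  assumes row_finite: "row_finite_no_sources k \<Lambda>" and ck: "cuntz_krieger_family k \<Lambda> A s"
    and eta_functor: "kgraph_functor \<Lambda> G \<eta>" and cocycle: "\<sigma> \<in> cocycles G"
    and fell: "fell_bundle G (graph_bundle \<Lambda> G \<eta> A s)"
    and rep: "fell_representation G (deformed_bundle G \<sigma> (graph_bundle \<Lambda> G \<eta> A s)) C \<pi>"
begin

abbreviation Bf :: "'g \<Rightarrow> 'a set" where "Bf \<equiv> graph_fibre \<Lambda> G \<eta> A s"

abbreviation fibre_gens :: "'g \<Rightarrow> 'a set" where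
  "fibre_gens g \<equiv> {s \<kappa> \<otimes>\<^bsub>A\<^esub> star A (s \<mu>) |\<kappa> \<mu>.
     \<kappa> \<in> paths \<Lambda> \<and> \<mu> \<in> paths \<Lambda> \<and> \<eta> \<kappa> \<otimes>\<^bsub>G\<^esub> inv\<^bsub>G\<^esub> (\<eta> \<mu>) = g}"

lemma s_closed [simp]: "\<kappa> \<in> paths \<Lambda> \<Longrightarrow> s \<kappa> \<in> carrier A"
  using ck by (auto simp: cuntz_krieger_family_def)

lemma s_vertex: "v \<in> vertices \<Lambda> \<Longrightarrow> s v \<otimes>\<^bsub>A\<^esub> s v = s v" "v \<in> vertices \<Lambda> \<Longrightarrow> star A (s v) = s v"
  using conjunct1[OF conjunct2[OF ck[unfolded cuntz_krieger_family_def]]] by simp_all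

lemma s_vertices_orth: "v \<in> vertices \<Lambda> \<Longrightarrow> w \<in> vertices \<Lambda> \<Longrightarrow> v \<noteq> w \<Longrightarrow> s v \<otimes>\<^bsub>A\<^esub> s w = \<zero>\<^bsub>A\<^esub>"
  using ck[unfolded cuntz_krieger_family_def, THEN conjunct2, THEN conjunct2, THEN conjunct1] by simp

lemma s_mult: "\<kappa> \<in> paths \<Lambda> \<Longrightarrow> \<mu> \<in> paths \<Lambda> \<Longrightarrow> src \<Lambda> \<kappa> = rng \<Lambda> \<mu> \<Longrightarrow> s \<kappa> \<otimes>\<^bsub>A\<^esub> s \<mu> = s (pcomp \<Lambda> \<kappa> \<mu>)"
  using ck[unfolded cuntz_krieger_family_def, THEN conjunct2, THEN conjunct2, THEN conjunct2, THEN
      conjunct1] by simp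

lemma s_star_mult: "\<kappa> \<in> paths \<Lambda> \<Longrightarrow> star A (s \<kappa>) \<otimes>\<^bsub>A\<^esub> s \<kappa> = s (src \<Lambda> \<kappa>)"
  using ck[unfolded cuntz_krieger_family_def, THEN conjunct2, THEN conjunct2, THEN conjunct2, THEN
      conjunct2,
      THEN conjunct1] by simp

lemma s_sum: "v \<in> vertices \<Lambda> \<Longrightarrow> n \<in> Nk k
      \<Longrightarrow> s v = finsum A (\<lambda>\<kappa>. s \<kappa> \<otimes>\<^bsub>A\<^esub> star A (s \<kappa>)) (paths_at_deg \<Lambda> v n)"
  by (rule ck[unfolded cuntz_krieger_family_def, THEN conjunct2, THEN conjunct2, THEN conjunct2,
      THEN conjunct2,
      THEN conjunct2, rule_format])

lemma \<eta>_closed [simp]: "\<kappa> \<in> paths \<Lambda> \<Longrightarrow> \<eta> \<kappa> \<in> carrier G"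
  using eta_functor by (auto simp: kgraph_functor_def)

lemma \<eta>_pcomp: "\<kappa> \<in> paths \<Lambda> \<Longrightarrow> \<mu> \<in> paths \<Lambda> \<Longrightarrow> src \<Lambda> \<kappa> = rng \<Lambda> \<mu> \<Longrightarrow> \<eta> (pcomp \<Lambda> \<kappa> \<mu>) = \<eta> \<kappa> \<otimes>\<^bsub>G\<^esub> \<eta> \<mu>"
  and \<eta>_vertex [simp]: "v \<in> vertices \<Lambda> \<Longrightarrow> \<eta> v = \<one>\<^bsub>G\<^esub>"
  using eta_functor by (auto simp: kgraph_functor_def)

lemma \<sigma>_norm: "g \<in> carrier G \<Longrightarrow> h \<in> carrier G \<Longrightarrow> cmod (\<sigma> g h) = 1"
  and \<sigma>_one [simp]: "g \<in> carrier G \<Longrightarrow> \<sigma> \<one>\<^bsub>G\<^esub> g = 1" "g \<in> carrier G \<Longrightarrow> \<sigma> g \<one>\<^bsub>G\<^esub> = 1"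
  using cocycle by (auto simp: cocycles_def)

text \<open>The cocycle identity at \<open>g\<close>, its inverse and \<open>g\<close>. It makes the
  scalars of the deformed product and involution match in \<open>\<pi>_star_mult\<close>.\<close>

lemma \<sigma>_inv: assumes "g \<in> carrier G" shows "\<sigma> (inv\<^bsub>G\<^esub> g) g = \<sigma> g (inv\<^bsub>G\<^esub> g)"
proof -
  have "\<forall>g\<in>carrier G. \<forall>h\<in>carrier G. \<forall>l\<in>carrier G.
      \<sigma> g h * \<sigma> (g \<otimes>\<^bsub>G\<^esub> h) l = \<sigma> g (h \<otimes>\<^bsub>G\<^esub> l) * \<sigma> h l"
    using cocycle unfolding cocycles_def mem_Collect_eq by (elim conjE)
  from this[rule_format, of g "inv\<^bsub>G\<^esub> g" g] show ?thesis using assms by simp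
qed

lemma \<sigma>_cnj: "g \<in> carrier G \<Longrightarrow> h \<in> carrier G \<Longrightarrow> cnj (\<sigma> g h) * \<sigma> g h = 1"
  using \<sigma>_norm[of g h] by (simp add: complex_norm_square[symmetric] mult.commute)

lemma gens_subset: "fibre_gens g \<subseteq> carrier A" by auto

lemma Bf_submodule: "submodule (Bf g) complex_ring A"
  unfolding graph_fibre_def by (rule A.submodule_closed_span[OF gens_subset])

lemma Bf_closed: "a \<in> Bf g \<Longrightarrow> a \<in> carrier A"
  using A.submoduleE(1)[OF Bf_submodule] by blast

lemma Bf_closedin: "closedin (norm_topology A) (Bf g)"
  unfolding graph_fibre_def by (rule A.closedin_closed_span)

lemma span_subset_Bf: "linear_span A (fibre_gens g) \<subseteq> Bf g"
  unfolding graph_fibre_def by (rule A.linear_span_subset_closed_span[OF gens_subset])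

lemma Bf_mult: "a \<in> Bf g \<Longrightarrow> b \<in> Bf h \<Longrightarrow> g \<in> carrier G \<Longrightarrow> h \<in> carrier G \<Longrightarrow> a \<otimes>\<^bsub>A\<^esub> b \<in> Bf (g \<otimes>\<^bsub>G\<^esub> h)"
  using fell_bundle.fmult_closed[OF fell, of "(a, g)" "(b, h)"] by (simp add: graph_bundle_def)

lemma Bf_star: "a \<in> Bf g \<Longrightarrow> g \<in> carrier G \<Longrightarrow> star A a \<in> Bf (inv\<^bsub>G\<^esub> g)"
  using fell_bundle.fstar_closed[OF fell, of "(a, g)"] by (simp add: graph_bundle_def)

lemma Bf_star_mult: "a \<in> Bf g \<Longrightarrow> g \<in> carrier G \<Longrightarrow> star A a \<otimes>\<^bsub>A\<^esub> a \<in> Bf \<one>\<^bsub>G\<^esub>"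
  using Bf_mult[OF Bf_star, of a g a g] by simp

lemma \<pi>_closed: "a \<in> Bf g \<Longrightarrow> g \<in> carrier G \<Longrightarrow> \<pi> (a, g) \<in> carrier C"
  using rep by (auto simp: fell_representation_def deformed_bundle_def graph_bundle_def)

lemma \<pi>_add: "a \<in> Bf g \<Longrightarrow> b \<in> Bf g \<Longrightarrow> g \<in> carrier G \<Longrightarrow> \<pi> (a \<oplus>\<^bsub>A\<^esub> b, g) = \<pi> (a, g) \<oplus>\<^bsub>C\<^esub> \<pi> (b, g)"
  using rep by (force simp: fell_representation_def deformed_bundle_def graph_bundle_def)

lemma \<pi>_scale: "a \<in> Bf g \<Longrightarrow> g \<in> carrier G \<Longrightarrow> \<pi> (z \<odot>\<^bsub>A\<^esub> a, g) = z \<odot>\<^bsub>C\<^esub> \<pi> (a, g)"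
  using rep by (force simp: fell_representation_def deformed_bundle_def graph_bundle_def)

lemma \<pi>_mult:
  assumes "a \<in> Bf g" "b \<in> Bf h" "g \<in> carrier G" "h \<in> carrier G"
  shows "\<pi> (a, g) \<otimes>\<^bsub>C\<^esub> \<pi> (b, h) = \<sigma> g h \<odot>\<^bsub>C\<^esub> \<pi> (a \<otimes>\<^bsub>A\<^esub> b, g \<otimes>\<^bsub>G\<^esub> h)"
proof -
  have "\<pi> (\<sigma> g h \<odot>\<^bsub>A\<^esub> (a \<otimes>\<^bsub>A\<^esub> b), g \<otimes>\<^bsub>G\<^esub> h) = \<pi> (a, g) \<otimes>\<^bsub>C\<^esub> \<pi> (b, h)"
    using rep assms by (force simp: fell_representation_def deformed_bundle_def graph_bundle_def)
  then show ?thesis using \<pi>_scale[OF Bf_mult[OF assms]] assms by simp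
qed

lemma \<pi>_star:
  assumes "a \<in> Bf g" "g \<in> carrier G"
  shows "star C (\<pi> (a, g)) = cnj (\<sigma> g (inv\<^bsub>G\<^esub> g)) \<odot>\<^bsub>C\<^esub> \<pi> (star A a, inv\<^bsub>G\<^esub> g)"
proof -
  have "\<pi> (cnj (\<sigma> g (inv\<^bsub>G\<^esub> g)) \<odot>\<^bsub>A\<^esub> star A a, inv\<^bsub>G\<^esub> g) = star C (\<pi> (a, g))"
    using rep assms by (force simp: fell_representation_def deformed_bundle_def graph_bundle_def)
  then show ?thesis using \<pi>_scale[OF Bf_star[OF assms]] assms by simp
qed

lemma \<pi>_zero: "g \<in> carrier G \<Longrightarrow> \<pi> (\<zero>\<^bsub>A\<^esub>, g) = \<zero>\<^bsub>C\<^esub>"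
  using \<pi>_scale[of "\<zero>\<^bsub>A\<^esub>" g 0] \<pi>_closed[of "\<zero>\<^bsub>A\<^esub>" g] A.submodule_zero[OF Bf_submodule] by simp

text \<open>The deformed involution contributes the conjugate of the scalar that the deformed
  product contributes, so both products land in the fibre over the identity without a twist.\<close>

lemma \<pi>_star_mult:
  assumes "a \<in> Bf g" "b \<in> Bf g" "g \<in> carrier G"
  shows "star C (\<pi> (a, g)) \<otimes>\<^bsub>C\<^esub> \<pi> (b, g) = \<pi> (star A a \<otimes>\<^bsub>A\<^esub> b, \<one>\<^bsub>G\<^esub>)"
    and "\<pi> (a, g) \<otimes>\<^bsub>C\<^esub> star C (\<pi> (b, g)) = \<pi> (a \<otimes>\<^bsub>A\<^esub> star A b, \<one>\<^bsub>G\<^esub>)"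
proof -
  have i: "inv\<^bsub>G\<^esub> g \<in> carrier G" using assms by simp
  note st = Bf_star[OF assms(1,3)] Bf_star[OF assms(2,3)]
  have c: "star A a \<otimes>\<^bsub>A\<^esub> b \<in> Bf \<one>\<^bsub>G\<^esub>" "a \<otimes>\<^bsub>A\<^esub> star A b \<in> Bf \<one>\<^bsub>G\<^esub>"
    using Bf_mult[OF st(1) assms(2) i assms(3)] Bf_mult[OF assms(1) st(2) assms(3) i] assms by auto
  show "star C (\<pi> (a, g)) \<otimes>\<^bsub>C\<^esub> \<pi> (b, g) = \<pi> (star A a \<otimes>\<^bsub>A\<^esub> b, \<one>\<^bsub>G\<^esub>)"
    using \<pi>_star[OF assms(1,3)] \<pi>_mult[OF st(1) assms(2) i assms(3)] \<pi>_closed[OF st(1) i]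
        \<pi>_closed[OF assms(2,3)]
      \<pi>_closed[OF c(1)] assms(3) \<sigma>_cnj[OF assms(3) i]
    by (simp add: C.mult_smult_left \<sigma>_inv)
  show "\<pi> (a, g) \<otimes>\<^bsub>C\<^esub> star C (\<pi> (b, g)) = \<pi> (a \<otimes>\<^bsub>A\<^esub> star A b, \<one>\<^bsub>G\<^esub>)"
    using \<pi>_star[OF assms(2,3)] \<pi>_mult[OF assms(1) st(2) assms(3) i] \<pi>_closed[OF st(2) i]
        \<pi>_closed[OF assms(1,3)]
      \<pi>_closed[OF c(2)] assms(3) \<sigma>_cnj[OF assms(3) i]
    by (simp add: C.mult_smult_right)
qed

text \<open>The source vertex serves as the second path of a generator, and \<open>\<eta>\<close> is
  trivial on it.\<close>

lemma s_in_Bf: assumes "\<kappa> \<in> paths \<Lambda>" shows "s \<kappa> \<in> Bf (\<eta> \<kappa>)"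
proof -
  have "s \<kappa> = s \<kappa> \<otimes>\<^bsub>A\<^esub> star A (s (src \<Lambda> \<kappa>))"
    using s_mult[of \<kappa> "src \<Lambda> \<kappa>"] s_vertex(2)[of "src \<Lambda> \<kappa>"] assms by simp
  moreover have "\<eta> \<kappa> \<otimes>\<^bsub>G\<^esub> inv\<^bsub>G\<^esub> (\<eta> (src \<Lambda> \<kappa>)) = \<eta> \<kappa>" using assms by simp
  ultimately have "s \<kappa> \<in> fibre_gens (\<eta> \<kappa>)" using assms src_closed by blast
  then show ?thesis by (rule subsetD[OF span_subset_Bf linear_span.base])
qed

definition t :: "'l \<Rightarrow> 'c" where "t \<kappa> = \<pi> (s \<kappa>, \<eta> \<kappa>)"

lemma t_mult_t:
  "\<kappa> \<in> paths \<Lambda> \<Longrightarrow> \<mu> \<in> paths \<Lambda> \<Longrightarrow> t \<kappa> \<otimes>\<^bsub>C\<^esub> t \<mu> = \<sigma> (\<eta> \<kappa>) (\<eta> \<mu>) \<odot>\<^bsub>C\<^esub> \<pi> (s \<kappa> \<otimes>\<^bsub>A\<^esub> s \<mu>, \<eta> \<kappa> \<otimes>\<^bsub>G\<^esub> \<eta> \<mu>)"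
  unfolding t_def by (rule \<pi>_mult) (simp_all add: s_in_Bf)

lemma t_vertex_mult:
  "v \<in> vertices \<Lambda> \<Longrightarrow> w \<in> vertices \<Lambda> \<Longrightarrow> t v \<otimes>\<^bsub>C\<^esub> t w = \<pi> (s v \<otimes>\<^bsub>A\<^esub> s w, \<one>\<^bsub>G\<^esub>)"
  using t_mult_t[of v w] \<pi>_closed[OF Bf_mult[OF s_in_Bf s_in_Bf], of v w] by simp

lemma \<pi>_finsum:
  assumes "finite S" "\<And>i. i \<in> S \<Longrightarrow> f i \<in> Bf g" "g \<in> carrier G"
  shows "\<pi> (finsum A f S, g) = finsum C (\<lambda>i. \<pi> (f i, g)) S"
  using assms(1,2)
proof (induction S)
  case empty
  then show ?case using \<pi>_zero assms(3) by simp
next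
  case (insert i S)
  have "finsum A f S \<in> Bf g" using insert by (intro A.submodule_finsum[OF Bf_submodule]) auto
  moreover have "f \<in> S \<rightarrow> carrier A" "f i \<in> carrier A" using insert Bf_closed by auto
  moreover have "(\<lambda>i. \<pi> (f i, g)) \<in> S \<rightarrow> carrier C" "\<pi> (f i, g) \<in> carrier C"
    using insert \<pi>_closed assms(3) by auto
  ultimately show ?case using insert assms(3) by (simp add: \<pi>_add)
qed

text \<open>The relations between an element and an adjoint are untwisted by
  \<open>\<pi>_star_mult\<close>, and those between vertices because \<open>\<sigma>\<close> is
  normalised; only the composition of paths picks up a value of \<open>\<sigma>\<close>.\<close>

lemma twisted: "twisted_family C k \<Lambda> t"
proof
  show "row_finite_no_sources k \<Lambda>" by (rule row_finite)
next
  fix \<kappa> assume "\<kappa> \<in> paths \<Lambda>"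
  then show "t \<kappa> \<in> carrier C" unfolding t_def by (intro \<pi>_closed s_in_Bf) simp_all
next
  fix v assume v: "v \<in> vertices \<Lambda>"
  then have sv: "s v \<in> Bf \<one>\<^bsub>G\<^esub>" using s_in_Bf[of v] by simp
  show "C.projection (t v)"
    unfolding C.projection_def
  proof (intro conjI)
    show "t v \<in> carrier C" using \<pi>_closed[OF sv] v by (simp add: t_def)
    show "t v \<otimes>\<^bsub>C\<^esub> t v = t v" using t_vertex_mult[OF v v] v s_vertex[OF v] by (simp add: t_def)
    show "star C (t v) = t v"
      using \<pi>_star[OF sv] v s_vertex[OF v] \<pi>_closed[OF sv] by (simp add: t_def)
  qed
next
  fix v w assume "v \<in> vertices \<Lambda>" "w \<in> vertices \<Lambda>" "v \<noteq> w"
  then show "t v \<otimes>\<^bsub>C\<^esub> t w = \<zero>\<^bsub>C\<^esub>"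
    using t_vertex_mult s_vertices_orth \<pi>_zero by simp
next
  fix \<kappa> \<mu> assume "\<kappa> \<in> paths \<Lambda>" "\<mu> \<in> paths \<Lambda>" "src \<Lambda> \<kappa> = rng \<Lambda> \<mu>"
  then show "\<exists>z. cmod z = 1 \<and> t \<kappa> \<otimes>\<^bsub>C\<^esub> t \<mu> = z \<odot>\<^bsub>C\<^esub> t (pcomp \<Lambda> \<kappa> \<mu>)"
    using t_mult_t[of \<kappa> \<mu>] \<sigma>_norm[of "\<eta> \<kappa>" "\<eta> \<mu>"] by (auto simp: s_mult \<eta>_pcomp t_def)
next
  fix \<kappa> assume "\<kappa> \<in> paths \<Lambda>"
  then show "star C (t \<kappa>) \<otimes>\<^bsub>C\<^esub> t \<kappa> = t (src \<Lambda> \<kappa>)"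
    using \<pi>_star_mult(1)[OF s_in_Bf s_in_Bf, of \<kappa>] by (simp add: t_def s_star_mult)
next
  fix v n assume v: "v \<in> vertices \<Lambda>" and n: "n \<in> Nk k"
  let ?S = "paths_at_deg \<Lambda> v n"
  have fin: "finite ?S" using row_finite v n by (auto simp: row_finite_no_sources_def)
  have S: "\<kappa> \<in> paths \<Lambda>" if "\<kappa> \<in> ?S" for \<kappa> using that by (auto simp: paths_at_deg_def paths_at_def)
  have eq: "t \<kappa> \<otimes>\<^bsub>C\<^esub> star C (t \<kappa>) = \<pi> (s \<kappa> \<otimes>\<^bsub>A\<^esub> star A (s \<kappa>), \<one>\<^bsub>G\<^esub>)" if "\<kappa> \<in> ?S" for \<kappa>
    unfolding t_def by (rule \<pi>_star_mult(2)) (use S[OF that] s_in_Bf in auto)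
  have B1: "s \<kappa> \<otimes>\<^bsub>A\<^esub> star A (s \<kappa>) \<in> Bf \<one>\<^bsub>G\<^esub>" if "\<kappa> \<in> ?S" for \<kappa>
    using Bf_mult[OF s_in_Bf Bf_star[OF s_in_Bf], of \<kappa> \<kappa>] S[OF that] by simp
  have "t v = \<pi> (finsum A (\<lambda>\<kappa>. s \<kappa> \<otimes>\<^bsub>A\<^esub> star A (s \<kappa>)) ?S, \<one>\<^bsub>G\<^esub>)"
    using v s_sum[OF v n] by (simp add: t_def)
  also have "\<dots> = finsum C (\<lambda>\<kappa>. \<pi> (s \<kappa> \<otimes>\<^bsub>A\<^esub> star A (s \<kappa>), \<one>\<^bsub>G\<^esub>)) ?S"
    using fin B1 by (intro \<pi>_finsum) auto
  also have "\<dots> = finsum C (\<lambda>\<kappa>. t \<kappa> \<otimes>\<^bsub>C\<^esub> star C (t \<kappa>)) ?S"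
    using eq B1 \<pi>_closed by (intro C.M.finsum_cong') auto
  finally show "t v = finsum C (\<lambda>\<kappa>. t \<kappa> \<otimes>\<^bsub>C\<^esub> star C (t \<kappa>)) ?S" .
qed

section \<open>Continuity of the representation and density\<close>

lemma \<pi>_diff:
  assumes "a \<in> Bf g" "b \<in> Bf g" "g \<in> carrier G"
  shows "\<pi> (a \<ominus>\<^bsub>A\<^esub> b, g) = \<pi> (a, g) \<ominus>\<^bsub>C\<^esub> \<pi> (b, g)"
  using \<pi>_add[OF assms(1) A.submodule_scale[OF Bf_submodule assms(2), of "-1"] assms(3)]
    \<pi>_scale[OF assms(2,3), of "-1"] \<pi>_closed assms Bf_closed[of _ g]
  by (simp add: A.diff_eq_scale C.diff_eq_scale)

lemma norm_\<pi>_le: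
  assumes a: "a \<in> Bf g" and g: "g \<in> carrier G" shows "nrm C (\<pi> (a, g)) \<le> 2 * nrm A a"
proof -
  have ac: "a \<in> carrier A" using a by (rule Bf_closed)
  have sub: "cstar_subalgebra A (Bf \<one>\<^bsub>G\<^esub>)"
    unfolding cstar_subalgebra_def
    using Bf_submodule Bf_closedin Bf_mult[of _ "\<one>\<^bsub>G\<^esub>" _ "\<one>\<^bsub>G\<^esub>"] Bf_star[of _ "\<one>\<^bsub>G\<^esub>"] by auto
  have "nrm C (\<pi> (star A a \<otimes>\<^bsub>A\<^esub> a, \<one>\<^bsub>G\<^esub>)) \<le> 2 * nrm A (star A a \<otimes>\<^bsub>A\<^esub> a)"
  proof (rule star_hom_bounded[OF A.cstar_algebra_axioms C.cstar_algebra_axioms sub, where \<phi> = "\<lambda>x.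
      \<pi> (x, \<one>\<^bsub>G\<^esub>)"])
    fix x y assume xy: "x \<in> Bf \<one>\<^bsub>G\<^esub>" "y \<in> Bf \<one>\<^bsub>G\<^esub>"
    show "\<pi> (x \<otimes>\<^bsub>A\<^esub> y, \<one>\<^bsub>G\<^esub>) = \<pi> (x, \<one>\<^bsub>G\<^esub>) \<otimes>\<^bsub>C\<^esub> \<pi> (y, \<one>\<^bsub>G\<^esub>)"
      using \<pi>_mult[OF xy] \<pi>_closed[OF Bf_mult[OF xy]] by simp
  next
    fix x assume x: "x \<in> Bf \<one>\<^bsub>G\<^esub>"
    show "\<pi> (star A x, \<one>\<^bsub>G\<^esub>) = star C (\<pi> (x, \<one>\<^bsub>G\<^esub>))"
      using \<pi>_star[OF x] \<pi>_closed[OF Bf_star[OF x]] by simp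
  qed (use ac a g in \<open>auto simp: \<pi>_closed \<pi>_add \<pi>_scale Bf_star_mult A.star_mult\<close>)
  also have "\<dots> = 2 * (nrm A a)\<^sup>2" using A.cstar_identity[OF ac] by simp
  also have "\<dots> \<le> (2 * nrm A a)\<^sup>2" by (simp add: power_mult_distrib)
  finally have "(nrm C (\<pi> (a, g)))\<^sup>2 \<le> (2 * nrm A a)\<^sup>2"
    using \<pi>_star_mult(1)[OF a a g] C.cstar_identity[OF \<pi>_closed[OF a g]] by simp
  then show ?thesis by (rule power2_le_imp_le) (use A.norm_nonneg[OF ac] in simp)
qed

lemma \<pi>_in_closed_span:
  assumes a: "a \<in> Bf g" and g: "g \<in> carrier G"
  shows "\<pi> (a, g) \<in> closed_span C {t \<kappa> \<otimes>\<^bsub>C\<^esub> star C (t \<mu>) |\<kappa> \<mu>. \<kappa> \<in> paths \<Lambda> \<and> \<mu> \<in> paths \<Lambda>}"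
    (is "_ \<in> closed_span C ?S")
proof -
  have S: "?S \<subseteq> carrier C" using \<pi>_closed[OF s_in_Bf] by (auto simp: t_def)
  have span: "\<pi> (b, g) \<in> linear_span C ?S" if "b \<in> linear_span A (fibre_gens g)" for b
    using that
  proof (induction rule: linear_span.induct)
    case (base b)
    then obtain \<kappa> \<mu> where *: "\<kappa> \<in> paths \<Lambda>" "\<mu> \<in> paths \<Lambda>" "g = \<eta> \<kappa> \<otimes>\<^bsub>G\<^esub> inv\<^bsub>G\<^esub> (\<eta> \<mu>)" "b = s \<kappa> \<otimes>\<^bsub>A\<^esub>
        star A (s \<mu>)"
      by blast
    \<comment> \<open>\<open>y\<close> and \<open>z\<close> are the scalars of the deformed product
      and involution; being unimodular, their product can be inverted.\<close>
    define y where "y = \<sigma> (\<eta> \<kappa>) (inv\<^bsub>G\<^esub> (\<eta> \<mu>))"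
    define z where "z = cnj (\<sigma> (\<eta> \<mu>) (inv\<^bsub>G\<^esub> (\<eta> \<mu>)))"
    have b: "b \<in> Bf g" by (rule subsetD[OF span_subset_Bf linear_span.base[OF base]])
    have st: "star A (s \<mu>) \<in> Bf (inv\<^bsub>G\<^esub> (\<eta> \<mu>))" using Bf_star[OF s_in_Bf] * by simp
    have "t \<kappa> \<otimes>\<^bsub>C\<^esub> star C (t \<mu>) = t \<kappa> \<otimes>\<^bsub>C\<^esub> (z \<odot>\<^bsub>C\<^esub> \<pi> (star A (s \<mu>), inv\<^bsub>G\<^esub> (\<eta> \<mu>)))"
      using \<pi>_star[OF s_in_Bf, of \<mu>] * by (simp add: t_def z_def)
    also have "\<dots> = z \<odot>\<^bsub>C\<^esub> (y \<odot>\<^bsub>C\<^esub> \<pi> (b, g))"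
      using \<pi>_mult[OF s_in_Bf st, of \<kappa>] \<pi>_closed[OF s_in_Bf, of \<kappa>] \<pi>_closed[OF st] *
      by (simp add: C.mult_smult_right t_def y_def)
    finally have eq: "t \<kappa> \<otimes>\<^bsub>C\<^esub> star C (t \<mu>) = (z * y) \<odot>\<^bsub>C\<^esub> \<pi> (b, g)" using \<pi>_closed[OF b g] by simp
    have "cmod (z * y) = 1" using * \<sigma>_norm by (simp add: z_def y_def Real_Vector_Spaces.norm_mult)
    then have "z * y \<noteq> 0" by auto
    then have "inverse (z * y) * (z * y) = 1" by (rule left_inverse)
    then have "\<pi> (b, g) = inverse (z * y) \<odot>\<^bsub>C\<^esub> (t \<kappa> \<otimes>\<^bsub>C\<^esub> star C (t \<mu>))"
      unfolding eq using \<pi>_closed[OF b g] by (simp only: C.scale_scale C.scale_one)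
    moreover have "t \<kappa> \<otimes>\<^bsub>C\<^esub> star C (t \<mu>) \<in> ?S" using *(1,2) by blast
    ultimately show ?case by (simp only: linear_span.scale[OF linear_span.base])
  next
    case zero
    show ?case using \<pi>_zero[OF g] linear_span.zero by simp
  next
    case (add x y)
    then show ?case
      unfolding \<pi>_add[OF subsetD[OF span_subset_Bf add.hyps(1)] subsetD[OF span_subset_Bf add.hyps(2)] g]
      by (intro linear_span.add)
  next
    case (scale x z)
    then show ?case
      unfolding \<pi>_scale[OF subsetD[OF span_subset_Bf scale.hyps(1)] g] by (intro linear_span.scale)
  qed
  show ?thesis
    unfolding C.closed_span_iff[OF S]
  proof (intro conjI allI impI \<pi>_closed[OF a g])
    fix \<epsilon> :: real assume "\<epsilon> > 0"
    then obtain b where b: "b \<in> linear_span A (fibre_gens g)" "nrm A (a \<ominus>\<^bsub>A\<^esub> b) < \<epsilon> / 2"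
      using a unfolding graph_fibre_def A.closed_span_iff[OF gens_subset] by (meson half_gt_zero)
    have bB: "b \<in> Bf g" using span_subset_Bf b(1) by blast
    have "nrm C (\<pi> (a, g) \<ominus>\<^bsub>C\<^esub> \<pi> (b, g)) \<le> 2 * nrm A (a \<ominus>\<^bsub>A\<^esub> b)"
      using norm_\<pi>_le[OF A.submodule_diff[OF Bf_submodule a bB] g] \<pi>_diff[OF a bB g] by simp
    then show "\<exists>y\<in>linear_span C ?S. nrm C (\<pi> (a, g) \<ominus>\<^bsub>C\<^esub> y) < \<epsilon>"
      using span[OF b(1)] b(2) by (intro bexI[of _ "\<pi> (b, g)"]) auto
  qed
qed

text \<open>By \<open>\<pi>_in_closed_span\<close> the closed span contains the generating set, and
  it is a C*-subalgebra.\<close>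

lemma closed_span_eq_carrier:
  assumes "cstar_generates C (\<pi> ` carrier (deformed_bundle G \<sigma> (graph_bundle \<Lambda> G \<eta> A s)))"
  shows "closed_span C {t \<kappa> \<otimes>\<^bsub>C\<^esub> star C (t \<mu>) |\<kappa> \<mu>. \<kappa> \<in> paths \<Lambda> \<and> \<mu> \<in> paths \<Lambda>} = carrier C"
proof -
  have "\<pi> ` carrier (deformed_bundle G \<sigma> (graph_bundle \<Lambda> G \<eta> A s)) \<subseteq>
      closed_span C {t \<kappa> \<otimes>\<^bsub>C\<^esub> star C (t \<mu>) |\<kappa> \<mu>. \<kappa> \<in> paths \<Lambda> \<and> \<mu> \<in> paths \<Lambda>}"
    using \<pi>_in_closed_span by (auto simp: deformed_bundle_def graph_bundle_def)
  then show ?thesis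
    using assms twisted_family.cstar_subalgebra_span[OF twisted] unfolding cstar_generates_def by blast
qed

end

theorem corollary5p5:
  fixes k :: nat and \<Lambda> :: "'l kgraph" and G :: "('g, 'm) monoid_scheme"
    and \<eta> :: "'l \<Rightarrow> 'g" and \<sigma> :: "'g \<Rightarrow> 'g \<Rightarrow> complex"
    and A :: "'a cstar" and s :: "'l \<Rightarrow> 'a"
    and B :: "('g, 'a \<times> 'g) fell"
    and C :: "'c cstar" and \<pi> :: "'a \<times> 'g \<Rightarrow> 'c"
  assumes "k_graph k \<Lambda>" and "row_finite_no_sources k \<Lambda>"
    and "kgraph_aperiodic k \<Lambda>" and "kgraph_cofinal k \<Lambda>"
    and "Group.group G" and "kgraph_functor \<Lambda> G \<eta>" and "\<sigma> \<in> cocycles G"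
    and "is_graph_cstar k \<Lambda> A s"
    and "fell_bundle G B" and "B = graph_bundle \<Lambda> G \<eta> A s"
    and "is_bundle_cstar G (deformed_bundle G \<sigma> B) C \<pi>"
  shows "simple_cstar_algebra C"
proof -
  have A: "cstar_algebra A" "cuntz_krieger_family k \<Lambda> A s"
    using assms(8) by (auto simp: is_graph_cstar_def)
  have C: "cstar_algebra C" "fell_representation G (deformed_bundle G \<sigma> B) C \<pi>"
    "cstar_generates C (\<pi> ` carrier (deformed_bundle G \<sigma> B))"
    using assms(11) by (auto simp: is_bundle_cstar_def)
  interpret deformed_graph_bundle_rep A C k \<Lambda> G s \<eta> \<sigma> \<pi>
    using A C assms
    by (intro deformed_graph_bundle_rep.intro deformed_graph_bundle_rep_axioms.intro) auto
  show ?thesis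
    using twisted_family.simple_if_aperiodic_cofinal[OF twisted assms(3,4)] closed_span_eq_carrier
        C(3) assms(10)
    by simp
qed

end
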